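(* Let $\Sigma_n(P_1,P_0,\mathcal H,\widetilde W_B,\widetilde W_C)$ be a hyperbolic boundary control system satisfying the standing assumptions (1)–(5) and such that there exist $K,M\in\mathbb K^{n\times n}$ with $K$ invertible and $$\widetilde W_B=K\begin{pmatrix}Q_+-MQ_-&Q_--MQ_+\end{pmatrix}.$$ Let $\alpha\in\mathbb R$ be such that $\mathbb C_\alpha\subset\rho(\widetilde A)$. Then for $s\in\rho(A)\cap\mathbb C_\alpha$ the transfer function is given by $$\mathbf G(s)=\mathbf Z(s)\left(\mathbb 1_n-M\mathbf U(s)\right)^{-1}K^{-1},\qquad\text{where}\quad \mathbf Z(s)=\widetilde W_C\begin{bmatrix}\Psi_b^s\\\mathbb 1_n\end{bmatrix}\mathbf V(s)^{-1}.$$ This holds in particular on $\mathbb C_{\widetilde\alpha}\subset\rho(A)\cap\mathbb C_\alpha$ for some $\widetilde\alpha\ge\alpha$.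
   Context: Let $\mathbb K\in\{\mathbb R,\mathbb C\}$, $a<b$, $n\ge1$, $\mathbb 1_n$ the $n\times n$ identity matrix, and $\mathbb C_\alpha=\{z\in\mathbb C:\mathrm{Re}\,z>\alpha\}$. **hBCS.** $\Sigma_n(P_1,P_0,\mathcal H,\widetilde W_B,\widetilde W_C)$ denotes the system on $[a,b]\times[0,\infty)$ with state $x(\xi,t)\in\mathbb K^n$, input $u(t)\in\mathbb K^n$, output $y(t)\in\mathbb K^n$: $$\tfrac{\partial x}{\partial t}(\xi,t)=P_1\tfrac{\partial}{\partial\xi}(\mathcal H(\xi)x(\xi,t))+P_0(\xi)\mathcal H(\xi)x(\xi,t),\quad x(\xi,0)=x_0(\xi),$$ $$u(t)=\widetilde W_B\begin{bmatrix}(\mathcal Hx)(b,t)\\(\mathcal Hx)(a,t)\end{bmatrix},\qquad y(t)=\widetilde W_C\begin{bmatrix}(\mathcal Hx)(b,t)\\(\mathcal Hx)(a,t)\end{bmatrix}.$$ **Standing assumptions.** (1) $P_1\in\mathbb K^{n\times n}$ is invertible and self-adjoint. (2) $P_0\in L^\infty([a,b],\mathbb K^{n\times n})$. (3) $\mathcal H\in L^\infty([a,b],\mathbb K^{n\times n})$, $\mathcal H(\xi)$ is self-adjoint and $m_0\mathbb 1_n\le\mathcal H(\xi)\le M_0\mathbb 1_n$ for a.e. $\xi$, for some constants $m_0,M_0>0$. (4) $\widetilde W_B\in\mathbb K^{n\times2n}$ and $\begin{bmatrix}\widetilde W_B\\\widetilde W_C\end{bmatrix}\in\mathbb K^{2n\times2n}$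 have full rank. (5) The operator $Ax_0=P_1\frac{\partial}{\partial\xi}(\mathcal Hx_0)+P_0\mathcal Hx_0$ with domain $\{x_0\in X:\mathcal Hx_0\in H^1([a,b],\mathbb K^n),\ \widetilde W_B\begin{bmatrix}(\mathcal Hx_0)(b)\\(\mathcal Hx_0)(a)\end{bmatrix}=0\}$ generates a $C_0$-semigroup on $X=L^2([a,b],\mathbb K^n)$ with inner product $\langle f,g\rangle_X=\frac12\int_a^bg^*\mathcal Hf\,d\xi$. Resolvent sets $\rho(\cdot)$ are taken for the complexification if $\mathbb K=\mathbb R$. **Transfer function.** For $s\in\rho(A)$, $\mathbf G(s)$ is the unique $n\times n$ matrix such that for every $u_0$ the (unique) $x_0$ with $\mathcal Hx_0\in H^1$ satisfying $$sx_0(\xi)=P_1\tfrac{d}{d\xi}(\mathcal H(\xi)x_0(\xi))+P_0(\xi)\mathcal H(\xi)x_0(\xi),\qquad u_0=\widetilde W_B\begin{bmatrix}(\mathcal Hx_0)(b)\\(\mathcal Hx_0)(a)\end{bmatrix}$$ satisfies $\mathbf G(s)u_0=\widetilde W_C\begin{bmatrix}(\mathcal Hx_0)(b)\\(\mathcal Hx_0)(a)\end{bmatrix}$. **Fundamental solution.** For $s\in\mathbb C$, $\zeta\mapsto\Psi_\zeta^s$ is the continuous $n\times n$-matrix-valued fundamental solution on $[a,b]$ of $v'(\zeta)=-P_1^{-1}\left(P_0(\zeta)-s\mathcal H^{-1}(\zeta)\right)v(\zeta)$ with $\Psi_a^s=\mathbb 1_n$. **$Q_\pm$.** Let $E_+$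 (resp. $E_-$) be the span of the eigenvectors of $P_1$ to positive (resp. negative) eigenvalues, so $\mathbb K^n=E_+\oplus E_-$, and $\iota_\pm:E_\pm\to\mathbb K^n$ the canonical embeddings. Put $P_1^\pm=\iota_\pm^*(\pm P_1)\iota_\pm:E_\pm\to E_\pm$ (strictly positive self-adjoint) and $Q_\pm=\iota_\pm(P_1^\pm)^{1/2}\iota_\pm^*\in\mathbb K^{n\times n}$. **$\widetilde A$, $\mathbf V$, $\mathbf U$.** $\widetilde A$ is the operator given by the same expression as $A$ but with $\widetilde W_B$ replaced by $\begin{bmatrix}Q_+&Q_-\end{bmatrix}$ in its domain; it generates a $C_0$-semigroup on $X$, so some $\mathbb C_\alpha$ is contained in $\rho(\widetilde A)$, and $Q_-+Q_+\Psi_b^s$ is invertible for $s\in\rho(\widetilde A)$. For $s\in\mathbb C_\alpha$ define $\mathbf V(s)=Q_-+Q_+\Psi_b^s$ and $\mathbf U(s)=(Q_++Q_-\Psi_b^s)\mathbf V(s)^{-1}$. *)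

theory Defs
  imports "HOL-Analysis.Analysis"
begin

text \<open>
  The scalar field is a set \<open>F\<close> of complex numbers, either \<open>\<real>\<close> or \<open>UNIV\<close>. Vectors and matrices over it
  are complex vectors and matrices whose entries lie in \<open>F\<close>. An index of type \<open>'n + 'n\<close> runs over
  \<open>2n\<close> positions, first the \<open>Inl\<close> block and then the \<open>Inr\<close> block.
\<close>

definition Fvec :: "complex set \<Rightarrow> (complex^'n) set" where
  "Fvec F = {v. \<forall>i. v $ i \<in> F}"

definition Fmat :: "complex set \<Rightarrow> (complex^'n^'m) set" where
  "Fmat F = {A. \<forall>i j. A $ i $ j \<in> F}"

definition vstack :: "'a^'n \<Rightarrow> 'a^'m \<Rightarrow> 'a^('n + 'm)" where
  "vstack u v = (\<chi> i. case i of Inl k \<Rightarrow> u $ k | Inr k \<Rightarrow> v $ k)"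

definition hblock :: "'a^'n^'k \<Rightarrow> 'a^'m^'k \<Rightarrow> 'a^('n + 'm)^'k" where
  "hblock A B = (\<chi> i. vstack (A $ i) (B $ i))"

definition vblock :: "'a^'k^'n \<Rightarrow> 'a^'k^'m \<Rightarrow> 'a^'k^('n + 'm)" where
  "vblock A B = vstack A B"

definition cinner :: "complex^'n \<Rightarrow> complex^'n \<Rightarrow> complex" where
  "cinner v w = (\<Sum>i\<in>UNIV. cnj (w $ i) * v $ i)"

definition self_adjoint :: "complex^'n^'n \<Rightarrow> bool" where
  "self_adjoint A \<longleftrightarrow> (\<chi> i j. cnj (A $ j $ i)) = A"

definition loewner_le :: "complex set \<Rightarrow> complex^'n^'n \<Rightarrow> complex^'n^'n \<Rightarrow> bool" where
  "loewner_le F A B \<longleftrightarrow> (\<forall>v \<in> Fvec F. 0 \<le> Re (cinner ((B - A) *v v) v))"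

definition right_half_plane :: "real \<Rightarrow> complex set" where
  "right_half_plane \<alpha> = {z. Re z > \<alpha>}"


text \<open>
  Elements of \<open>L\<^sup>2\<close> and \<open>L\<^sup>\<infinity>\<close> are represented by functions; two functions stand for the same element iff they
  agree almost everywhere on \<open>{a..b}\<close>. All notions below are invariant under this identification.
\<close>

type_synonym 'n state = "real \<Rightarrow> complex^'n"

definition L2 :: "complex set \<Rightarrow> real \<Rightarrow> real \<Rightarrow> ('n::finite) state set" where
  "L2 F a b = {f. f \<in> borel_measurable (lebesgue_on {a..b}) \<and>
                  integrable (lebesgue_on {a..b}) (\<lambda>\<xi>. (norm (f \<xi>))\<^sup>2) \<and>
                  (AE \<xi> in lebesgue_on {a..b}. f \<xi> \<in> Fvec F)}"

definition Linf_mat :: "complex set \<Rightarrow> real \<Rightarrow> real \<Rightarrow> (real \<Rightarrow> complex^'n^'n::finite) set" where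
  "Linf_mat F a b = {P. P \<in> borel_measurable (lebesgue_on {a..b}) \<and>
                  (\<exists>C. AE \<xi> in lebesgue_on {a..b}. norm (P \<xi>) \<le> C) \<and>
                  (AE \<xi> in lebesgue_on {a..b}. P \<xi> \<in> Fmat F)}"

text \<open>
  \<open>H1 F a b w w'\<close>: the function \<open>w\<close> is absolutely continuous on \<open>{a..b}\<close> with derivative
  \<open>w'\<close> in \<open>L\<^sup>2\<close>, that is, \<open>w\<close> is the continuous representative of an element of \<open>H\<^sup>1\<close>. Boundary values
  of elements of \<open>H\<^sup>1\<close> are those of this representative.
\<close>

definition H1 :: "complex set \<Rightarrow> real \<Rightarrow> real \<Rightarrow> ('n::finite) state \<Rightarrow> 'n state \<Rightarrow> bool" where
  "H1 F a b w w' \<longleftrightarrow> w' \<in> L2 F a b \<and> w a \<in> Fvec F \<and>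
     (\<forall>\<xi>\<in>{a..b}. w \<xi> = w a + (LINT \<tau>|lebesgue_on {a..\<xi>}. w' \<tau>))"

definition X_inner ::
  "real \<Rightarrow> real \<Rightarrow> (real \<Rightarrow> complex^'n^'n) \<Rightarrow> 'n state \<Rightarrow> ('n::finite) state \<Rightarrow> complex" where
  "X_inner a b H f g = 1/2 * (LINT \<xi>|lebesgue_on {a..b}. cinner (H \<xi> *v f \<xi>) (g \<xi>))"

definition X_norm :: "real \<Rightarrow> real \<Rightarrow> (real \<Rightarrow> complex^'n^'n) \<Rightarrow> ('n::finite) state \<Rightarrow> real" where
  "X_norm a b H f = sqrt (Re (X_inner a b H f f))"


text \<open>
  Operators are graphs. A space is a carrier \<open>X\<close> with a seminorm \<open>nrm\<close>, and equality of elements is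
  \<open>nrm (f - g) = 0\<close>; since \<open>T t\<close> is linear and bounded, it respects this equality.
\<close>

definition C0_semigroup ::
  "complex set \<Rightarrow> 'n state set \<Rightarrow> ('n state \<Rightarrow> real) \<Rightarrow> (real \<Rightarrow> 'n state \<Rightarrow> ('n::finite) state) \<Rightarrow> bool"
  where
  "C0_semigroup F X nrm T \<longleftrightarrow>
     (\<forall>t\<ge>0. \<forall>f\<in>X. T t f \<in> X) \<and>
     (\<forall>t\<ge>0. \<forall>f\<in>X. \<forall>g\<in>X. \<forall>c\<in>F. \<forall>d\<in>F.
        nrm (\<lambda>\<xi>. T t (\<lambda>\<eta>. c *s f \<eta> + d *s g \<eta>) \<xi> - (c *s T t f \<xi> + d *s T t g \<xi>)) = 0) \<and>
     (\<forall>t\<ge>0. \<exists>C. \<forall>f\<in>X. nrm (T t f) \<le> C * nrm f) \<and>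
     (\<forall>f\<in>X. nrm (\<lambda>\<xi>. T 0 f \<xi> - f \<xi>) = 0) \<and>
     (\<forall>t\<ge>0. \<forall>r\<ge>0. \<forall>f\<in>X. nrm (\<lambda>\<xi>. T (t + r) f \<xi> - T t (T r f) \<xi>) = 0) \<and>
     (\<forall>f\<in>X. ((\<lambda>t. nrm (\<lambda>\<xi>. T t f \<xi> - f \<xi>)) \<longlongrightarrow> 0) (at_right 0))"

definition generator ::
  "'n state set \<Rightarrow> ('n state \<Rightarrow> real) \<Rightarrow> (real \<Rightarrow> 'n state \<Rightarrow> 'n state) \<Rightarrow> ('n state \<times> ('n::finite) state) set"
  where
  "generator X nrm T = {(f, g). f \<in> X \<and> g \<in> X \<and>
     ((\<lambda>t. nrm (\<lambda>\<xi>. (1/t) *\<^sub>R (T t f \<xi> - f \<xi>) - g \<xi>)) \<longlongrightarrow> 0) (at_right 0)}"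

definition generates_C0_semigroup ::
  "complex set \<Rightarrow> 'n state set \<Rightarrow> ('n state \<Rightarrow> real) \<Rightarrow> ('n state \<times> ('n::finite) state) set \<Rightarrow> bool" where
  "generates_C0_semigroup F X nrm A \<longleftrightarrow> (\<exists>T. C0_semigroup F X nrm T \<and> generator X nrm T = A)"

definition complexification ::
  "complex set \<Rightarrow> ('n state \<times> 'n state) set \<Rightarrow> ('n state \<times> ('n::finite) state) set" where
  "complexification F A = (if F = \<real>
     then {(\<lambda>\<xi>. f1 \<xi> + \<i> *s f2 \<xi>, \<lambda>\<xi>. g1 \<xi> + \<i> *s g2 \<xi>) | f1 f2 g1 g2. (f1, g1) \<in> A \<and> (f2, g2) \<in> A}
     else A)"

text \<open>
  Surjectivity of \<open>s - A\<close>, and injectivity together with boundedness of the inverse.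
\<close>

definition resolvent_set ::
  "'n state set \<Rightarrow> ('n state \<Rightarrow> real) \<Rightarrow> ('n state \<times> ('n::finite) state) set \<Rightarrow> complex set" where
  "resolvent_set X nrm A = {s.
     (\<forall>g\<in>X. \<exists>(f, h)\<in>A. nrm (\<lambda>\<xi>. (s *s f \<xi> - h \<xi>) - g \<xi>) = 0) \<and>
     (\<exists>C. \<forall>(f, h)\<in>A. nrm f \<le> C * nrm (\<lambda>\<xi>. s *s f \<xi> - h \<xi>))}"


definition hbcs_operator ::
  "complex set \<Rightarrow> real \<Rightarrow> real \<Rightarrow> complex^'n^'n \<Rightarrow> (real \<Rightarrow> complex^'n^'n) \<Rightarrow> (real \<Rightarrow> complex^'n^'n) \<Rightarrow>
   complex^('n + 'n)^'n \<Rightarrow> ('n state \<times> ('n::finite) state) set" where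
  "hbcs_operator F a b P1 P0 H W = {(f, g). f \<in> L2 F a b \<and> g \<in> L2 F a b \<and>
     (\<exists>w w'. H1 F a b w w' \<and>
        (AE \<xi> in lebesgue_on {a..b}. H \<xi> *v f \<xi> = w \<xi>) \<and>
        W *v vstack (w b) (w a) = 0 \<and>
        (AE \<xi> in lebesgue_on {a..b}. g \<xi> = P1 *v w' \<xi> + P0 \<xi> *v (H \<xi> *v f \<xi>)))}"

definition hbcs_resolvent_set ::
  "complex set \<Rightarrow> real \<Rightarrow> real \<Rightarrow> complex^'n^'n \<Rightarrow> (real \<Rightarrow> complex^'n^'n) \<Rightarrow> (real \<Rightarrow> complex^'n^'n) \<Rightarrow>
   complex^('n + 'n)^('n::finite) \<Rightarrow> complex set" where
  "hbcs_resolvent_set F a b P1 P0 H W =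
     resolvent_set (L2 UNIV a b) (X_norm a b H) (complexification F (hbcs_operator F a b P1 P0 H W))"

locale hbcs =
  fixes F :: "complex set" and a b :: real
    and P1 :: "complex^'n^('n::finite)"
    and P0 H :: "real \<Rightarrow> complex^'n^'n"
    and WB WC :: "complex^('n + 'n)^'n"
  assumes field: "F = \<real> \<or> F = UNIV"
    and interval: "a < b"
    and P1_mat: "P1 \<in> Fmat F"
    and P1_invertible: "invertible P1"
    and P1_self_adjoint: "self_adjoint P1"
    and P0_Linf: "P0 \<in> Linf_mat F a b"
    and H_Linf: "H \<in> Linf_mat F a b"
    and H_self_adjoint: "AE \<xi> in lebesgue_on {a..b}. self_adjoint (H \<xi>)"
    and H_bounds: "\<exists>m0>0. \<exists>M0>0. AE \<xi> in lebesgue_on {a..b}.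
          loewner_le F (mat (complex_of_real m0)) (H \<xi>) \<and> loewner_le F (H \<xi>) (mat (complex_of_real M0))"
    and WB_mat: "WB \<in> Fmat F"
    and WC_mat: "WC \<in> Fmat F"
    and WB_full_rank: "rank WB = CARD('n)"
    and WB_WC_full_rank: "rank (vblock WB WC) = 2 * CARD('n)"
    and generates: "generates_C0_semigroup F (L2 F a b) (X_norm a b H) (hbcs_operator F a b P1 P0 H WB)"


text \<open>
  \<open>bvp_solution a b P1 P0 H WB s u0 f w\<close>: the function \<open>f\<close> is a complex solution \<open>x\<^sub>0\<close> of the boundary
  value problem defining the transfer function, and \<open>w\<close> is the continuous representative of \<open>\<H> x\<^sub>0\<close>.
\<close>

definition bvp_solution ::
  "real \<Rightarrow> real \<Rightarrow> complex^'n^'n \<Rightarrow> (real \<Rightarrow> complex^'n^'n) \<Rightarrow> (real \<Rightarrow> complex^'n^'n) \<Rightarrow>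
   complex^('n + 'n)^'n \<Rightarrow> complex \<Rightarrow> complex^'n \<Rightarrow> 'n state \<Rightarrow> ('n::finite) state \<Rightarrow> bool" where
  "bvp_solution a b P1 P0 H WB s u0 f w \<longleftrightarrow> f \<in> L2 UNIV a b \<and>
     (\<exists>w'. H1 UNIV a b w w' \<and>
        (AE \<xi> in lebesgue_on {a..b}. H \<xi> *v f \<xi> = w \<xi>) \<and>
        (AE \<xi> in lebesgue_on {a..b}. s *s f \<xi> = P1 *v w' \<xi> + P0 \<xi> *v (H \<xi> *v f \<xi>)) \<and>
        u0 = WB *v vstack (w b) (w a))"

definition transfer_function ::
  "real \<Rightarrow> real \<Rightarrow> complex^'n^'n \<Rightarrow> (real \<Rightarrow> complex^'n^'n) \<Rightarrow> (real \<Rightarrow> complex^'n^'n) \<Rightarrow>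
   complex^('n + 'n)^'n \<Rightarrow> complex^('n + 'n)^('n::finite) \<Rightarrow> complex \<Rightarrow> complex^'n^'n" where
  "transfer_function a b P1 P0 H WB WC s = (THE G. \<forall>u0. \<exists>f w.
     bvp_solution a b P1 P0 H WB s u0 f w \<and>
     (\<forall>f' w'. bvp_solution a b P1 P0 H WB s u0 f' w' \<longrightarrow> (AE \<xi> in lebesgue_on {a..b}. f' \<xi> = f \<xi>)) \<and>
     G *v u0 = WC *v vstack (w b) (w a))"

text \<open>
  The coefficients are only essentially bounded, so the differential equation is understood almost everywhere
  for absolutely continuous functions, i.e. as an integral equation. This determines the solution on
  \<open>{a..b}\<close>; values elsewhere are irrelevant.
\<close>

definition is_fundamental_solution ::
  "real \<Rightarrow> real \<Rightarrow> complex^'n^'n \<Rightarrow> (real \<Rightarrow> complex^'n^'n) \<Rightarrow> (real \<Rightarrow> complex^'n^'n) \<Rightarrow>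
   complex \<Rightarrow> (real \<Rightarrow> complex^'n^('n::finite)) \<Rightarrow> bool" where
  "is_fundamental_solution a b P1 P0 H s \<Phi> \<longleftrightarrow> continuous_on {a..b} \<Phi> \<and>
     (\<forall>\<zeta>\<in>{a..b}. \<Phi> \<zeta> = mat 1 +
        (LINT \<tau>|lebesgue_on {a..\<zeta>}. - (matrix_inv P1 ** (P0 \<tau> - mat s ** matrix_inv (H \<tau>)) ** \<Phi> \<tau>)))"

definition fundamental_solution ::
  "real \<Rightarrow> real \<Rightarrow> complex^'n^'n \<Rightarrow> (real \<Rightarrow> complex^'n^'n) \<Rightarrow> (real \<Rightarrow> complex^'n^'n) \<Rightarrow>
   complex \<Rightarrow> real \<Rightarrow> complex^'n^('n::finite)" where
  "fundamental_solution a b P1 P0 H s = (SOME \<Phi>. is_fundamental_solution a b P1 P0 H s \<Phi>)"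


text \<open>
  \<open>Q_mat F P1 \<sigma>\<close> is \<open>Q\<^sub>+\<close> for \<open>\<sigma> = 1\<close> and \<open>Q\<^sub>-\<close> for \<open>\<sigma> = -1\<close>; \<open>embed_adj E\<close> is the adjoint of
  the embedding of the subspace \<open>E\<close>, i.e. the orthogonal projection onto \<open>E\<close>.
\<close>

definition Fspan :: "complex set \<Rightarrow> (complex^'n) set \<Rightarrow> (complex^'n) set" where
  "Fspan F B = {\<Sum>v\<in>t. c v *s v | t c. finite t \<and> t \<subseteq> B \<and> (\<forall>v\<in>t. c v \<in> F)}"

definition E_space :: "complex set \<Rightarrow> complex^'n^'n \<Rightarrow> real \<Rightarrow> (complex^'n) set" where
  "E_space F P1 \<sigma> =
     Fspan F {v \<in> Fvec F. v \<noteq> 0 \<and> (\<exists>\<mu>::real. \<sigma> * \<mu> > 0 \<and> P1 *v v = complex_of_real \<mu> *s v)}"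

definition embed_adj :: "(complex^'n) set \<Rightarrow> complex^'n \<Rightarrow> complex^'n" where
  "embed_adj E v = (THE p. p \<in> E \<and> (\<forall>e\<in>E. cinner p e = cinner v e))"

definition is_pos_sqrt_on ::
  "complex set \<Rightarrow> (complex^'n) set \<Rightarrow> (complex^'n \<Rightarrow> complex^'n) \<Rightarrow> (complex^'n \<Rightarrow> complex^'n) \<Rightarrow> bool" where
  "is_pos_sqrt_on F E T S \<longleftrightarrow>
     (\<forall>x\<in>E. S x \<in> E) \<and>
     (\<forall>x\<in>E. \<forall>y\<in>E. \<forall>c\<in>F. \<forall>d\<in>F. S (c *s x + d *s y) = c *s S x + d *s S y) \<and>
     (\<forall>x\<in>E. \<forall>y\<in>E. cinner (S x) y = cinner x (S y)) \<and>
     (\<forall>x\<in>E. 0 \<le> Re (cinner (S x) x)) \<and>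
     (\<forall>x\<in>E. S (S x) = T x)"

definition Q_mat :: "complex set \<Rightarrow> complex^'n^'n \<Rightarrow> real \<Rightarrow> complex^'n^'n" where
  "Q_mat F P1 \<sigma> = (let E = E_space F P1 \<sigma>; P1\<sigma> = (\<lambda>x. embed_adj E (\<sigma> *\<^sub>R (P1 *v x))) in
     THE Q. Q \<in> Fmat F \<and>
       (\<exists>S. is_pos_sqrt_on F E P1\<sigma> S \<and> (\<forall>v\<in>Fvec F. Q *v v = S (embed_adj E v))))"

abbreviation Q_plus :: "complex set \<Rightarrow> complex^'n^'n \<Rightarrow> complex^'n^'n" where
  "Q_plus F P1 \<equiv> Q_mat F P1 1"

abbreviation Q_minus :: "complex set \<Rightarrow> complex^'n^'n \<Rightarrow> complex^'n^'n" where
  "Q_minus F P1 \<equiv> Q_mat F P1 (- 1)"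

definition V_fun ::
  "complex set \<Rightarrow> real \<Rightarrow> real \<Rightarrow> complex^'n^'n \<Rightarrow> (real \<Rightarrow> complex^'n^'n) \<Rightarrow> (real \<Rightarrow> complex^'n^'n) \<Rightarrow>
   complex \<Rightarrow> complex^'n^('n::finite)" where
  "V_fun F a b P1 P0 H s = Q_minus F P1 + Q_plus F P1 ** fundamental_solution a b P1 P0 H s b"

definition U_fun ::
  "complex set \<Rightarrow> real \<Rightarrow> real \<Rightarrow> complex^'n^'n \<Rightarrow> (real \<Rightarrow> complex^'n^'n) \<Rightarrow> (real \<Rightarrow> complex^'n^'n) \<Rightarrow>
   complex \<Rightarrow> complex^'n^('n::finite)" where
  "U_fun F a b P1 P0 H s =
     (Q_plus F P1 + Q_minus F P1 ** fundamental_solution a b P1 P0 H s b) ** matrix_inv (V_fun F a b P1 P0 H s)"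

definition Z_fun ::
  "complex set \<Rightarrow> real \<Rightarrow> real \<Rightarrow> complex^'n^'n \<Rightarrow> (real \<Rightarrow> complex^'n^'n) \<Rightarrow> (real \<Rightarrow> complex^'n^'n) \<Rightarrow>
   complex^('n + 'n)^'n \<Rightarrow> complex \<Rightarrow> complex^'n^('n::finite)" where
  "Z_fun F a b P1 P0 H WC s =
     WC ** vblock (fundamental_solution a b P1 P0 H s b) (mat 1) ** matrix_inv (V_fun F a b P1 P0 H s)"

end

theory Submission
  imports Defs
begin

text \<open>
  Write \<open>\<Psi>\<close> for the fundamental solution. Every solution \<open>w = \<H> x\<^sub>0\<close> of the homogeneous
  equation is \<open>\<Psi> v\<close> with \<open>v = w a\<close>, so a boundary operator \<open>W\<close> acts on solutions through the
  matrix \<open>N\<^sub>W s = W [\<Psi>\<^sub>b; 1]\<close>. By variation of constants, \<open>s\<close> lies in the resolvent set of the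
  operator with boundary condition \<open>W\<close> iff \<open>N\<^sub>W s\<close> is invertible, and then the transfer function is
  \<open>W\<^sub>C [\<Psi>\<^sub>b; 1] (N\<^sub>W s)\<^sup>-\<^sup>1\<close>. For \<open>[Q\<^sub>+ Q\<^sub>-]\<close> this matrix is \<open>V\<close>, for \<open>W\<^sub>B\<close> it is
  \<open>K (1 - M U) V\<close>, which gives the formula.

  That some right half plane lies in the resolvent set then only requires that \<open>A\<close> has no
  eigenvalues of large real part. The eigenspace of \<open>s\<close> is finite-dimensional and invariant under
  the semigroup \<open>T\<close>, hence \<open>\<parallel>T h f - f - h s f\<parallel> \<le> h \<parallel>f\<parallel>\<close> on it for all small \<open>h\<close>. Iterating
  with \<open>h = 1/n\<close>, \<open>\<parallel>T 1 f\<parallel> \<ge> (1 + (Re s - 1)/n)\<^sup>n \<parallel>f\<parallel> \<ge> Re s \<parallel>f\<parallel>\<close>, so \<open>Re s\<close> is at most the norm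
  of \<open>T 1\<close> or \<open>1\<close>.

  In the real case the semigroup and the operator are complexified first; this needs that
  \<open>Q\<^sub>\<pm>\<close> are real.
\<close>

section \<open>Vectors and matrices\<close>

interpretation matrix_vector_mult: bounded_bilinear
  "(*v) :: 'a::{euclidean_space,real_algebra_1}^'n^'m \<Rightarrow> 'a^'n \<Rightarrow> 'a^'m"
  unfolding bilinear_conv_bounded_bilinear[symmetric] bilinear_def
  by (auto intro!: linearI simp: matrix_vector_mult_def vec_eq_iff algebra_simps sum.distrib
      scaleR_sum_right)

interpretation matrix_matrix_mult: bounded_bilinear
  "(**) :: 'a::{euclidean_space,real_algebra_1}^'n^'m \<Rightarrow> 'a^'k^'n \<Rightarrow> 'a^'k^'m"
  unfolding bilinear_conv_bounded_bilinear[symmetric] bilinear_def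
  by (auto intro!: linearI simp: matrix_matrix_mult_def vec_eq_iff algebra_simps sum.distrib
      scaleR_sum_right)

lemma mat_mult_vec: "mat s *v x = s *s (x :: 'a::semiring_1^'n)"
  by (simp add: vec_eq_iff matrix_vector_mult_def mat_def if_distrib if_distribR cong: if_cong)

lemma matrix_vector_mult_axis: "A *v axis j (1 :: 'a::semiring_1) = column j A"
  by (simp add: vec_eq_iff matrix_vector_mult_def column_def axis_def if_distrib cong: if_cong)

lemma of_real_vector_smult: "complex_of_real r *s v = r *\<^sub>R v"
  by (simp add: vec_eq_iff) (simp add: scaleR_conv_of_real)

lemma norm_vector_smult: "norm (c *s v) = norm c * norm (v :: 'a::real_normed_field^'n)"
  by (simp add: norm_vec_def L2_set_def norm_mult power_mult_distrib real_sqrt_mult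
      flip: sum_distrib_left)

lemma bounded_linear_vector_smult: "bounded_linear ((*s) c :: complex^'n \<Rightarrow> complex^'n)"
  by (rule bounded_linear_intro[where K="norm c"])
    (auto simp: vec_eq_iff algebra_simps norm_vector_smult)

lemma norm_matrix_le:
  fixes A :: "complex^'n^'m"
  assumes "\<And>x. norm (A *v x) \<le> c * norm x"
  shows "norm A \<le> real (CARD('m) * CARD('n)) * c"
proof -
  have entry: "norm (A $ i $ j) \<le> c" for i j
  proof -
    have "norm (A $ i $ j) \<le> norm (A *v axis j 1)"
      using Finite_Cartesian_Product.norm_nth_le[of "column j A" i]
      by (simp add: matrix_vector_mult_axis column_def)
    also have "\<dots> \<le> c" using assms[of "axis j 1"] by simp
    finally show ?thesis .
  qed
  have "norm A \<le> (\<Sum>i\<in>UNIV. norm (A $ i))"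
    unfolding norm_vec_def[of A] by (rule L2_set_le_sum) simp
  also have "\<dots> \<le> (\<Sum>i\<in>UNIV. \<Sum>j\<in>UNIV. norm (A $ i $ j))"
    unfolding norm_vec_def[of "A $ _"] by (intro sum_mono L2_set_le_sum) simp
  also have "\<dots> \<le> (\<Sum>i\<in>(UNIV :: 'm set). \<Sum>j\<in>(UNIV :: 'n set). c)"
    by (intro sum_mono entry)
  finally show ?thesis by simp
qed

lemma inner_eq_Re_cinner: "x \<bullet> y = Re (cinner x y)"
  by (simp add: inner_vec_def cinner_def inner_complex_def algebra_simps)

lemma cinner_vector_smult: "cinner (c *s x) (c *s y) = complex_of_real ((cmod c)\<^sup>2) * cinner x y"
proof -
  have "cinner (c *s x) (c *s y) = (c * cnj c) * cinner x y"
    by (simp add: cinner_def sum_distrib_left mult_ac)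
  then show ?thesis unfolding complex_norm_square .
qed

lemma bounded_bilinear_cinner: "bounded_bilinear cinner"
  unfolding bilinear_conv_bounded_bilinear[symmetric] bilinear_def
  by (auto intro!: linearI simp: cinner_def algebra_simps sum.distrib scaleR_sum_right)

lemma self_adjoint_inner:
  assumes "self_adjoint A"
  shows "(A *v x) \<bullet> y = x \<bullet> (A *v y)"
proof -
  have entries: "cnj (A $ j $ i) = A $ i $ j" for i j
    using assms by (simp add: self_adjoint_def vec_eq_iff)
  have "cinner (A *v x) y = (\<Sum>i\<in>UNIV. \<Sum>j\<in>UNIV. cnj (y $ i) * (A $ i $ j * x $ j))"
    by (simp add: cinner_def matrix_vector_mult_def sum_distrib_left)
  also have "\<dots> = (\<Sum>j\<in>UNIV. \<Sum>i\<in>UNIV. cnj (y $ i) * (A $ i $ j * x $ j))"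
    by (rule sum.swap)
  also have "\<dots> = cinner x (A *v y)"
    by (simp add: cinner_def matrix_vector_mult_def sum_distrib_right sum_distrib_left entries
        ac_simps)
  finally show ?thesis by (simp add: inner_eq_Re_cinner)
qed

lemma sum_UNIV_Plus:
  fixes f :: "'n::finite + 'm::finite \<Rightarrow> 'a::comm_monoid_add"
  shows "sum f UNIV = (\<Sum>k\<in>UNIV. f (Inl k)) + (\<Sum>k\<in>UNIV. f (Inr k))"
  using sum.Plus[of "UNIV::'n set" "UNIV::'m set" f] by (simp add: UNIV_Plus_UNIV o_def)

lemma hblock_mult_vstack:
  fixes A :: "'a::semiring_1^'n::finite^'k" and B :: "'a^'m::finite^'k"
  shows "hblock A B *v vstack x y = A *v x + B *v y"
  by (simp add: hblock_def vstack_def matrix_vector_mult_def vec_eq_iff sum_UNIV_Plus)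

lemma vblock_mult_vec: "vblock A B *v x = vstack (A *v x) (B *v x)"
  by (auto simp: vblock_def vstack_def matrix_vector_mult_def vec_eq_iff split: sum.split)

lemma vstack_add: "vstack (u + u') (v + v') = vstack u v + vstack u' v'"
  by (auto simp: vstack_def vec_eq_iff split: sum.split)

lemma vstack_smult: "vstack (c *s u) (c *s v) = c *s vstack u v"
  by (auto simp: vstack_def vec_eq_iff split: sum.split)

lemma bounded_linear_vstack_zero:
  "bounded_linear (\<lambda>u :: 'a::euclidean_space^'n::finite. vstack u (0 :: 'a^'m::finite))"
  unfolding linear_conv_bounded_linear[symmetric]
  by (auto intro!: linearI simp: vstack_def vec_eq_iff split: sum.split)

lemma matrix_inv:
  assumes "invertible A"
  shows matrix_inv_right: "A ** matrix_inv A = mat 1"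
    and matrix_inv_left: "matrix_inv A ** A = mat 1"
  using someI_ex[OF assms[unfolded invertible_def]] by (auto simp: matrix_inv_def)

lemma matrix_inv_vector:
  fixes A :: "'a::semiring_1^'n^'n"
  assumes "invertible A"
  shows "A *v (matrix_inv A *v x) = x" "matrix_inv A *v (A *v x) = x"
  using matrix_inv[OF assms] by (simp_all add: matrix_vector_mul_assoc)

lemma invertible_mult_vec_eq_iff:
  fixes A :: "'a::semiring_1^'n^'n"
  assumes "invertible A"
  shows "A *v x = y \<longleftrightarrow> x = matrix_inv A *v y"
  using matrix_inv_vector[OF assms] by metis

lemma matrix_inv_unique:
  fixes A B :: "'a::semiring_1^'n^'n"
  assumes "A ** B = mat 1" "B ** A = mat 1"
  shows "matrix_inv A = B"
proof -
  have "invertible A" using assms by (auto simp: invertible_def)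
  then have "matrix_inv A = matrix_inv A ** (A ** B)" by (simp add: assms)
  also have "\<dots> = B"
    by (simp add: matrix_mul_assoc matrix_inv_left \<open>invertible A\<close>)
  finally show ?thesis .
qed

lemma matrix_inv_mult:
  fixes A B :: "'a::semiring_1^'n^'n"
  assumes "invertible A" "invertible B"
  shows "matrix_inv (A ** B) = matrix_inv B ** matrix_inv A"
proof (rule matrix_inv_unique)
  note A = matrix_inv[OF assms(1)] and B = matrix_inv[OF assms(2)]
  show "A ** B ** (matrix_inv B ** matrix_inv A) = mat 1"
    by (metis A(1) B(1) matrix_mul_assoc matrix_mul_rid)
  show "matrix_inv B ** matrix_inv A ** (A ** B) = mat 1"
    by (metis A(2) B(2) matrix_mul_assoc matrix_mul_rid)
qed

lemma invertible_iff_ker: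
  fixes A :: "'a::field^'n^'n"
  shows "invertible A \<longleftrightarrow> (\<forall>x. A *v x = 0 \<longrightarrow> x = 0)"
  using invertible_left_inverse[of A] matrix_left_invertible_ker[of A] by blast

lemma matrix_inv_cramer:
  fixes A :: "'a::field^'n^'n"
  assumes "det A \<noteq> 0"
  shows "matrix_inv A $ k $ l = det (\<chi> i j. if j = k then axis l 1 $ i else A $ i $ j) / det A"
proof -
  have "A *v (matrix_inv A *v axis l 1) = axis l 1"
    using assms by (intro matrix_inv_vector) (simp add: invertible_det_nz)
  then have "matrix_inv A *v axis l 1 =
      (\<chi> k. det (\<chi> i j. if j = k then axis l 1 $ i else A $ i $ j) / det A)"
    using cramer[OF assms] by blast
  then show ?thesis by (simp add: vec_eq_iff matrix_vector_mult_axis column_def)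
qed


section \<open>Measurability of matrix operations\<close>

lemma borel_measurable_vec_nth:
  fixes f :: "'a \<Rightarrow> 'b::euclidean_space^'n"
  assumes "f \<in> borel_measurable M"
  shows "(\<lambda>x. f x $ i) \<in> borel_measurable M"
  by (rule borel_measurable_continuous_on[OF _ assms])
    (intro linear_continuous_on bounded_linear_vec_nth)

lemma borel_measurable_vecI:
  fixes f :: "'a \<Rightarrow> 'b::euclidean_space^'n"
  assumes "\<And>i. (\<lambda>x. f x $ i) \<in> borel_measurable M"
  shows "f \<in> borel_measurable M"
  using assms by (subst borel_measurable_euclidean_space) (auto simp: Basis_vec_def inner_axis)

lemma borel_measurable_bounded_linear:
  fixes L :: "'b::{second_countable_topology,real_normed_vector} \<Rightarrow> 'c::real_normed_vector"
  assumes "bounded_linear L" "f \<in> borel_measurable M"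
  shows "(\<lambda>x. L (f x)) \<in> borel_measurable M"
  by (rule borel_measurable_continuous_on[OF linear_continuous_on[OF assms(1)] assms(2)])

lemma borel_measurable_bounded_bilinear:
  fixes prod :: "'b::{second_countable_topology,real_normed_vector} \<Rightarrow>
    'c::{second_countable_topology,real_normed_vector} \<Rightarrow> 'd::real_normed_vector"
  assumes "bounded_bilinear prod" "f \<in> borel_measurable M" "g \<in> borel_measurable M"
  shows "(\<lambda>x. prod (f x) (g x)) \<in> borel_measurable M"
  by (rule borel_measurable_continuous_Pair[OF assms(2,3)])
    (intro bounded_bilinear.continuous_on[OF assms(1)] continuous_intros)

lemma borel_measurable_det:
  fixes A :: "'a \<Rightarrow> complex^'n^'n"
  assumes "A \<in> borel_measurable M"
  shows "(\<lambda>x. det (A x)) \<in> borel_measurable M"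
proof -
  have [measurable]: "(\<lambda>x. A x $ i $ j) \<in> borel_measurable M" for i j
    using assms by (intro borel_measurable_vec_nth)
  show ?thesis unfolding det_def by measurable
qed

text \<open>
  On singular matrices \<^const>\<open>matrix_inv\<close> has a single junk value, because the predicate that
  it chooses from is then constantly false.
\<close>

lemma borel_measurable_matrix_inv:
  fixes A :: "'a \<Rightarrow> complex^'n^'n"
  assumes A: "A \<in> borel_measurable M"
  shows "(\<lambda>x. matrix_inv (A x)) \<in> borel_measurable M"
proof -
  let ?minor = "\<lambda>B :: complex^'n^'n. \<lambda>l k. \<chi> i j. if j = k then axis l 1 $ i else B $ i $ j"
  let ?junk = "SOME B :: complex^'n^'n. False"
  have entry [measurable]: "(\<lambda>x. A x $ i $ j) \<in> borel_measurable M" for i j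
    using assms by (intro borel_measurable_vec_nth)
  have [measurable]: "(\<lambda>x. det (A x)) \<in> borel_measurable M"
    by (rule borel_measurable_det[OF A])
  have [measurable]: "(\<lambda>x. det (?minor (A x) l k)) \<in> borel_measurable M" for l k
    by (intro borel_measurable_det borel_measurable_vecI) (auto simp: axis_def)
  have singular: "matrix_inv B = ?junk" if "det B = 0" for B :: "complex^'n^'n"
  proof -
    have "(\<lambda>B'. B ** B' = mat 1 \<and> B' ** B = mat 1) = (\<lambda>_. False)"
      using that invertible_det_nz[of B] by (auto simp: invertible_def)
    then show ?thesis by (simp add: matrix_inv_def)
  qed
  have "matrix_inv B $ k $ l = (if det B = 0 then ?junk $ k $ l else det (?minor B l k) / det B)"
    for B :: "complex^'n^'n" and k l
    by (simp add: singular matrix_inv_cramer)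
  then have "(\<lambda>x. matrix_inv (A x) $ k $ l) \<in> borel_measurable M" for k l
    by simp
  then show ?thesis by (intro borel_measurable_vecI)
qed


section \<open>Real vectors inside complex vectors\<close>

lemma Fmat_UNIV [simp]: "A \<in> Fmat UNIV"
  by (simp add: Fmat_def)

lemma Fvec_UNIV [simp]: "v \<in> Fvec UNIV"
  by (simp add: Fvec_def)

lemma subspace_Fvec_Reals: "subspace (Fvec \<real>)"
  by (auto simp: subspace_def Fvec_def scaleR_conv_of_real[where 'a=complex])

lemma axis_Fvec_Reals: "axis j 1 \<in> Fvec \<real>"
  by (simp add: Fvec_def axis_def)

lemma matrix_vector_mult_Fvec_Reals:
  assumes "A \<in> Fmat \<real>" "v \<in> Fvec \<real>"
  shows "A *v v \<in> Fvec \<real>"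
  using assms
  by (auto simp: Fmat_def Fvec_def matrix_vector_mult_def intro!: sum_in_Reals Reals_mult)

lemma cinner_Fvec_Reals:
  assumes "x \<in> Fvec \<real>" "y \<in> Fvec \<real>"
  shows "cinner x y = complex_of_real (x \<bullet> y)"
proof -
  have "cinner x y \<in> \<real>"
    unfolding cinner_def using assms
    by (auto simp: Fvec_def Reals_cnj_iff intro!: sum_in_Reals Reals_mult)
  then show ?thesis by (simp add: inner_eq_Re_cinner)
qed

lemma matrix_eq_on_Fvec_Reals:
  fixes A B :: "complex^'n^'m"
  assumes "\<And>v. v \<in> Fvec \<real> \<Longrightarrow> A *v v = B *v v"
  shows "A = B"
proof -
  have "column j A = column j B" for j
    using assms[OF axis_Fvec_Reals] by (simp add: matrix_vector_mult_axis)
  then show ?thesis by (simp add: vec_eq_iff column_def)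
qed

lemma linear_Fvec_Reals_matrix:
  fixes f :: "complex^'n \<Rightarrow> complex^'m"
  assumes "linear f" "f ` Fvec \<real> \<subseteq> Fvec \<real>"
  obtains A where "A \<in> Fmat \<real>" "\<And>v. v \<in> Fvec \<real> \<Longrightarrow> A *v v = f v"
proof
  let ?A = "\<chi> i j. f (axis j 1) $ i"
  show "?A \<in> Fmat \<real>"
    using assms(2) axis_Fvec_Reals by (force simp: Fmat_def Fvec_def)
  fix v :: "complex^'n" assume "v \<in> Fvec \<real>"
  then have v: "v $ j = complex_of_real (Re (v $ j))" for j by (simp add: Fvec_def)
  have "v = (\<Sum>j\<in>UNIV. v $ j *s axis j 1)" by (simp add: basis_expansion)
  also have "\<dots> = (\<Sum>j\<in>UNIV. Re (v $ j) *\<^sub>R axis j 1)"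
    by (subst v) (simp add: of_real_vector_smult)
  finally have "f v = (\<Sum>j\<in>UNIV. Re (v $ j) *\<^sub>R f (axis j 1))"
    by (metis (no_types, lifting) assms(1) linear_sum linear_scale sum.cong)
  then have "f v $ i = (\<Sum>j\<in>UNIV. f (axis j 1) $ i * v $ j)" for i
    by (subst v) (simp add: scaleR_conv_of_real[where 'a=complex] mult.commute)
  then show "?A *v v = f v" by (simp add: vec_eq_iff matrix_vector_mult_def)
qed

lemma Fspan_Reals: "Fspan \<real> B = span B"
proof (intro subset_antisym subsetI)
  fix x assume "x \<in> Fspan \<real> B"
  then obtain t c where t: "x = (\<Sum>v\<in>t. c v *s v)" "t \<subseteq> B" "\<forall>v\<in>t. c v \<in> \<real>"
    by (auto simp: Fspan_def)
  then have "x = (\<Sum>v\<in>t. Re (c v) *\<^sub>R v)"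
    by (auto intro!: sum.cong simp flip: of_real_vector_smult)
  also have "\<dots> \<in> span B" using t by (intro span_sum span_scale span_base) auto
  finally show "x \<in> span B" .
next
  fix x assume "x \<in> span B"
  then obtain t r where "x = (\<Sum>v\<in>t. r v *\<^sub>R v)" "t \<subseteq> B" "finite t"
    by (auto simp: span_explicit)
  then have "x = (\<Sum>v\<in>t. complex_of_real (r v) *s v) \<and> finite t \<and> t \<subseteq> B \<and>
      (\<forall>v\<in>t. complex_of_real (r v) \<in> \<real>)"
    by (simp add: of_real_vector_smult)
  then show "x \<in> Fspan \<real> B" unfolding Fspan_def mem_Collect_eq
    by (intro exI[of _ t] exI[of _ "\<lambda>v. complex_of_real (r v)"])
qed

definition re_vec :: "complex^'n \<Rightarrow> complex^'n" where
  "re_vec v = (\<chi> i. complex_of_real (Re (v $ i)))"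

definition im_vec :: "complex^'n \<Rightarrow> complex^'n" where
  "im_vec v = (\<chi> i. complex_of_real (Im (v $ i)))"

lemma re_vec_add_im_vec: "re_vec v + \<i> *s im_vec v = v"
  by (simp add: re_vec_def im_vec_def vec_eq_iff complex_eq_iff)

lemma im_vec_eq_re_vec: "im_vec v = re_vec ((- \<i>) *s v)"
  by (simp add: re_vec_def im_vec_def)

lemma re_vec_Fvec [simp]: "re_vec v \<in> Fvec \<real>"
  by (simp add: re_vec_def Fvec_def)

lemma im_vec_Fvec [simp]: "im_vec v \<in> Fvec \<real>"
  by (simp add: im_vec_def Fvec_def)

lemma re_vec_Reals_pair:
  assumes "x \<in> Fvec \<real>" "y \<in> Fvec \<real>"
  shows "re_vec (x + \<i> *s y) = x" "im_vec (x + \<i> *s y) = y"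
  using assms
  by (auto simp: re_vec_def im_vec_def vec_eq_iff complex_eq_iff Fvec_def complex_is_Real_iff)

lemma norm_re_vec_le: "norm (re_vec v) \<le> norm v"
  by (auto simp: re_vec_def norm_vec_def abs_Re_le_cmod intro!: L2_set_mono)

lemma bounded_linear_re_vec: "bounded_linear re_vec"
  by (rule bounded_linear_intro[where K=1])
    (simp_all add: norm_re_vec_le, simp_all add: re_vec_def vec_eq_iff complex_eq_iff)

lemma re_vec_matrix_vector_mult:
  assumes "A \<in> Fmat \<real>"
  shows "re_vec (A *v v) = A *v re_vec v"
proof -
  have "Im (A $ i $ j) = 0" for i j
    using assms by (simp add: Fmat_def complex_is_Real_iff)
  then show ?thesis
    by (simp add: re_vec_def matrix_vector_mult_def vec_eq_iff complex_eq_iff)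
qed

lemma re_vec_vstack: "vstack (re_vec x) (re_vec y) = re_vec (vstack x y)"
  by (auto simp: re_vec_def vstack_def vec_eq_iff split: sum.split)

lemma inner_re_vec_im_vec:
  fixes A :: "complex^'n^'n"
  assumes "A \<in> Fmat \<real>"
  shows "(A *v v) \<bullet> v = (A *v re_vec v) \<bullet> re_vec v + (A *v im_vec v) \<bullet> im_vec v"
proof -
  have mixed: "x \<bullet> (\<i> *s y) = 0" if "x \<in> Fvec \<real>" "y \<in> Fvec \<real>" for x y :: "complex^'n"
    using that by (simp add: inner_vec_def inner_complex_def Fvec_def complex_is_Real_iff)
  have imaginary: "(\<i> *s x) \<bullet> (\<i> *s y) = x \<bullet> y" for x y :: "complex^'n"
    by (simp add: inner_vec_def inner_complex_def add.commute)
  have real: "A *v re_vec v \<in> Fvec \<real>" "A *v im_vec v \<in> Fvec \<real>"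
    using assms by (simp_all add: matrix_vector_mult_Fvec_Reals)
  have "(A *v v) \<bullet> v =
      (A *v re_vec v + \<i> *s (A *v im_vec v)) \<bullet> (re_vec v + \<i> *s im_vec v)"
    by (metis re_vec_add_im_vec matrix_vector_right_distrib vector_scalar_commute)
  also have "\<dots> = (A *v re_vec v) \<bullet> re_vec v + (A *v im_vec v) \<bullet> im_vec v"
    using mixed[OF real(1), of "im_vec v"] mixed[OF _ real(2), of "re_vec v"]
    by (simp add: inner_add_left inner_add_right imaginary inner_commute)
  finally show ?thesis .
qed

lemma norm_re_vec_im_vec: "(norm v)\<^sup>2 = (norm (re_vec v))\<^sup>2 + (norm (im_vec v))\<^sup>2"
proof -
  have "mat 1 \<in> Fmat \<real>" by (simp add: Fmat_def mat_def)
  from inner_re_vec_im_vec[OF this, of v] show ?thesis by (simp add: dot_square_norm)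
qed


section \<open>Operators diagonal in an orthonormal set\<close>

locale orthonormal_set =
  fixes B :: "'a::euclidean_space set"
  assumes orthogonal: "pairwise orthogonal B"
    and normalized: "c \<in> B \<Longrightarrow> norm c = 1"
begin

lemma finite_B: "finite B"
proof -
  have "0 \<notin> B" using normalized by force
  then have "independent B" by (rule pairwise_orthogonal_independent[OF orthogonal])
  then show ?thesis by (rule independent_imp_finite)
qed

lemma inner_basis: "c \<in> B \<Longrightarrow> d \<in> B \<Longrightarrow> c \<bullet> d = (if c = d then 1 else 0)"
  using orthogonal normalized
  by (auto simp: pairwise_def orthogonal_def dot_square_norm)

definition diagonal :: "('a \<Rightarrow> real) \<Rightarrow> 'a \<Rightarrow> 'a" where
  "diagonal r x = (\<Sum>c\<in>B. (r c * (x \<bullet> c)) *\<^sub>R c)"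

lemma diagonal_in_span: "diagonal r x \<in> span B"
  unfolding diagonal_def by (intro span_sum span_scale span_base)

lemma linear_diagonal: "linear (diagonal r)"
  by (auto intro!: linearI
      simp: diagonal_def inner_add_left algebra_simps sum.distrib scaleR_sum_right)

lemma diagonal_inner_basis: "c \<in> B \<Longrightarrow> diagonal r x \<bullet> c = r c * (x \<bullet> c)"
  by (simp add: diagonal_def inner_sum_left inner_basis finite_B if_distrib cong: if_cong)

lemma diagonal_basis: "c \<in> B \<Longrightarrow> diagonal r c = r c *\<^sub>R c"
  by (simp add: diagonal_def inner_basis finite_B if_distrib if_distribR cong: if_cong)

lemma diagonal_diagonal: "diagonal r (diagonal q x) = diagonal (\<lambda>c. r c * q c) x"
  unfolding diagonal_def[of r] diagonal_def[of "\<lambda>c. r c * q c"]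
  by (simp add: diagonal_inner_basis mult.assoc)

lemma diagonal_one: "x \<in> span B \<Longrightarrow> diagonal (\<lambda>_. 1) x = x"
  unfolding diagonal_def
  using orthonormal_basis_expand[OF orthogonal normalized _ finite_B] by simp

lemma diagonal_symmetric: "diagonal r x \<bullet> y = x \<bullet> diagonal r y"
  by (auto simp: diagonal_def inner_sum_left inner_sum_right inner_commute intro!: sum.cong)

lemma diagonal_nonneg:
  assumes "\<And>c. c \<in> B \<Longrightarrow> 0 \<le> r c"
  shows "0 \<le> diagonal r x \<bullet> x"
proof -
  have "diagonal r x \<bullet> x = (\<Sum>c\<in>B. r c * (x \<bullet> c)\<^sup>2)"
    unfolding diagonal_def inner_sum_left
    by (auto simp: power2_eq_square inner_commute intro!: sum.cong)
  also have "\<dots> \<ge> 0" by (intro sum_nonneg mult_nonneg_nonneg assms) auto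
  finally show ?thesis .
qed

lemma diagonal_sqrt_unique:
  assumes closed: "\<And>x. x \<in> span B \<Longrightarrow> S x \<in> span B"
    and lincomb: "\<And>x y r t. x \<in> span B \<Longrightarrow> y \<in> span B \<Longrightarrow>
      S (r *\<^sub>R x + t *\<^sub>R y) = r *\<^sub>R S x + t *\<^sub>R S y"
    and nonneg: "\<And>x. x \<in> span B \<Longrightarrow> 0 \<le> S x \<bullet> x"
    and square: "\<And>x. x \<in> span B \<Longrightarrow> S (S x) = diagonal (\<lambda>c. q c * q c) x"
    and q: "\<And>c. c \<in> B \<Longrightarrow> 0 < q c"
    and x: "x \<in> span B"
  shows "S x = diagonal q x"
proof -
  have basis: "S c = diagonal q c" if c: "c \<in> B" for c
  proof -
    have span: "c \<in> span B" "S c \<in> span B" using c by (auto intro: closed span_base)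
    define y where "y = 1 *\<^sub>R S c + (- q c) *\<^sub>R c"
    have y: "y \<in> span B" unfolding y_def using span by (intro span_add span_scale)
    have "S y = 1 *\<^sub>R S (S c) + (- q c) *\<^sub>R S c"
      unfolding y_def by (rule lincomb) (use span in auto)
    also have "\<dots> = (- q c) *\<^sub>R y"
      using c span by (simp add: square diagonal_basis y_def algebra_simps)
    finally have "q c * (y \<bullet> y) \<le> 0" using nonneg[OF y] by simp
    then have "y = 0" using q[OF c] by (simp add: dot_square_norm mult_le_0_iff)
    then show ?thesis using c by (simp add: y_def diagonal_basis)
  qed
  have "linear (\<lambda>x. S (diagonal (\<lambda>_. 1) x))"
    using lincomb[OF diagonal_in_span diagonal_in_span, where r=1 and t=1]
      lincomb[OF diagonal_in_span diagonal_in_span, where t=0]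
    by (auto intro!: linearI simp: linear_add[OF linear_diagonal]
        linear_scale[OF linear_diagonal])
  then have "S (diagonal (\<lambda>_. 1) x) = diagonal q x"
    by (rule linear_eq_on_span[OF _ linear_diagonal _ x]) (simp add: diagonal_one span_base basis)
  then show ?thesis using x by (simp add: diagonal_one)
qed

end

lemma symmetric_orthonormal_eigenbasis:
  fixes A :: "'a::euclidean_space \<Rightarrow> 'a"
  assumes A: "linear A" "\<And>x y. A x \<bullet> y = x \<bullet> A y" and V: "subspace V"
  obtains B where "orthonormal_set B" "\<And>c. c \<in> B \<Longrightarrow> c \<in> V \<and> (\<exists>\<mu>\<in>\<Lambda>. A c = \<mu> *\<^sub>R c)"
    "span B = span {v \<in> V. \<exists>\<mu>\<in>\<Lambda>. A v = \<mu> *\<^sub>R v}"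
proof -
  define E where "E \<mu> = {v \<in> V. A v = \<mu> *\<^sub>R v}" for \<mu>
  have "subspace (E \<mu>)" for \<mu>
    using A(1) V
    by (auto simp: E_def subspace_def linear_0 linear_add linear_scale scaleR_add_right)
  then have "\<exists>b \<subseteq> E \<mu>. pairwise orthogonal b \<and> (\<forall>c\<in>b. norm c = 1) \<and> span b = E \<mu>" for \<mu>
    by (metis orthonormal_basis_subspace)
  then obtain b where b: "\<And>\<mu>. b \<mu> \<subseteq> E \<mu>" "\<And>\<mu>. pairwise orthogonal (b \<mu>)"
      "\<And>\<mu> c. c \<in> b \<mu> \<Longrightarrow> norm c = 1" "\<And>\<mu>. span (b \<mu>) = E \<mu>"
    by metis
  have distinct: "orthogonal x y" if "x \<in> E \<mu>" "y \<in> E \<nu>" "\<mu> \<noteq> \<nu>" for x y \<mu> \<nu>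
    using that A(2)[of x y] by (simp add: E_def orthogonal_def)
  show thesis
  proof (rule that[of "\<Union>\<mu>\<in>\<Lambda>. b \<mu>"])
    show "orthonormal_set (\<Union>\<mu>\<in>\<Lambda>. b \<mu>)"
    proof
      show "pairwise orthogonal (\<Union>\<mu>\<in>\<Lambda>. b \<mu>)"
        using b(1,2) distinct unfolding pairwise_def by (metis UN_E subsetD)
    qed (use b(3) in auto)
    show "c \<in> V \<and> (\<exists>\<mu>\<in>\<Lambda>. A c = \<mu> *\<^sub>R c)" if "c \<in> (\<Union>\<mu>\<in>\<Lambda>. b \<mu>)" for c
      using that b(1) by (force simp: E_def)
    have E: "{v \<in> V. \<exists>\<mu>\<in>\<Lambda>. A v = \<mu> *\<^sub>R v} = (\<Union>\<mu>\<in>\<Lambda>. E \<mu>)" by (auto simp: E_def)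
    have "E \<mu> \<subseteq> span (\<Union>\<mu>\<in>\<Lambda>. b \<mu>)" if "\<mu> \<in> \<Lambda>" for \<mu>
      using that span_mono[of "b \<mu>" "\<Union>\<mu>\<in>\<Lambda>. b \<mu>"] b(4) by auto
    then have "span (\<Union>\<mu>\<in>\<Lambda>. E \<mu>) \<subseteq> span (\<Union>\<mu>\<in>\<Lambda>. b \<mu>)"
      by (intro span_minimal UN_least subspace_span)
    moreover have "span (\<Union>\<mu>\<in>\<Lambda>. b \<mu>) \<subseteq> span (\<Union>\<mu>\<in>\<Lambda>. E \<mu>)"
      by (intro span_mono UN_mono b(1)) auto
    ultimately show "span (\<Union>\<mu>\<in>\<Lambda>. b \<mu>) = span {v \<in> V. \<exists>\<mu>\<in>\<Lambda>. A v = \<mu> *\<^sub>R v}"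
      unfolding E by (rule subset_antisym[rotated])
  qed
qed


section \<open>The matrices \<open>Q\<^sub>\<pm>\<close> over the reals\<close>

lemma E_space_Reals_eigenbasis:
  assumes "self_adjoint P"
  obtains B m where "orthonormal_set B" "B \<subseteq> Fvec \<real>" "E_space \<real> P \<sigma> = span B"
    "\<And>c. c \<in> B \<Longrightarrow> \<sigma> * m c > 0 \<and> P *v c = m c *\<^sub>R c"
proof -
  let ?\<Lambda> = "{\<mu>. \<sigma> * \<mu> > 0}"
  let ?E = "{v \<in> Fvec \<real>. \<exists>\<mu>\<in>?\<Lambda>. P *v v = \<mu> *\<^sub>R v}"
  have "linear ((*v) P)" by (rule bounded_linear.linear) simp
  then obtain B where B: "orthonormal_set B" "span B = span ?E"
      "\<And>c. c \<in> B \<Longrightarrow> c \<in> Fvec \<real> \<and> (\<exists>\<mu>\<in>?\<Lambda>. P *v c = \<mu> *\<^sub>R c)"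
    by (rule symmetric_orthonormal_eigenbasis[OF _ self_adjoint_inner[OF assms]
        subspace_Fvec_Reals, where \<Lambda>="?\<Lambda>"]) (rule that)
  have "E_space \<real> P \<sigma> = span (?E - {0})"
    unfolding E_space_def Fspan_Reals of_real_vector_smult
    by (rule arg_cong[where f=span]) auto
  then have "E_space \<real> P \<sigma> = span B" using B(2) by simp
  moreover obtain m where "\<And>c. c \<in> B \<Longrightarrow> \<sigma> * m c > 0 \<and> P *v c = m c *\<^sub>R c"
    using B(3) by (metis mem_Collect_eq)
  ultimately show thesis using that[of B m] B(1,3) by blast
qed

lemma is_pos_sqrt_on_Reals_iff:
  assumes "E \<subseteq> Fvec \<real>"
  shows "is_pos_sqrt_on \<real> E T S \<longleftrightarrow>
     (\<forall>x\<in>E. S x \<in> E) \<and>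
     (\<forall>x\<in>E. \<forall>y\<in>E. \<forall>r t. S (r *\<^sub>R x + t *\<^sub>R y) = r *\<^sub>R S x + t *\<^sub>R S y) \<and>
     (\<forall>x\<in>E. \<forall>y\<in>E. S x \<bullet> y = x \<bullet> S y) \<and> (\<forall>x\<in>E. 0 \<le> S x \<bullet> x) \<and> (\<forall>x\<in>E. S (S x) = T x)"
proof -
  have "(\<forall>c\<in>\<real>. \<forall>d\<in>\<real>. S (c *s x + d *s y) = c *s S x + d *s S y) \<longleftrightarrow>
      (\<forall>r t. S (r *\<^sub>R x + t *\<^sub>R y) = r *\<^sub>R S x + t *\<^sub>R S y)" for x y
    unfolding of_real_vector_smult[symmetric] by (metis Reals_cases Reals_of_real)
  moreover have "(\<forall>x\<in>E. \<forall>y\<in>E. cinner (S x) y = cinner x (S y)) \<longleftrightarrow>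
      (\<forall>x\<in>E. \<forall>y\<in>E. S x \<bullet> y = x \<bullet> S y)" if "\<forall>x\<in>E. S x \<in> E"
    using assms that by (auto simp: cinner_Fvec_Reals subset_iff)
  ultimately show ?thesis
    unfolding is_pos_sqrt_on_def by (simp add: inner_eq_Re_cinner) blast
qed

locale real_orthonormal_set = orthonormal_set B for B :: "(complex^'n) set" +
  assumes real: "B \<subseteq> Fvec \<real>"
begin

lemma span_subset_Fvec: "span B \<subseteq> Fvec \<real>"
  by (rule span_minimal[OF real subspace_Fvec_Reals])

lemma embed_adj_span:
  assumes "v \<in> Fvec \<real>"
  shows "embed_adj (span B) v = diagonal (\<lambda>_. 1) v"
  unfolding embed_adj_def
proof (rule the_equality)
  let ?p = "diagonal (\<lambda>_. 1) v"
  have p: "cinner ?p e = cinner v e" if "e \<in> span B" for e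
  proof -
    have "?p \<bullet> e = v \<bullet> e" using that by (simp add: diagonal_symmetric diagonal_one)
    then show ?thesis
      using that assms span_subset_Fvec diagonal_in_span[of _ v]
      by (simp add: cinner_Fvec_Reals subset_iff)
  qed
  then show "?p \<in> span B \<and> (\<forall>e\<in>span B. cinner ?p e = cinner v e)"
    using diagonal_in_span by blast
  fix p assume *: "p \<in> span B \<and> (\<forall>e\<in>span B. cinner p e = cinner v e)"
  then have d: "p - ?p \<in> span B" by (intro span_diff diagonal_in_span) auto
  then have "p \<bullet> (p - ?p) = ?p \<bullet> (p - ?p)"
    unfolding inner_eq_Re_cinner using * p[OF d] by simp
  then have "(p - ?p) \<bullet> (p - ?p) = 0" by (simp add: inner_diff_left)
  then show "p = ?p" by simp
qed

lemma is_pos_sqrt_on_span_iff: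
  assumes T: "\<And>x. x \<in> span B \<Longrightarrow> T x = diagonal (\<lambda>c. q c * q c) x"
    and q: "\<And>c. c \<in> B \<Longrightarrow> 0 < q c"
  shows "is_pos_sqrt_on \<real> (span B) T S \<longleftrightarrow> (\<forall>x\<in>span B. S x = diagonal q x)"
proof
  assume "is_pos_sqrt_on \<real> (span B) T S"
  note S = this[unfolded is_pos_sqrt_on_Reals_iff[OF span_subset_Fvec]]
  show "\<forall>x\<in>span B. S x = diagonal q x"
    by (rule ballI, rule diagonal_sqrt_unique) (use S T q in \<open>(blast | metis)+\<close>)
next
  assume S: "\<forall>x\<in>span B. S x = diagonal q x"
  have "0 \<le> diagonal q x \<bullet> x" for x
    by (rule diagonal_nonneg) (use q in \<open>simp add: less_imp_le\<close>)
  then show "is_pos_sqrt_on \<real> (span B) T S"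
    unfolding is_pos_sqrt_on_Reals_iff[OF span_subset_Fvec]
    using S
    by (simp add: T diagonal_in_span diagonal_symmetric diagonal_diagonal span_add span_scale
        linear_add[OF linear_diagonal] linear_scale[OF linear_diagonal])
qed

lemma pos_sqrt_matrix_ex1:
  assumes T: "\<And>x. x \<in> span B \<Longrightarrow> T x = diagonal (\<lambda>c. q c * q c) x"
    and q: "\<And>c. c \<in> B \<Longrightarrow> 0 < q c"
  shows "\<exists>!Q. Q \<in> Fmat \<real> \<and>
    (\<exists>S. is_pos_sqrt_on \<real> (span B) T S \<and> (\<forall>v\<in>Fvec \<real>. Q *v v = S (embed_adj (span B) v)))"
proof -
  have sqrt: "(\<exists>S. is_pos_sqrt_on \<real> (span B) T S \<and> (\<forall>v\<in>Fvec \<real>. Q *v v = S (embed_adj (span B) v)))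
      \<longleftrightarrow> (\<forall>v\<in>Fvec \<real>. Q *v v = diagonal q v)" for Q
    by (subst is_pos_sqrt_on_span_iff[OF T q])
      (auto simp: embed_adj_span diagonal_in_span diagonal_diagonal
        intro!: exI[of _ "diagonal q"])
  obtain Q where Q: "Q \<in> Fmat \<real>" "\<And>v. v \<in> Fvec \<real> \<Longrightarrow> Q *v v = diagonal q v"
    using linear_Fvec_Reals_matrix[OF linear_diagonal, of q] diagonal_in_span span_subset_Fvec
    by (metis image_subset_iff subsetD)
  then show ?thesis
    unfolding sqrt by (intro ex1I[of _ Q]) (auto intro: matrix_eq_on_Fvec_Reals)
qed

end

lemma Q_mat_Reals:
  assumes P: "P \<in> Fmat \<real>" "self_adjoint P"
  shows "Q_mat \<real> P \<sigma> \<in> Fmat \<real>"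
proof -
  obtain B m where B: "orthonormal_set B" "B \<subseteq> Fvec \<real>" and span: "E_space \<real> P \<sigma> = span B"
    and m: "\<And>c. c \<in> B \<Longrightarrow> \<sigma> * m c > 0 \<and> P *v c = m c *\<^sub>R c"
    using E_space_Reals_eigenbasis[OF P(2), of \<sigma>] by metis
  interpret real_orthonormal_set B
    using B by (simp add: real_orthonormal_set_def real_orthonormal_set_axioms_def)
  define q where "q c = sqrt (\<sigma> * m c)" for c
  have q: "0 < q c" "q c * q c = \<sigma> * m c" if "c \<in> B" for c
    using m[OF that] by (simp_all add: q_def)
  have square: "embed_adj (span B) (\<sigma> *\<^sub>R (P *v x)) = diagonal (\<lambda>c. q c * q c) x"
      if "x \<in> span B" for x
  proof -
    have "\<sigma> *\<^sub>R (P *v x) \<in> Fvec \<real>"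
      using that span_subset_Fvec P(1)
      by (intro subspace_scale subspace_Fvec_Reals matrix_vector_mult_Fvec_Reals) auto
    then have "embed_adj (span B) (\<sigma> *\<^sub>R (P *v x)) = diagonal (\<lambda>_. 1) (\<sigma> *\<^sub>R (P *v x))"
      by (rule embed_adj_span)
    also have "\<dots> = diagonal (\<lambda>c. q c * q c) x"
      unfolding diagonal_def by (rule sum.cong) (simp_all add: q self_adjoint_inner[OF P(2)] m)
    finally show ?thesis .
  qed
  show ?thesis
    unfolding Q_mat_def Let_def span
    by (rule the1I2[OF pos_sqrt_matrix_ex1[where q=q]]) (use square q(1) in auto)
qed


section \<open>Integration over compact intervals\<close>

lemma AE_lebesgue_on_subset:
  assumes "AE x in lebesgue_on T. P x" "S \<subseteq> T" "S \<in> sets lebesgue" "T \<in> sets lebesgue"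
  shows "AE x in lebesgue_on S. P x"
  using assms by (auto simp: AE_restrict_space_iff elim!: eventually_mono)

lemma AE_lebesgue_on_IccI: "(\<And>x. x \<in> {a..b} \<Longrightarrow> P x) \<Longrightarrow> AE x in lebesgue_on {a..b::real}. P x"
  by (rule AE_I2) simp

lemma borel_measurable_lebesgue_on_AE:
  fixes f g :: "real \<Rightarrow> 'b::euclidean_space"
  assumes f: "f \<in> borel_measurable (lebesgue_on {a..b})"
    and eq: "AE x in lebesgue_on {a..b}. f x = g x"
  shows "g \<in> borel_measurable (lebesgue_on {a..b})"
proof -
  have "AE x in lebesgue. x \<in> {a..b} \<longrightarrow> f x = g x"
    using eq by (subst (asm) AE_restrict_space_iff) auto
  then have "AE x in lebesgue. (if x \<in> {a..b} then f x else 0) = (if x \<in> {a..b} then g x else 0)"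
    by eventually_elim auto
  with borel_measurable_if_I[OF f]
  have "(\<lambda>x. if x \<in> {a..b} then g x else 0) \<in> borel_measurable lebesgue"
    using borel_measurable_AE by fastforce
  then show ?thesis by (rule borel_measurable_if_D)
qed

lemma continuous_imp_borel_measurable_Icc:
  fixes w :: "real \<Rightarrow> 'a::euclidean_space"
  shows "continuous_on {a..b} w \<Longrightarrow> w \<in> borel_measurable (lebesgue_on {a..b})"
  by (rule continuous_imp_measurable_on_sets_lebesgue) auto

lemma continuous_bounded_Icc:
  fixes w :: "real \<Rightarrow> 'a::real_normed_vector"
  assumes "continuous_on {a..b} w"
  obtains C where "C \<ge> 0" "\<And>x. x \<in> {a..b} \<Longrightarrow> norm (w x) \<le> C"
proof -
  have "bounded (w ` {a..b})" by (intro compact_imp_bounded compact_continuous_image assms) auto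
  then obtain C where "\<forall>x\<in>w ` {a..b}. norm x \<le> C" by (auto simp: bounded_iff)
  then show thesis using that[of "max C 0"] by force
qed

lemma continuous_AE_zero_imp_zero:
  fixes w :: "real \<Rightarrow> 'a::real_normed_vector"
  assumes w: "continuous_on {a..b} w" and ae: "AE x in lebesgue_on {a..b}. w x = 0"
    and ab: "a < b" and x: "x \<in> {a..b}"
  shows "w x = 0"
proof -
  let ?N = "{y \<in> {a<..<b}. w y \<noteq> 0}"
  have "continuous_on {a<..<b} w" by (rule continuous_on_subset[OF w]) auto
  then have "open ({a<..<b} \<inter> w -` (- {0}))"
    by (rule continuous_open_preimage) auto
  also have "{a<..<b} \<inter> w -` (- {0}) = ?N" by auto
  finally have "open ?N" .
  moreover have "negligible ?N"
  proof -
    have "AE y in lebesgue. y \<in> {a..b} \<longrightarrow> w y = 0"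
      using ae by (subst (asm) AE_restrict_space_iff) auto
    then obtain N where N: "N \<in> null_sets lebesgue" "{y. \<not> (y \<in> {a..b} \<longrightarrow> w y = 0)} \<subseteq> N"
      by (auto simp: eventually_ae_filter)
    have "?N \<subseteq> N" using N(2) by auto
    then show ?thesis using N(1) negligible_subset by (metis negligible_iff_null_sets)
  qed
  ultimately have "?N = {}" using open_not_negligible by blast
  moreover have "continuous_on (closure {a<..<b}) w" using w ab by simp
  ultimately show ?thesis
    using continuous_constant_on_closure[of "{a<..<b}" w 0 x] ab x by auto
qed

lemma continuous_on_indefinite_LINT:
  fixes f :: "real \<Rightarrow> 'a::euclidean_space"
  assumes "integrable (lebesgue_on {a..b}) f"
  shows "continuous_on {a..b} (\<lambda>x. LINT t|lebesgue_on {a..x}. f t)"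
proof -
  have "(LINT t|lebesgue_on {a..x}. f t) = integral {a..x} f" if "x \<in> {a..b}" for x
    by (rule lebesgue_integral_eq_integral)
      (use that assms integrable_subinterval[of a b f a x] in auto)
  moreover have "continuous_on {a..b} (\<lambda>x. integral {a..x} f)"
    by (intro indefinite_integral_continuous_1 integrable_on_lebesgue_on[OF assms]) auto
  ultimately show ?thesis by (subst continuous_on_cong[OF refl])
qed

lemma LINT_singleton: "(LINT t|lebesgue_on {a::real}. f t) = (0 :: 'a::euclidean_space)"
  using integral_eq_zero_null_sets[of "{a}"] by simp

lemma
  fixes L :: real
  assumes "L \<noteq> 0" "a \<le> x"
  shows integrable_exp_Icc: "integrable (lebesgue_on {a..x}) (\<lambda>t. exp (L * (t - a)))"
    and integral_exp_Icc: "(LINT t|lebesgue_on {a..x}. exp (L * (t - a))) =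
        (exp (L * (x - a)) - 1) / L"
proof -
  have "(\<lambda>t. exp (L * (t - a))) absolutely_integrable_on {a..x}"
    by (intro absolutely_integrable_continuous_real continuous_intros)
  then show integrable: "integrable (lebesgue_on {a..x}) (\<lambda>t. exp (L * (t - a)))"
    by (simp add: integrable_restrict_space set_integrable_def)
  have "((\<lambda>t. exp (L * (t - a))) has_integral exp (L * (x - a)) / L - exp (L * (a - a)) / L) {a..x}"
    by (rule fundamental_theorem_of_calculus[OF assms(2)])
      (use assms in \<open>auto simp flip: has_real_derivative_iff_has_vector_derivative
          intro!: derivative_eq_intros\<close>)
  then show "(LINT t|lebesgue_on {a..x}. exp (L * (t - a))) = (exp (L * (x - a)) - 1) / L"
    using lebesgue_integral_eq_integral[OF integrable]
    by (auto simp: integral_unique diff_divide_distrib)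
qed


section \<open>Linear Volterra equations\<close>

lemma continuous_on_Icc_bcontfun_family:
  fixes h :: "'u \<Rightarrow> real \<Rightarrow> 'e::metric_space"
  assumes "\<And>u. continuous_on {a..b} (h u)"
  obtains \<Phi> :: "'u \<Rightarrow> (real \<Rightarrow>\<^sub>C 'e)" where "\<And>u x. \<Phi> u x = h u (clamp a b x)"
proof -
  have "\<exists>v :: real \<Rightarrow>\<^sub>C 'e. \<forall>x. v x = h u (clamp a b x)" for u
    using assms[of u]
    by (rule continuous_on_cbox_bcontfunE[of a b "h u", unfolded cbox_interval]) blast
  then show thesis using that by metis
qed

locale linear_volterra = bounded_bilinear prod
  for prod :: "'b::euclidean_space \<Rightarrow> 'e::euclidean_space \<Rightarrow> 'e" +
  fixes a b :: real and A :: "real \<Rightarrow> 'b"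
  assumes interval: "a \<le> b"
    and measurable: "A \<in> borel_measurable (lebesgue_on {a..b})"
    and ess_bounded: "\<exists>C. AE t in lebesgue_on {a..b}. norm (A t) \<le> C"
begin

definition volterra :: "(real \<Rightarrow> 'e) \<Rightarrow> real \<Rightarrow> 'e" where
  "volterra w x = (LINT t|lebesgue_on {a..x}. prod (A t) (w t))"

definition volterra_solution :: "(real \<Rightarrow> 'e) \<Rightarrow> (real \<Rightarrow> 'e) \<Rightarrow> bool" where
  "volterra_solution p w \<longleftrightarrow> continuous_on {a..b} w \<and> (\<forall>x\<in>{a..b}. w x = p x + volterra w x)"

definition weighted_norm_le :: "real \<Rightarrow> (real \<Rightarrow> 'e) \<Rightarrow> real \<Rightarrow> bool" where
  "weighted_norm_le L w m \<longleftrightarrow> (\<forall>x\<in>{a..b}. norm (w x) \<le> m * exp (L * (x - a)))"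

lemma kernel_bound:
  obtains K where "K > 0" "AE t in lebesgue_on {a..b}. \<forall>x. norm (prod (A t) x) \<le> K * norm x"
proof -
  obtain C where C: "AE t in lebesgue_on {a..b}. norm (A t) \<le> C" using ess_bounded by blast
  obtain D where D: "D > 0" "\<And>x y. norm (prod x y) \<le> norm x * norm y * D"
    using pos_bounded by blast
  have "AE t in lebesgue_on {a..b}. \<forall>x. norm (prod (A t) x) \<le> (\<bar>C\<bar> * D + 1) * norm x"
    using C
  proof eventually_elim
    case (elim t)
    have "norm (prod (A t) x) \<le> (\<bar>C\<bar> * D + 1) * norm x" for x
    proof -
      have "norm (prod (A t) x) \<le> \<bar>C\<bar> * norm x * D"
        using D elim by (intro order_trans[OF D(2)] mult_right_mono) auto
      also have "\<dots> \<le> (\<bar>C\<bar> * D + 1) * norm x" by (simp add: algebra_simps)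
      finally show ?thesis .
    qed
    then show ?case ..
  qed
  then show thesis using D(1) by (intro that[of "\<bar>C\<bar> * D + 1"]) (auto intro: add_nonneg_pos)
qed

lemma integrable_kernel:
  assumes w: "continuous_on {a..b} w" and x: "x \<in> {a..b}"
  shows "integrable (lebesgue_on {a..x}) (\<lambda>t. prod (A t) (w t))"
proof -
  interpret finite_measure "lebesgue_on {a..b}" by (rule finite_measure_lebesgue_on) auto
  obtain K where K: "K > 0" "AE t in lebesgue_on {a..b}. \<forall>x. norm (prod (A t) x) \<le> K * norm x"
    by (rule kernel_bound)
  obtain C where C: "\<And>t. t \<in> {a..b} \<Longrightarrow> norm (w t) \<le> C"
    using continuous_bounded_Icc[OF w] by blast
  have "AE t in lebesgue_on {a..b}. t \<in> {a..b}" by (rule AE_lebesgue_on_IccI)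
  with K(2) have "AE t in lebesgue_on {a..b}. norm (prod (A t) (w t)) \<le> K * C"
  proof eventually_elim
    case (elim t)
    then show ?case using C K(1) by (meson mult_left_mono order_trans less_imp_le)
  qed
  then have "integrable (lebesgue_on {a..b}) (\<lambda>t. prod (A t) (w t))"
    by (intro integrable_const_bound[of _ "K * C"]
        borel_measurable_bounded_bilinear[OF bounded_bilinear_axioms measurable]
        continuous_imp_borel_measurable_Icc w)
  then show ?thesis using integrable_subinterval[of a b _ a x] x by auto
qed

lemma continuous_on_volterra: "continuous_on {a..b} w \<Longrightarrow> continuous_on {a..b} (volterra w)"
  unfolding volterra_def[abs_def]
  by (intro continuous_on_indefinite_LINT integrable_kernel) (use interval in auto)

lemma volterra_at_left_end: "volterra w a = 0"
  by (simp add: volterra_def LINT_singleton)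

lemma volterra_diff:
  assumes "continuous_on {a..b} u" "continuous_on {a..b} v" "x \<in> {a..b}"
  shows "volterra (\<lambda>t. u t - v t) x = volterra u x - volterra v x"
  using assms by (simp add: volterra_def diff_right integrable_kernel)

lemma volterra_contraction:
  obtains L where "L > 0"
    "\<And>w m. continuous_on {a..b} w \<Longrightarrow> weighted_norm_le L w m \<Longrightarrow>
        weighted_norm_le L (volterra w) (m / 2)"
proof -
  obtain K where K: "K > 0" "AE t in lebesgue_on {a..b}. \<forall>x. norm (prod (A t) x) \<le> K * norm x"
    by (rule kernel_bound)
  let ?e = "\<lambda>t. exp (2 * K * (t - a))"
  have "norm (volterra w x) \<le> m / 2 * ?e x"
    if w: "continuous_on {a..b} w" and x: "x \<in> {a..b}"
      and bound: "\<And>t. t \<in> {a..b} \<Longrightarrow> norm (w t) \<le> m * ?e t" for w m x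
  proof -
    have "0 \<le> m" using order_trans[OF norm_ge_zero bound[of a]] interval by simp
    have integrand: "AE t in lebesgue_on {a..x}. norm (prod (A t) (w t)) \<le> K * m * ?e t"
    proof -
      have "AE t in lebesgue_on {a..x}. \<forall>y. norm (prod (A t) y) \<le> K * norm y"
        by (rule AE_lebesgue_on_subset[OF K(2)]) (use x in auto)
      moreover have "AE t in lebesgue_on {a..x}. norm (w t) \<le> m * ?e t"
        by (rule AE_lebesgue_on_IccI) (use bound x in auto)
      ultimately show ?thesis
      proof eventually_elim
        case (elim t)
        then have "norm (prod (A t) (w t)) \<le> K * norm (w t)" by blast
        also have "\<dots> \<le> K * (m * ?e t)" using elim K(1) by simp
        finally show ?case by (simp add: mult.assoc)
      qed
    qed
    have "norm (volterra w x) \<le> (LINT t|lebesgue_on {a..x}. norm (prod (A t) (w t)))"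
      unfolding volterra_def by (rule integral_norm_bound)
    also have "\<dots> \<le> (LINT t|lebesgue_on {a..x}. K * m * ?e t)"
      using integrand x K(1)
      by (intro integral_mono_AE integrable_norm integrable_kernel[OF w x] integrable_mult_right
          integrable_exp_Icc) auto
    also have "\<dots> = m / 2 * (?e x - 1)" using K(1) x by (simp add: integral_exp_Icc)
    also have "\<dots> \<le> m / 2 * ?e x" using \<open>0 \<le> m\<close> by (simp add: mult_left_mono)
    finally show ?thesis .
  qed
  then show thesis using that[of "2 * K"] K(1) unfolding weighted_norm_le_def by simp
qed

lemma volterra_solution_bound:
  obtains C where "C \<ge> 0"
    "\<And>w p P x. volterra_solution p w \<Longrightarrow> (\<And>t. t \<in> {a..b} \<Longrightarrow> norm (p t) \<le> P) \<Longrightarrow> x \<in> {a..b} \<Longrightarrow>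
      norm (w x) \<le> C * P"
proof -
  obtain L where L: "L > 0" "\<And>w m. continuous_on {a..b} w \<Longrightarrow> weighted_norm_le L w m \<Longrightarrow>
      weighted_norm_le L (volterra w) (m / 2)"
    by (rule volterra_contraction) (rule that)
  let ?e = "\<lambda>t. exp (L * (t - a))"
  have "norm (w x) \<le> 2 * ?e b * P"
    if sol: "volterra_solution p w" and p: "\<And>t. t \<in> {a..b} \<Longrightarrow> norm (p t) \<le> P" and x: "x \<in> {a..b}"
    for w p P x
  proof -
    have w: "continuous_on {a..b} w" using sol by (simp add: volterra_solution_def)
    define g where "g t = norm (w t) / ?e t" for t
    have "continuous_on {a..b} g" unfolding g_def by (intro continuous_intros w) auto
    then obtain t where t: "t \<in> {a..b}" "\<And>r. r \<in> {a..b} \<Longrightarrow> g r \<le> g t"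
      using continuous_attains_sup[of "{a..b}" g] interval by auto
    have weighted: "norm (w r) \<le> g t * ?e r" if "r \<in> {a..b}" for r
      using t(2)[OF that] by (simp add: g_def field_simps)
    then have "weighted_norm_le L (volterra w) (g t / 2)"
      by (intro L(2) w) (simp add: weighted_norm_le_def)
    then have "norm (volterra w t) \<le> g t / 2 * ?e t" using t(1)
      by (simp add: weighted_norm_le_def)
    moreover have "w t = p t + volterra w t" using sol t(1) unfolding volterra_solution_def
      by blast
    ultimately have "norm (w t) \<le> P + g t / 2 * ?e t"
      using p[OF t(1)] norm_triangle_ineq[of "p t" "volterra w t"] by simp
    then have "g t \<le> P / ?e t + g t / 2" by (simp add: g_def field_simps)
    moreover have "0 \<le> P" using p[OF x] norm_ge_zero order_trans by blast
    moreover from this have "P / ?e t \<le> P / 1" using t L(1) by (intro divide_left_mono) auto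
    ultimately have "g t * ?e x \<le> 2 * P * ?e b"
      using x L(1) by (intro mult_mono) auto
    then show ?thesis using weighted[OF x] by (simp add: mult_ac)
  qed
  then show thesis by (intro that[of "2 * ?e b"]) auto
qed

lemma volterra_solution_unique:
  assumes u: "volterra_solution p u" and v: "volterra_solution p v" and x: "x \<in> {a..b}"
  shows "u x = v x"
proof -
  obtain C where C: "\<And>w p P x. volterra_solution p w \<Longrightarrow>
      (\<And>t. t \<in> {a..b} \<Longrightarrow> norm (p t) \<le> P) \<Longrightarrow> x \<in> {a..b} \<Longrightarrow> norm (w x) \<le> C * P"
    by (rule volterra_solution_bound) metis
  have cont: "continuous_on {a..b} u" "continuous_on {a..b} v"
    using u v by (simp_all add: volterra_solution_def)
  have "u t - v t = 0 + volterra (\<lambda>t. u t - v t) t" if t: "t \<in> {a..b}" for t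
  proof -
    have "u t = p t + volterra u t" "v t = p t + volterra v t"
      using u v t unfolding volterra_solution_def by blast+
    then show ?thesis by (simp add: volterra_diff[OF cont t])
  qed
  then have "volterra_solution (\<lambda>_. 0) (\<lambda>t. u t - v t)"
    by (simp add: volterra_solution_def continuous_on_diff cont)
  then have "norm (u x - v x) \<le> C * 0" by (rule C) (use x in auto)
  then show ?thesis by simp
qed

text \<open>
  The fixed point is taken for \<open>u x = exp (- L * (x - a)) *\<^sub>R w x\<close>, so that the sup norm of
  \<open>u\<close> is the weighted norm of \<open>w\<close>.
\<close>

lemma volterra_solution_exists:
  assumes p: "continuous_on {a..b} p"
  obtains w where "volterra_solution p w"
proof -
  obtain L where L: "L > 0" "\<And>w m. continuous_on {a..b} w \<Longrightarrow> weighted_norm_le L w m \<Longrightarrow>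
      weighted_norm_le L (volterra w) (m / 2)"
    by (rule volterra_contraction) (rule that)
  define e where "e t = exp (L * (t - a))" for t
  have e_pos: "e t > 0" for t by (simp add: e_def)
  define weighted where "weighted u t = e t *\<^sub>R apply_bcontfun u t" for u :: "real \<Rightarrow>\<^sub>C 'e" and t
  have cont: "continuous_on {a..b} (weighted u)" for u
    unfolding weighted_def e_def by (intro continuous_intros continuous_on_apply_bcontfun)
  let ?h = "\<lambda>u x. (p x + volterra (weighted u) x) /\<^sub>R e x"
  have "continuous_on {a..b} (?h u)" for u
    unfolding e_def by (intro continuous_intros p continuous_on_volterra cont) auto
  then obtain \<Phi> :: "(real \<Rightarrow>\<^sub>C 'e) \<Rightarrow> (real \<Rightarrow>\<^sub>C 'e)" where
    \<Phi>: "\<And>u x. \<Phi> u x = ?h u (clamp a b x)"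
    by (rule continuous_on_Icc_bcontfun_family[of a b ?h]) (rule that)
  have "dist (\<Phi> u) (\<Phi> v) \<le> 1/2 * dist u v" for u v
  proof (rule dist_bound)
    fix x
    let ?x = "clamp a b x" and ?d = "\<lambda>t. weighted u t - weighted v t"
    have x: "?x \<in> {a..b}" using clamp_in_interval[of a b x] interval by simp
    have "norm (?d t) \<le> dist u v * e t" for t
      using dist_bounded[of u t v] e_pos[of t]
      by (simp add: weighted_def dist_norm mult.commute flip: scaleR_diff_right)
    then have "weighted_norm_le L ?d (dist u v)" by (simp add: weighted_norm_le_def e_def)
    then have "weighted_norm_le L (volterra ?d) (dist u v / 2)"
      by (intro L(2) continuous_intros cont)
    then have "norm (volterra ?d ?x) / e ?x \<le> 1/2 * dist u v"
      using x e_pos[of ?x] by (simp add: weighted_norm_le_def e_def pos_divide_le_eq)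
    moreover have "dist (\<Phi> u x) (\<Phi> v x) = norm (volterra ?d ?x) / e ?x"
      using e_pos[of ?x]
      by (simp add: \<Phi> dist_norm volterra_diff[OF cont cont x] divide_inverse_commute
          flip: scaleR_diff_right)
    ultimately show "dist (\<Phi> u x) (\<Phi> v x) \<le> 1/2 * dist u v" by simp
  qed
  then obtain u where u: "\<Phi> u = u" using banach_fix_type[of "1/2" \<Phi>] by auto
  have "weighted u x = p x + volterra (weighted u) x" if "x \<in> {a..b}" for x
    using \<Phi>[of u x] that e_pos[of x] u by (simp add: weighted_def)
  then show thesis using that cont unfolding volterra_solution_def by blast
qed

end


section \<open>The spaces \<open>L\<^sup>2\<close> and \<open>H\<^sup>1\<close>\<close>

lemma L2_iff: "f \<in> L2 F a b \<longleftrightarrow> f \<in> L2 UNIV a b \<and> (AE \<xi> in lebesgue_on {a..b}. f \<xi> \<in> Fvec F)"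
  by (auto simp: L2_def)

lemma L2_UNIV_iff: "f \<in> L2 UNIV a b \<longleftrightarrow> f \<in> borel_measurable (lebesgue_on {a..b}) \<and>
    integrable (lebesgue_on {a..b}) (\<lambda>\<xi>. (norm (f \<xi>))\<^sup>2)"
  by (simp add: L2_def)

lemma L2_dominated:
  fixes f :: "'n::finite state" and g :: "'m::finite state"
  assumes f: "f \<in> L2 UNIV a b" and g: "g \<in> borel_measurable (lebesgue_on {a..b})"
    and bound: "AE \<xi> in lebesgue_on {a..b}. norm (g \<xi>) \<le> C * norm (f \<xi>)"
  shows "g \<in> L2 UNIV a b"
proof -
  have "integrable (lebesgue_on {a..b}) (\<lambda>\<xi>. (norm (g \<xi>))\<^sup>2)"
  proof (rule Bochner_Integration.integrable_bound[where f="\<lambda>\<xi>. C\<^sup>2 * (norm (f \<xi>))\<^sup>2"])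
    show "integrable (lebesgue_on {a..b}) (\<lambda>\<xi>. C\<^sup>2 * (norm (f \<xi>))\<^sup>2)"
      using f by (auto simp: L2_UNIV_iff)
    show "(\<lambda>\<xi>. (norm (g \<xi>))\<^sup>2) \<in> borel_measurable (lebesgue_on {a..b})" using g by measurable
    from bound show "AE \<xi> in lebesgue_on {a..b}. norm ((norm (g \<xi>))\<^sup>2) \<le>
        norm (C\<^sup>2 * (norm (f \<xi>))\<^sup>2)"
    proof eventually_elim
      case (elim \<xi>)
      then have "(norm (g \<xi>))\<^sup>2 \<le> (C * norm (f \<xi>))\<^sup>2" by (intro power_mono) auto
      then show ?case by (simp add: power_mult_distrib abs_mult)
    qed
  qed
  then show ?thesis using g by (simp add: L2_UNIV_iff)
qed

lemma L2_bounded_linear: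
  assumes "bounded_linear T" "f \<in> L2 UNIV a b"
  shows "(\<lambda>\<xi>. T (f \<xi>)) \<in> L2 UNIV a b"
proof -
  obtain K where "\<And>x. norm (T x) \<le> norm x * K"
    using bounded_linear.bounded[OF assms(1)] by blast
  then show ?thesis using assms
    by (intro L2_dominated[OF assms(2), where C=K] borel_measurable_bounded_linear[OF assms(1)])
      (simp_all add: L2_UNIV_iff mult.commute)
qed

lemmas L2_vector_smult = L2_bounded_linear[OF bounded_linear_vector_smult]

lemma L2_add:
  assumes f: "f \<in> L2 UNIV a b" and g: "g \<in> L2 UNIV a b"
  shows "(\<lambda>\<xi>. f \<xi> + g \<xi>) \<in> L2 UNIV a b"
proof -
  have measurable [measurable]: "f \<in> borel_measurable (lebesgue_on {a..b})"
      "g \<in> borel_measurable (lebesgue_on {a..b})"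
    using f g by (auto simp: L2_UNIV_iff)
  have "integrable (lebesgue_on {a..b}) (\<lambda>\<xi>. (norm (f \<xi> + g \<xi>))\<^sup>2)"
  proof (rule Bochner_Integration.integrable_bound)
    show "integrable (lebesgue_on {a..b}) (\<lambda>\<xi>. 2 * (norm (f \<xi>))\<^sup>2 + 2 * (norm (g \<xi>))\<^sup>2)"
      using f g by (auto simp: L2_UNIV_iff)
    show "(\<lambda>\<xi>. (norm (f \<xi> + g \<xi>))\<^sup>2) \<in> borel_measurable (lebesgue_on {a..b})"
      by measurable
    have "(norm (x + y))\<^sup>2 \<le> 2 * (norm x)\<^sup>2 + 2 * (norm y)\<^sup>2" for x y :: "complex^'a"
    proof -
      have "(norm (x + y))\<^sup>2 \<le> (norm x + norm y)\<^sup>2" by (intro power_mono norm_triangle_ineq) auto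
      moreover have "0 \<le> (norm x - norm y)\<^sup>2" by simp
      ultimately show ?thesis unfolding power2_sum power2_diff by linarith
    qed
    then show "AE \<xi> in lebesgue_on {a..b}. norm ((norm (f \<xi> + g \<xi>))\<^sup>2) \<le>
        norm (2 * (norm (f \<xi>))\<^sup>2 + 2 * (norm (g \<xi>))\<^sup>2)"
      by (intro AE_I2) (simp add: abs_of_nonneg)
  qed
  then show ?thesis using measurable by (simp add: L2_UNIV_iff)
qed

lemma L2_diff:
  assumes "f \<in> L2 UNIV a b" "g \<in> L2 UNIV a b"
  shows "(\<lambda>\<xi>. f \<xi> - g \<xi>) \<in> L2 UNIV a b"
  using L2_add[OF assms(1) L2_vector_smult[OF assms(2), of "- 1"]] by simp

lemma L2_zero: "(\<lambda>\<xi>. 0) \<in> L2 UNIV a b"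
  by (simp add: L2_UNIV_iff)

lemma L2_lincomb:
  assumes F: "F = \<real> \<or> F = UNIV" and f: "f \<in> L2 F a b" and g: "g \<in> L2 F a b"
    and c: "c \<in> F" and d: "d \<in> F"
  shows "(\<lambda>\<xi>. c *s f \<xi> + d *s g \<xi>) \<in> L2 F a b"
proof -
  have "AE \<xi> in lebesgue_on {a..b}. f \<xi> \<in> Fvec F" "AE \<xi> in lebesgue_on {a..b}. g \<xi> \<in> Fvec F"
    using f g by (simp_all add: L2_def)
  then have "AE \<xi> in lebesgue_on {a..b}. c *s f \<xi> + d *s g \<xi> \<in> Fvec F"
    by eventually_elim (use F c d in \<open>auto simp: Fvec_def\<close>)
  moreover have "(\<lambda>\<xi>. c *s f \<xi> + d *s g \<xi>) \<in> L2 UNIV a b"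
    using f g by (intro L2_add L2_vector_smult) (auto simp: L2_iff[of _ F])
  ultimately show ?thesis by (simp add: L2_iff[of _ F])
qed

lemma L2_AE_cong:
  assumes f: "f \<in> L2 UNIV a b" and AE_eq: "AE \<xi> in lebesgue_on {a..b}. f \<xi> = g \<xi>"
  shows "g \<in> L2 UNIV a b"
proof (rule L2_dominated[OF f, where C=1])
  show "g \<in> borel_measurable (lebesgue_on {a..b})"
    using f AE_eq by (auto simp: L2_UNIV_iff intro: borel_measurable_lebesgue_on_AE)
  show "AE \<xi> in lebesgue_on {a..b}. norm (g \<xi>) \<le> 1 * norm (f \<xi>)"
    using AE_eq by eventually_elim simp
qed

lemma L2_continuous:
  assumes w: "continuous_on {a..b} w"
  shows "w \<in> L2 UNIV a b"
proof -
  interpret finite_measure "lebesgue_on {a..b}" by (rule finite_measure_lebesgue_on) auto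
  obtain C where "C \<ge> 0" and C: "\<And>x. x \<in> {a..b} \<Longrightarrow> norm (w x) \<le> C"
    by (rule continuous_bounded_Icc[OF w]) (rule that)
  note [measurable] = continuous_imp_borel_measurable_Icc[OF w]
  have "AE \<xi> in lebesgue_on {a..b}. norm ((norm (w \<xi>))\<^sup>2) \<le> C\<^sup>2"
    by (rule AE_lebesgue_on_IccI) (simp add: C power_mono)
  then have "integrable (lebesgue_on {a..b}) (\<lambda>\<xi>. (norm (w \<xi>))\<^sup>2)"
    by (rule integrable_const_bound) measurable
  then show ?thesis by (simp add: L2_UNIV_iff)
qed

lemma L2_integrable:
  assumes f: "f \<in> L2 UNIV a b" and x: "x \<in> {a..b}"
  shows "integrable (lebesgue_on {a..x}) f"
proof -
  interpret finite_measure "lebesgue_on {a..b}" by (rule finite_measure_lebesgue_on) auto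
  have "integrable (lebesgue_on {a..b}) (\<lambda>\<xi>. norm (f \<xi>))"
    by (rule square_integrable_imp_integrable) (use f in \<open>auto simp: L2_UNIV_iff\<close>)
  then have "integrable (lebesgue_on {a..b}) f"
    using f by (simp add: L2_UNIV_iff integrable_norm_iff)
  then show ?thesis using integrable_subinterval[of a b f a x] x by auto
qed

lemma L2_bounded_bilinear_integrable:
  fixes f :: "'n::finite state" and g :: "'m::finite state"
    and prod :: "complex^'n \<Rightarrow> complex^'m \<Rightarrow> 'c::{banach,second_countable_topology}"
  assumes prod: "bounded_bilinear prod" and f: "f \<in> L2 UNIV a b" and g: "g \<in> L2 UNIV a b"
  shows "integrable (lebesgue_on {a..b}) (\<lambda>\<xi>. prod (f \<xi>) (g \<xi>))"
proof -
  obtain K where K: "K > 0" "\<And>x y. norm (prod x y) \<le> norm x * norm y * K"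
    using bounded_bilinear.pos_bounded[OF prod] by blast
  have integrable: "integrable (lebesgue_on {a..b}) (\<lambda>\<xi>. ((norm (f \<xi>))\<^sup>2 + (norm (g \<xi>))\<^sup>2) * K)"
    using f g by (auto simp: L2_UNIV_iff)
  have measurable: "(\<lambda>\<xi>. prod (f \<xi>) (g \<xi>)) \<in> borel_measurable (lebesgue_on {a..b})"
    using f g by (intro borel_measurable_bounded_bilinear[OF prod]) (auto simp: L2_UNIV_iff)
  have "norm (prod x y) \<le> ((norm x)\<^sup>2 + (norm y)\<^sup>2) * K" for x y
  proof -
    have "2 * (norm x * norm y) \<le> (norm x)\<^sup>2 + (norm y)\<^sup>2"
      using sum_squares_bound[of "norm x" "norm y"] by (simp add: mult.assoc)
    moreover have "0 \<le> norm x * norm y" by simp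
    ultimately have "norm x * norm y \<le> (norm x)\<^sup>2 + (norm y)\<^sup>2" by linarith
    then show ?thesis using K by (meson order_trans mult_right_mono less_imp_le)
  qed
  then show ?thesis
    using K(1) by (intro Bochner_Integration.integrable_bound[OF integrable measurable] AE_I2)
      (simp add: abs_of_nonneg)
qed

lemma nonneg_quadratic_discriminant:
  fixes p q r :: real
  assumes nonneg: "\<And>t. 0 \<le> p + 2 * t * q + t\<^sup>2 * r" and r: "0 \<le> r"
  shows "q\<^sup>2 \<le> p * r"
proof (cases "r = 0")
  case True
  have "q = 0"
  proof (rule ccontr)
    assume "q \<noteq> 0"
    then have "p + 2 * (- (p + 1) / (2 * q)) * q = - 1"
      by (simp add: field_simps)
    then show False using nonneg[of "- (p + 1) / (2 * q)"] True by simp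
  qed
  then show ?thesis using True by simp
next
  case False
  then have "p + 2 * (- q / r) * q + (- q / r)\<^sup>2 * r = (p * r - q\<^sup>2) / r"
    by (simp add: field_simps power2_eq_square)
  then have "0 \<le> (p * r - q\<^sup>2) / r" using nonneg[of "- q / r"] by simp
  then show ?thesis using r False by (simp add: zero_le_divide_iff)
qed

lemma L1_norm_le_L2_norm:
  assumes interval: "a \<le> b" and f: "f \<in> L2 UNIV a b"
  shows "(LINT \<xi>|lebesgue_on {a..b}. norm (f \<xi>)) \<le>
    sqrt (b - a) * sqrt (LINT \<xi>|lebesgue_on {a..b}. (norm (f \<xi>))\<^sup>2)"
proof -
  interpret finite_measure "lebesgue_on {a..b}" by (rule finite_measure_lebesgue_on) auto
  let ?I = "LINT \<xi>|lebesgue_on {a..b}. norm (f \<xi>)"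
      and ?J = "LINT \<xi>|lebesgue_on {a..b}. (norm (f \<xi>))\<^sup>2"
  have integrable: "integrable (lebesgue_on {a..b}) (\<lambda>\<xi>. norm (f \<xi>))"
    "integrable (lebesgue_on {a..b}) (\<lambda>\<xi>. (norm (f \<xi>))\<^sup>2)"
    using f interval by (auto simp: L2_UNIV_iff L2_integrable)
  have "0 \<le> ?J + 2 * t * ?I + t\<^sup>2 * (b - a)" for t
  proof -
    have "0 \<le> (LINT \<xi>|lebesgue_on {a..b}. (norm (f \<xi>) + t)\<^sup>2)" by (rule integral_nonneg_AE) simp
    also have "\<dots> = ?J + 2 * t * ?I + t\<^sup>2 * (b - a)"
      using integrable interval by (simp add: power2_sum measure_restrict_space mult_ac)
    finally show ?thesis .
  qed
  then have "?I\<^sup>2 \<le> ?J * (b - a)" by (rule nonneg_quadratic_discriminant) (use interval in simp)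
  then have "?I \<le> sqrt (?J * (b - a))" by (rule real_le_rsqrt)
  then show ?thesis by (simp add: real_sqrt_mult mult.commute)
qed

lemma Linf_mat_UNIV_iff: "P \<in> Linf_mat UNIV a b \<longleftrightarrow> P \<in> borel_measurable (lebesgue_on {a..b}) \<and>
    (\<exists>C. AE \<xi> in lebesgue_on {a..b}. norm (P \<xi>) \<le> C)"
  by (simp add: Linf_mat_def)

lemma Linf_mat_const: "(\<lambda>_. A) \<in> Linf_mat UNIV a b"
  by (auto simp: Linf_mat_UNIV_iff)

lemma Linf_mat_diff:
  assumes "P \<in> Linf_mat UNIV a b" "Q \<in> Linf_mat UNIV a b"
  shows "(\<lambda>\<xi>. P \<xi> - Q \<xi>) \<in> Linf_mat UNIV a b"
proof -
  obtain C D where "AE \<xi> in lebesgue_on {a..b}. norm (P \<xi>) \<le> C"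
      "AE \<xi> in lebesgue_on {a..b}. norm (Q \<xi>) \<le> D"
    using assms by (auto simp: Linf_mat_UNIV_iff)
  then have "AE \<xi> in lebesgue_on {a..b}. norm (P \<xi> - Q \<xi>) \<le> C + D"
    by eventually_elim (rule order_trans[OF norm_triangle_ineq4 add_mono])
  then show ?thesis using assms by (auto simp: Linf_mat_UNIV_iff)
qed

lemma Linf_mat_mult:
  fixes P Q :: "real \<Rightarrow> complex^'n^'n::finite"
  assumes "P \<in> Linf_mat UNIV a b" "Q \<in> Linf_mat UNIV a b"
  shows "(\<lambda>\<xi>. P \<xi> ** Q \<xi>) \<in> Linf_mat UNIV a b"
proof -
  obtain K where K: "K > 0"
      "\<And>(A :: complex^'n^'n) (B :: complex^'n^'n). norm (A ** B) \<le> norm A * norm B * K"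
    using matrix_matrix_mult.pos_bounded by blast
  obtain C D where "AE \<xi> in lebesgue_on {a..b}. norm (P \<xi>) \<le> C"
      "AE \<xi> in lebesgue_on {a..b}. norm (Q \<xi>) \<le> D"
    using assms by (auto simp: Linf_mat_UNIV_iff)
  then have "AE \<xi> in lebesgue_on {a..b}. norm (P \<xi> ** Q \<xi>) \<le> \<bar>C\<bar> * \<bar>D\<bar> * K"
  proof eventually_elim
    case (elim \<xi>)
    then have "norm (P \<xi>) * norm (Q \<xi>) * K \<le> \<bar>C\<bar> * \<bar>D\<bar> * K"
      using K(1) by (intro mult_right_mono mult_mono) auto
    with K(2) show ?case by (rule order_trans)
  qed
  moreover have "(\<lambda>\<xi>. P \<xi> ** Q \<xi>) \<in> borel_measurable (lebesgue_on {a..b})"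
    using assms
    by (intro borel_measurable_bounded_bilinear[OF matrix_matrix_mult.bounded_bilinear_axioms])
      (simp_all add: Linf_mat_UNIV_iff)
  ultimately show ?thesis unfolding Linf_mat_UNIV_iff by blast
qed

lemma Linf_mat_mult_vec_bound:
  fixes P :: "real \<Rightarrow> complex^'n^'n::finite"
  assumes "P \<in> Linf_mat UNIV a b"
  obtains C where "C \<ge> 0" "AE \<xi> in lebesgue_on {a..b}. \<forall>x. norm (P \<xi> *v x) \<le> C * norm x"
proof -
  obtain K where K: "K > 0" "\<And>(A :: complex^'n^'n) x. norm (A *v x) \<le> norm A * norm x * K"
    using matrix_vector_mult.pos_bounded by blast
  obtain C where "AE \<xi> in lebesgue_on {a..b}. norm (P \<xi>) \<le> C"
    using assms by (auto simp: Linf_mat_UNIV_iff)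
  then have "AE \<xi> in lebesgue_on {a..b}. \<forall>x. norm (P \<xi> *v x) \<le> (\<bar>C\<bar> * K) * norm x"
  proof eventually_elim
    case (elim \<xi>)
    have "norm (P \<xi> *v x) \<le> \<bar>C\<bar> * norm x * K" for x
      using K(1) elim by (intro order_trans[OF K(2)] mult_right_mono) auto
    then show ?case by (simp add: mult_ac)
  qed
  then show thesis using K(1) by (intro that[of "\<bar>C\<bar> * K"]) auto
qed

lemma L2_Linf_mat:
  fixes P :: "real \<Rightarrow> complex^'n^'n::finite"
  assumes P: "P \<in> Linf_mat UNIV a b" and f: "f \<in> L2 UNIV a b"
  shows "(\<lambda>\<xi>. P \<xi> *v f \<xi>) \<in> L2 UNIV a b"
proof -
  obtain C where "AE \<xi> in lebesgue_on {a..b}. \<forall>x. norm (P \<xi> *v x) \<le> C * norm x"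
    using Linf_mat_mult_vec_bound[OF P] by blast
  then show ?thesis
    using P f
    by (intro L2_dominated[OF f, where C=C]
        borel_measurable_bounded_bilinear[OF matrix_vector_mult.bounded_bilinear_axioms])
      (auto simp: L2_UNIV_iff Linf_mat_UNIV_iff elim: eventually_mono)
qed

lemma H1_eq_integral:
  assumes "H1 F a b w w'" "x \<in> {a..b}"
  shows "w x = w a + (LINT \<tau>|lebesgue_on {a..x}. w' \<tau>)"
  using assms unfolding H1_def by blast

lemma H1_deriv_L2: "H1 F a b w w' \<Longrightarrow> w' \<in> L2 UNIV a b"
  by (simp add: H1_def L2_iff[of _ F])

lemma H1_continuous_on:
  assumes w: "H1 F a b w w'"
  shows "continuous_on {a..b} w"
proof (cases "a \<le> b")
  case True
  then have "continuous_on {a..b} (\<lambda>x. w a + (LINT \<tau>|lebesgue_on {a..x}. w' \<tau>))"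
    by (intro continuous_intros continuous_on_indefinite_LINT
        L2_integrable[OF H1_deriv_L2[OF w]]) auto
  then show ?thesis
    by (rule continuous_on_eq) (rule H1_eq_integral[OF w, symmetric])
qed simp

lemma H1_AE_cong:
  assumes w: "H1 UNIV a b w w'" and AE_eq: "AE \<xi> in lebesgue_on {a..b}. w' \<xi> = v' \<xi>"
  shows "H1 UNIV a b w v'"
  unfolding H1_def
proof (intro conjI ballI)
  show v': "v' \<in> L2 UNIV a b" by (rule L2_AE_cong[OF H1_deriv_L2[OF w] AE_eq])
  fix x assume x: "x \<in> {a..b}"
  have "(LINT \<tau>|lebesgue_on {a..x}. w' \<tau>) = (LINT \<tau>|lebesgue_on {a..x}. v' \<tau>)"
  proof (rule integral_cong_AE)
    show "AE \<xi> in lebesgue_on {a..x}. w' \<xi> = v' \<xi>"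
      by (rule AE_lebesgue_on_subset[OF AE_eq]) (use x in auto)
  qed (use L2_integrable[OF H1_deriv_L2[OF w] x] L2_integrable[OF v' x] in auto)
  then show "w x = w a + (LINT \<tau>|lebesgue_on {a..x}. v' \<tau>)"
    using H1_eq_integral[OF w x] by simp
qed simp

lemma H1_bounded_linear:
  assumes T: "bounded_linear T" and w: "H1 UNIV a b w w'"
    and F: "\<And>x. T x \<in> Fvec F"
  shows "H1 F a b (\<lambda>\<xi>. T (w \<xi>)) (\<lambda>\<xi>. T (w' \<xi>))"
  unfolding H1_def
proof (intro conjI ballI)
  show "(\<lambda>\<xi>. T (w' \<xi>)) \<in> L2 F a b"
    using L2_bounded_linear[OF T H1_deriv_L2[OF w]] F by (auto simp: L2_iff[of _ F])
  show "T (w a) \<in> Fvec F" by (rule F)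
  fix x assume x: "x \<in> {a..b}"
  have "T (w x) = T (w a) + T (LINT \<tau>|lebesgue_on {a..x}. w' \<tau>)"
    unfolding H1_eq_integral[OF w x] by (rule linear_add[OF bounded_linear.linear[OF T]])
  also have "T (LINT \<tau>|lebesgue_on {a..x}. w' \<tau>) = (LINT \<tau>|lebesgue_on {a..x}. T (w' \<tau>))"
    by (rule integral_bounded_linear[symmetric, OF T L2_integrable[OF H1_deriv_L2[OF w] x]])
  finally show "T (w x) = T (w a) + (LINT \<tau>|lebesgue_on {a..x}. T (w' \<tau>))" .
qed

lemma H1_add:
  assumes w: "H1 UNIV a b w w'" and v: "H1 UNIV a b v v'"
  shows "H1 UNIV a b (\<lambda>\<xi>. w \<xi> + v \<xi>) (\<lambda>\<xi>. w' \<xi> + v' \<xi>)"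
  unfolding H1_def
proof (intro conjI ballI)
  note L2 = H1_deriv_L2[OF w] H1_deriv_L2[OF v]
  show "(\<lambda>\<xi>. w' \<xi> + v' \<xi>) \<in> L2 UNIV a b" by (intro L2_add L2)
  fix x assume x: "x \<in> {a..b}"
  show "w x + v x = w a + v a + (LINT \<tau>|lebesgue_on {a..x}. w' \<tau> + v' \<tau>)"
    using H1_eq_integral[OF w x] H1_eq_integral[OF v x] L2[THEN L2_integrable[OF _ x]] by simp
qed simp

lemma H1_UNIV: "H1 F a b w w' \<Longrightarrow> H1 UNIV a b w w'"
  using H1_deriv_L2[of F] unfolding H1_def by (intro conjI) (blast | simp)+


section \<open>Seminorms\<close>

locale seminorm =
  fixes N :: "'a::real_vector \<Rightarrow> real"
  assumes triangle: "N (x + y) \<le> N x + N y"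
    and scale: "N (r *\<^sub>R x) = \<bar>r\<bar> * N x"
begin

lemma zero: "N 0 = 0"
  using scale[of 0 0] by simp

lemma nonneg: "0 \<le> N x"
  using triangle[of x "- 1 *\<^sub>R x"] scale[of "- 1" x] by (simp add: zero)

lemma sum_le: "finite B \<Longrightarrow> N (\<Sum>v\<in>B. r v *\<^sub>R v) \<le> (\<Sum>v\<in>B. \<bar>r v\<bar> * N v)"
proof (induction B rule: finite_induct)
  case (insert v B)
  then show ?case using triangle[of "r v *\<^sub>R v" "\<Sum>v\<in>B. r v *\<^sub>R v"] by (simp add: scale)
qed (simp add: zero)

end

lemma definite_seminorm_lower_bound:
  fixes N :: "'a::euclidean_space \<Rightarrow> real"
  assumes "seminorm N" and definite: "\<And>x. N x = 0 \<Longrightarrow> x = 0"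
  obtains c where "c > 0" "\<And>x. c * norm x \<le> N x"
proof -
  interpret seminorm N by fact
  have "convex_on UNIV N"
    using triangle by (auto intro!: convex_onI order_trans[OF triangle] simp: scale)
  then have "continuous_on UNIV N" by (intro convex_on_continuous) auto
  then have "continuous_on (sphere 0 1) N" by (rule continuous_on_subset) simp
  then obtain u where u: "norm u = 1" "\<And>x. norm x = 1 \<Longrightarrow> N u \<le> N x"
    using continuous_attains_inf[of "sphere 0 1" N] by auto
  show thesis
  proof (rule that[of "N u"])
    show "0 < N u" using u(1) definite nonneg[of u] by (force simp: less_le)
    show "N u * norm x \<le> N x" for x
    proof (cases "x = 0")
      case False
      then have "N u \<le> N ((1 / norm x) *\<^sub>R x)" by (intro u(2)) simp
      then show ?thesis using False by (simp add: scale field_simps)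
    qed (simp add: zero)
  qed
qed

lemma (in orthonormal_set) seminorm_span_le:
  assumes "seminorm N" and bound: "\<And>u. u \<in> B \<Longrightarrow> N u \<le> q" and v: "v \<in> span B"
  shows "N v \<le> real (card B) * q * norm v"
proof -
  interpret seminorm N by fact
  have "v = (\<Sum>u\<in>B. (v \<bullet> u) *\<^sub>R u)"
    using orthonormal_basis_expand[OF orthogonal normalized v finite_B] by simp
  then have "N v \<le> (\<Sum>u\<in>B. \<bar>v \<bullet> u\<bar> * N u)"
    using sum_le[OF finite_B, of "\<lambda>u. v \<bullet> u"] by simp
  also have "\<dots> \<le> (\<Sum>u\<in>B. norm v * q)"
  proof (intro sum_mono mult_mono bound)
    fix u assume "u \<in> B"
    then show "\<bar>v \<bullet> u\<bar> \<le> norm v" using Cauchy_Schwarz_ineq2[of v u] normalized by simp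
  qed (simp_all add: nonneg)
  finally show ?thesis by (simp add: mult_ac)
qed


section \<open>Semigroups on spaces of functions\<close>

locale function_space =
  fixes F :: "complex set" and M :: "real measure"
    and X :: "('n::finite) state set" and nrm :: "'n state \<Rightarrow> real"
  assumes scalars: "F = \<real> \<or> F = UNIV"
    and lincomb_closed: "f \<in> X \<Longrightarrow> g \<in> X \<Longrightarrow> c \<in> F \<Longrightarrow> d \<in> F \<Longrightarrow> (\<lambda>\<xi>. c *s f \<xi> + d *s g \<xi>) \<in> X"
    and nrm_triangle: "f \<in> X \<Longrightarrow> g \<in> X \<Longrightarrow> nrm (\<lambda>\<xi>. f \<xi> + g \<xi>) \<le> nrm f + nrm g"
    and nrm_smult: "f \<in> X \<Longrightarrow> c \<in> F \<Longrightarrow> nrm (\<lambda>\<xi>. c *s f \<xi>) = cmod c * nrm f"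
    and nrm_eq_0_iff: "f \<in> X \<Longrightarrow> nrm f = 0 \<longleftrightarrow> (AE \<xi> in M. f \<xi> = 0)"
begin

lemma scalars_mem: "complex_of_real r \<in> F" "0 \<in> F" "1 \<in> F" "- 1 \<in> F"
  using scalars by auto

lemma smult_closed: "f \<in> X \<Longrightarrow> c \<in> F \<Longrightarrow> (\<lambda>\<xi>. c *s f \<xi>) \<in> X"
  using lincomb_closed[of f f c 0] scalars_mem by simp

lemma add_closed: "f \<in> X \<Longrightarrow> g \<in> X \<Longrightarrow> (\<lambda>\<xi>. f \<xi> + g \<xi>) \<in> X"
  using lincomb_closed[of f g 1 1] scalars_mem by simp

lemma diff_closed: "f \<in> X \<Longrightarrow> g \<in> X \<Longrightarrow> (\<lambda>\<xi>. f \<xi> - g \<xi>) \<in> X"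
  using lincomb_closed[of f g 1 "- 1"] scalars_mem by simp

lemma scaleR_closed: "f \<in> X \<Longrightarrow> (\<lambda>\<xi>. r *\<^sub>R f \<xi>) \<in> X"
  using smult_closed[of f "complex_of_real r"] scalars_mem by (simp add: of_real_vector_smult)

lemma nrm_scaleR: "f \<in> X \<Longrightarrow> nrm (\<lambda>\<xi>. r *\<^sub>R f \<xi>) = \<bar>r\<bar> * nrm f"
  using nrm_smult[of f "complex_of_real r"] scalars_mem by (simp add: of_real_vector_smult)

lemma nrm_nonneg:
  assumes f: "f \<in> X"
  shows "0 \<le> nrm f"
proof -
  have "nrm (\<lambda>\<xi>. f \<xi> + (- 1) *\<^sub>R f \<xi>) \<le> nrm f + nrm (\<lambda>\<xi>. (- 1) *\<^sub>R f \<xi>)"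
    by (intro nrm_triangle scaleR_closed f)
  moreover have "nrm (\<lambda>\<xi>. 0) = 0" using nrm_scaleR[OF f, of 0] by simp
  ultimately show ?thesis using nrm_scaleR[OF f, of "- 1"] by simp
qed

lemma nrm_diff_eq_0_iff:
  "f \<in> X \<Longrightarrow> g \<in> X \<Longrightarrow> nrm (\<lambda>\<xi>. f \<xi> - g \<xi>) = 0 \<longleftrightarrow> (AE \<xi> in M. f \<xi> = g \<xi>)"
  using nrm_eq_0_iff[OF diff_closed, of f g] by simp

lemma nrm_cong_AE:
  assumes f: "f \<in> X" and g: "g \<in> X" and AE_eq: "AE \<xi> in M. f \<xi> = g \<xi>"
  shows "nrm f = nrm g"
proof (rule antisym)
  have "nrm (\<lambda>\<xi>. g \<xi> + (f \<xi> - g \<xi>)) \<le> nrm g + nrm (\<lambda>\<xi>. f \<xi> - g \<xi>)"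
    by (intro nrm_triangle diff_closed f g)
  then show "nrm f \<le> nrm g" using nrm_diff_eq_0_iff[OF f g] AE_eq by simp
  have "nrm (\<lambda>\<xi>. f \<xi> + (g \<xi> - f \<xi>)) \<le> nrm f + nrm (\<lambda>\<xi>. g \<xi> - f \<xi>)"
    by (intro nrm_triangle diff_closed f g)
  moreover have "AE \<xi> in M. g \<xi> = f \<xi>" using AE_eq by eventually_elim simp
  ultimately show "nrm g \<le> nrm f" using nrm_diff_eq_0_iff[OF g f] by simp
qed

end

locale strongly_continuous_semigroup = function_space F M X nrm
  for F M X and nrm :: "('n::finite) state \<Rightarrow> real" +
  fixes T :: "real \<Rightarrow> 'n state \<Rightarrow> 'n state"
  assumes C0_semigroup: "C0_semigroup F X nrm T"
begin

lemma T_closed: "t \<ge> 0 \<Longrightarrow> f \<in> X \<Longrightarrow> T t f \<in> X"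
  using C0_semigroup unfolding C0_semigroup_def by blast

lemma T_lincomb:
  assumes "t \<ge> 0" "f \<in> X" "g \<in> X" "c \<in> F" "d \<in> F"
  shows "AE \<xi> in M. T t (\<lambda>\<eta>. c *s f \<eta> + d *s g \<eta>) \<xi> = c *s T t f \<xi> + d *s T t g \<xi>"
proof -
  have "nrm (\<lambda>\<xi>. T t (\<lambda>\<eta>. c *s f \<eta> + d *s g \<eta>) \<xi> - (c *s T t f \<xi> + d *s T t g \<xi>)) = 0"
    using C0_semigroup assms unfolding C0_semigroup_def by blast
  then show ?thesis
    by (subst (asm) nrm_diff_eq_0_iff) (use assms in \<open>auto intro!: T_closed lincomb_closed\<close>)
qed

lemma T_zero:
  assumes "f \<in> X"
  shows "AE \<xi> in M. T 0 f \<xi> = f \<xi>"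
proof -
  have "nrm (\<lambda>\<xi>. T 0 f \<xi> - f \<xi>) = 0"
    using C0_semigroup assms unfolding C0_semigroup_def by blast
  then show ?thesis by (subst (asm) nrm_diff_eq_0_iff) (auto intro: T_closed assms)
qed

lemma T_add:
  assumes "t \<ge> 0" "r \<ge> 0" "f \<in> X"
  shows "AE \<xi> in M. T (t + r) f \<xi> = T t (T r f) \<xi>"
proof -
  have "nrm (\<lambda>\<xi>. T (t + r) f \<xi> - T t (T r f) \<xi>) = 0"
    using C0_semigroup assms unfolding C0_semigroup_def by blast
  then show ?thesis by (subst (asm) nrm_diff_eq_0_iff) (use assms in \<open>auto intro!: T_closed\<close>)
qed

lemma T_tendsto: "f \<in> X \<Longrightarrow> ((\<lambda>t. nrm (\<lambda>\<xi>. T t f \<xi> - f \<xi>)) \<longlongrightarrow> 0) (at_right 0)"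
  using C0_semigroup unfolding C0_semigroup_def by blast

lemma T_bounded:
  assumes "t \<ge> 0"
  obtains C where "C \<ge> 0" "\<And>f. f \<in> X \<Longrightarrow> nrm (T t f) \<le> C * nrm f"
proof -
  have "\<exists>C. \<forall>f\<in>X. nrm (T t f) \<le> C * nrm f"
    using C0_semigroup[unfolded C0_semigroup_def, THEN conjunct2, THEN conjunct2,
        THEN conjunct1] assms
    by blast
  then obtain C where C: "\<And>f. f \<in> X \<Longrightarrow> nrm (T t f) \<le> C * nrm f" by blast
  have "nrm (T t f) \<le> max C 0 * nrm f" if "f \<in> X" for f
    by (rule order_trans[OF C[OF that] mult_right_mono]) (simp_all add: nrm_nonneg that)
  then show thesis using that[of "max C 0"] by simp
qed

lemma T_cong_AE:
  assumes t: "t \<ge> 0" and f: "f \<in> X" and g: "g \<in> X" and AE_eq: "AE \<xi> in M. f \<xi> = g \<xi>"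
  shows "AE \<xi> in M. T t f \<xi> = T t g \<xi>"
proof -
  let ?d = "\<lambda>\<eta>. 1 *s f \<eta> + (- 1) *s g \<eta>"
  have d: "?d \<in> X" by (intro lincomb_closed f g scalars_mem)
  have "nrm ?d = 0" using AE_eq by (simp add: nrm_diff_eq_0_iff f g)
  moreover obtain C where "C \<ge> 0" and C: "\<And>f. f \<in> X \<Longrightarrow> nrm (T t f) \<le> C * nrm f"
    by (rule T_bounded[OF t]) (rule that)
  ultimately have "nrm (T t ?d) = 0"
    using C[OF d] nrm_nonneg[OF T_closed[OF t d]] by simp
  then have "AE \<xi> in M. T t ?d \<xi> = 0" using nrm_eq_0_iff[OF T_closed[OF t d]] by blast
  with T_lincomb[OF t f g scalars_mem(3,4)] show ?thesis by eventually_elim simp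
qed

definition generator_defect :: "real \<Rightarrow> 'n state \<Rightarrow> 'n state \<Rightarrow> 'n state" where
  "generator_defect h f g = (\<lambda>\<xi>. (1/h) *\<^sub>R (T h f \<xi> - f \<xi>) - g \<xi>)"

lemma generator_iff: "(f, g) \<in> generator X nrm T \<longleftrightarrow>
    f \<in> X \<and> g \<in> X \<and> ((\<lambda>h. nrm (generator_defect h f g)) \<longlongrightarrow> 0) (at_right 0)"
  by (simp add: generator_def generator_defect_def)

lemma generator_defect_closed: "h \<ge> 0 \<Longrightarrow> f \<in> X \<Longrightarrow> g \<in> X \<Longrightarrow> generator_defect h f g \<in> X"
  unfolding generator_defect_def by (intro diff_closed scaleR_closed T_closed)

lemma generator_defect_lincomb:
  assumes "h \<ge> 0" "f \<in> X" "f' \<in> X" "c \<in> F" "d \<in> F"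
  shows "AE \<xi> in M. generator_defect h (\<lambda>\<eta>. c *s f \<eta> + d *s f' \<eta>) (\<lambda>\<eta>. c *s g \<eta> + d *s g' \<eta>) \<xi> =
    c *s generator_defect h f g \<xi> + d *s generator_defect h f' g' \<xi>"
  using T_lincomb[OF assms]
  by eventually_elim (simp add: generator_defect_def vec_eq_iff algebra_simps)

lemma nrm_generator_defect_cong_AE:
  assumes h: "h \<ge> 0" and X: "f \<in> X" "g \<in> X" "f' \<in> X" "g' \<in> X"
    and AE_eq: "AE \<xi> in M. f \<xi> = f' \<xi>" "AE \<xi> in M. g \<xi> = g' \<xi>"
  shows "nrm (generator_defect h f g) = nrm (generator_defect h f' g')"
proof (rule nrm_cong_AE)
  show "AE \<xi> in M. generator_defect h f g \<xi> = generator_defect h f' g' \<xi>"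
    using T_cong_AE[OF h X(1,3) AE_eq(1)] AE_eq
    by eventually_elim (simp add: generator_defect_def)
qed (simp_all add: generator_defect_closed h X)

lemma generator_T:
  assumes fg: "(f, g) \<in> generator X nrm T" and t: "t \<ge> 0"
  shows "(T t f, T t g) \<in> generator X nrm T"
proof -
  have X: "f \<in> X" "g \<in> X" and lim: "((\<lambda>h. nrm (generator_defect h f g)) \<longlongrightarrow> 0) (at_right 0)"
    using fg by (simp_all add: generator_iff)
  obtain C where C: "C \<ge> 0" "\<And>f. f \<in> X \<Longrightarrow> nrm (T t f) \<le> C * nrm f"
    by (rule T_bounded[OF t]) (rule that)
  have bound: "nrm (generator_defect h (T t f) (T t g)) \<le> C * nrm (generator_defect h f g)"
      if h: "h > 0" for h
  proof -
    let ?k = "complex_of_real (1 / h)"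
    let ?q = "\<lambda>\<eta>. ?k *s T h f \<eta> + (- ?k) *s f \<eta>"
    have k: "?k \<in> F" "- ?k \<in> F" using scalars_mem(1)[of "1 / h"] scalars_mem(1)[of "- 1 / h"]
      by simp_all
    have "h \<ge> 0" using h by simp
    then have Thf: "T h f \<in> X" by (intro T_closed X)
    then have q: "?q \<in> X" by (intro lincomb_closed X k)
    have d: "generator_defect h f g = (\<lambda>\<eta>. 1 *s ?q \<eta> + (- 1) *s g \<eta>)"
      unfolding generator_defect_def of_real_vector_smult[symmetric]
      by (rule ext) (simp add: vec_eq_iff algebra_simps)
    have "AE \<xi> in M. T h (T t f) \<xi> = T t (T h f) \<xi>"
      using T_add[OF \<open>h \<ge> 0\<close> t X(1)] T_add[OF t \<open>h \<ge> 0\<close> X(1)]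
      by eventually_elim (metis add.commute)
    with T_lincomb[OF t q X(2) scalars_mem(3,4)] T_lincomb[OF t Thf X(1) k]
    have "AE \<xi> in M. generator_defect h (T t f) (T t g) \<xi> = T t (generator_defect h f g) \<xi>"
    proof eventually_elim
      case (elim \<xi>)
      then show ?case
        unfolding d elim(1,2)
        unfolding generator_defect_def elim(3) of_real_vector_smult[symmetric]
        by (simp add: vec_eq_iff algebra_simps)
    qed
    then have "nrm (generator_defect h (T t f) (T t g)) = nrm (T t (generator_defect h f g))"
      using h t X by (intro nrm_cong_AE generator_defect_closed T_closed) auto
    then show ?thesis using C(2) generator_defect_closed h X by simp
  qed
  have "\<forall>\<^sub>F h in at_right 0. norm (nrm (generator_defect h (T t f) (T t g))) \<le>
      C * nrm (generator_defect h f g)"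
    using eventually_at_right_less[of "0::real"]
    by eventually_elim (use bound X t in \<open>simp add: nrm_nonneg generator_defect_closed T_closed\<close>)
  then have "((\<lambda>h. nrm (generator_defect h (T t f) (T t g))) \<longlongrightarrow> 0) (at_right 0)"
    by (rule Lim_null_comparison) (use tendsto_mult_right_zero[OF lim] in simp)
  then show ?thesis using X t by (simp add: generator_iff T_closed)
qed

lemma generator_cong_AE:
  assumes fg: "(f, g) \<in> generator X nrm T" and f': "f' \<in> X" "AE \<xi> in M. f \<xi> = f' \<xi>"
    and g': "g' \<in> X" "AE \<xi> in M. g \<xi> = g' \<xi>"
  shows "(f', g') \<in> generator X nrm T"
proof -
  have X: "f \<in> X" "g \<in> X" using fg by (simp_all add: generator_iff)
  have "nrm (generator_defect h f g) = nrm (generator_defect h f' g')" if "h > 0" for h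
    using that X f' g' by (intro nrm_generator_defect_cong_AE) auto
  then have "((\<lambda>h. nrm (generator_defect h f g)) \<longlongrightarrow> 0) (at_right 0) \<longleftrightarrow>
      ((\<lambda>h. nrm (generator_defect h f' g')) \<longlongrightarrow> 0) (at_right 0)"
    by (intro tendsto_cong eventually_mono[OF eventually_at_right_less]) auto
  then show ?thesis using fg f' g' by (simp add: generator_iff)
qed

definition eigenfunction :: "complex \<Rightarrow> 'n state \<Rightarrow> bool" where
  "eigenfunction s f \<longleftrightarrow> (f, \<lambda>\<xi>. s *s f \<xi>) \<in> generator X nrm T"

lemma eigenfunction_closed: "eigenfunction s f \<Longrightarrow> f \<in> X"
  by (simp add: eigenfunction_def generator_iff)

lemma eigenfunction_T:
  assumes f: "eigenfunction s f" and t: "t \<ge> 0" and s: "s \<in> F"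
  shows "eigenfunction s (T t f)"
  unfolding eigenfunction_def
proof (rule generator_cong_AE[OF generator_T[OF f[unfolded eigenfunction_def] t]])
  note X = eigenfunction_closed[OF f]
  show "T t f \<in> X" "(\<lambda>\<xi>. s *s T t f \<xi>) \<in> X" using X t s by (auto intro: T_closed smult_closed)
  show "AE \<xi> in M. T t (\<lambda>\<xi>. s *s f \<xi>) \<xi> = s *s T t f \<xi>"
    using T_lincomb[OF t X X s scalars_mem(2)] by simp
qed simp

lemma eigenfunction_growth_step:
  assumes h: "h > 0" and f: "f \<in> X" and s: "s \<in> F"
    and small: "nrm (generator_defect h f (\<lambda>\<xi>. s *s f \<xi>)) \<le> nrm f"
  shows "(1 + h * (Re s - 1)) * nrm f \<le> nrm (T h f)"
proof -
  let ?d = "generator_defect h f (\<lambda>\<xi>. s *s f \<xi>)"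
  have X: "T h f \<in> X" "?d \<in> X" "(\<lambda>\<xi>. s *s f \<xi>) \<in> X"
    using h f s by (auto intro!: T_closed generator_defect_closed smult_closed)
  define k where "k = 1 + complex_of_real h * s"
  have k: "(\<lambda>\<xi>. k *s f \<xi>) = (\<lambda>\<xi>. T h f \<xi> + (- h) *\<^sub>R ?d \<xi>)"
    using h by (intro ext) (simp add: k_def generator_defect_def vec_eq_iff algebra_simps
        scaleR_conv_of_real[where 'a=complex])
  have "(1 + h * Re s) * nrm f \<le> cmod k * nrm f"
    using complex_Re_le_cmod[of k] by (intro mult_right_mono nrm_nonneg f) (simp add: k_def)
  also have "k \<in> F" using scalars s by (auto simp: k_def)
  then have "cmod k * nrm f = nrm (\<lambda>\<xi>. k *s f \<xi>)" by (simp add: nrm_smult f)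
  also have "\<dots> \<le> nrm (T h f) + h * nrm ?d"
    unfolding k
    using nrm_triangle[OF X(1) scaleR_closed[OF X(2)], of "- h"] nrm_scaleR[OF X(2), of "- h"] h
    by simp
  also have "\<dots> \<le> nrm (T h f) + h * nrm f" using small h by simp
  finally show ?thesis by (simp add: algebra_simps)
qed

end

text \<open>
  That the eigenspace of \<open>s\<close> is finite-dimensional is expressed by an injection \<open>J\<close> of a Euclidean
  space into \<open>X\<close> whose image contains every eigenfunction, up to null sets.
\<close>

locale finite_dimensional_eigenspace = strongly_continuous_semigroup F M X nrm T
  for F M X and nrm :: "('n::finite) state \<Rightarrow> real" and T +
  fixes s :: complex and J :: "'v::euclidean_space \<Rightarrow> 'n state"
  assumes s_scalar: "s \<in> F"
    and J_closed: "J v \<in> X"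
    and J_linear: "linear (\<lambda>v. J v \<xi>)"
    and J_injective: "nrm (J v) = 0 \<Longrightarrow> v = 0"
    and J_surjective: "eigenfunction s f \<Longrightarrow> \<exists>v. AE \<xi> in M. f \<xi> = J v \<xi>"
begin

abbreviation eigen_defect :: "real \<Rightarrow> 'n state \<Rightarrow> 'n state" where
  "eigen_defect h f \<equiv> generator_defect h f (\<lambda>\<xi>. s *s f \<xi>)"

lemma eigenfunction_J_iff:
  "eigenfunction s (J v) \<longleftrightarrow> ((\<lambda>h. nrm (eigen_defect h (J v))) \<longlongrightarrow> 0) (at_right 0)"
  by (simp add: eigenfunction_def generator_iff J_closed smult_closed s_scalar)

lemma J_add: "J (x + y) = (\<lambda>\<xi>. J x \<xi> + J y \<xi>)"
  by (simp add: fun_eq_iff linear_add[OF J_linear])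

lemma J_scaleR: "J (r *\<^sub>R x) = (\<lambda>\<xi>. r *\<^sub>R J x \<xi>)"
  by (simp add: fun_eq_iff linear_scale[OF J_linear])

lemma eigen_defect_J_lincomb:
  assumes "h \<ge> 0"
  shows "AE \<xi> in M. eigen_defect h (J (r *\<^sub>R x + t *\<^sub>R y)) \<xi> =
    r *\<^sub>R eigen_defect h (J x) \<xi> + t *\<^sub>R eigen_defect h (J y) \<xi>"
proof -
  let ?r = "complex_of_real r" and ?t = "complex_of_real t"
  have J: "J (r *\<^sub>R x + t *\<^sub>R y) = (\<lambda>\<xi>. ?r *s J x \<xi> + ?t *s J y \<xi>)"
    by (simp add: J_add J_scaleR of_real_vector_smult)
  have "(\<lambda>\<xi>. s *s (?r *s J x \<xi> + ?t *s J y \<xi>)) = (\<lambda>\<xi>. ?r *s (s *s J x \<xi>) + ?t *s (s *s J y \<xi>))"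
    by (simp add: fun_eq_iff vec_eq_iff algebra_simps)
  then show ?thesis
    unfolding J
    using generator_defect_lincomb[of h "J x" "J y" ?r ?t "\<lambda>\<xi>. s *s J x \<xi>" "\<lambda>\<xi>. s *s J y \<xi>",
        OF assms J_closed J_closed scalars_mem(1) scalars_mem(1)]
    unfolding of_real_vector_smult by simp
qed

lemma seminorm_nrm_J: "seminorm (\<lambda>v. nrm (J v))"
  by unfold_locales (simp_all add: J_add J_scaleR nrm_triangle nrm_scaleR J_closed)

lemma seminorm_eigen_defect_J:
  assumes h: "h \<ge> 0"
  shows "seminorm (\<lambda>v. nrm (eigen_defect h (J v)))"
proof
  note X = generator_defect_closed[OF h J_closed smult_closed[OF J_closed s_scalar]]
  fix x y r
  have "nrm (eigen_defect h (J (x + y))) =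
      nrm (\<lambda>\<xi>. eigen_defect h (J x) \<xi> + eigen_defect h (J y) \<xi>)"
    using eigen_defect_J_lincomb[OF h, of 1 x 1 y] by (intro nrm_cong_AE X add_closed) simp
  then show "nrm (eigen_defect h (J (x + y))) \<le>
      nrm (eigen_defect h (J x)) + nrm (eigen_defect h (J y))"
    using nrm_triangle[OF X X] by simp
  have "nrm (eigen_defect h (J (r *\<^sub>R x))) = nrm (\<lambda>\<xi>. r *\<^sub>R eigen_defect h (J x) \<xi>)"
    using eigen_defect_J_lincomb[OF h, of r x 0 x] by (intro nrm_cong_AE X scaleR_closed) simp
  then show "nrm (eigen_defect h (J (r *\<^sub>R x))) = \<bar>r\<bar> * nrm (eigen_defect h (J x))"
    by (simp add: nrm_scaleR X)
qed

lemma subspace_eigen: "subspace {v. eigenfunction s (J v)}"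
proof (rule subspaceI; unfold mem_Collect_eq eigenfunction_J_iff)
  let ?N = "\<lambda>v h. nrm (eigen_defect h (J v))"
  have seminorm: "\<forall>\<^sub>F h in at_right 0. seminorm (\<lambda>v. ?N v h)"
    using eventually_at_right_less[of "0::real"]
    by eventually_elim (simp add: seminorm_eigen_defect_J)
  have zero: "\<forall>\<^sub>F h in at_right 0. ?N 0 h = 0"
    using seminorm by eventually_elim (drule seminorm.zero)
  show "(?N 0 \<longlongrightarrow> 0) (at_right 0)" using zero by (rule tendsto_eventually)
  fix x y r
  have scale: "\<forall>\<^sub>F h in at_right 0. \<bar>r\<bar> * ?N x h = ?N (r *\<^sub>R x) h"
    using seminorm by eventually_elim (drule seminorm.scale[where r=r and x=x], simp)
  have triangle: "\<forall>\<^sub>F h in at_right 0. norm (?N (x + y) h) \<le> ?N x h + ?N y h"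
    using seminorm
    by eventually_elim
      (frule seminorm.triangle[where x=x and y=y], drule seminorm.nonneg[where x="x + y"], simp)
  assume x: "(?N x \<longlongrightarrow> 0) (at_right 0)"
  show "(?N (r *\<^sub>R x) \<longlongrightarrow> 0) (at_right 0)"
    by (rule Lim_transform_eventually[OF tendsto_mult_right_zero[OF x] scale])
  assume y: "(?N y \<longlongrightarrow> 0) (at_right 0)"
  show "(?N (x + y) \<longlongrightarrow> 0) (at_right 0)"
    by (rule Lim_null_comparison[OF triangle tendsto_add_zero[OF x y]])
qed

lemma eigenfunction_representative:
  assumes f: "eigenfunction s f"
  obtains v where "eigenfunction s (J v)" "nrm f = nrm (J v)"
    "\<And>h. h \<ge> 0 \<Longrightarrow> nrm (eigen_defect h f) = nrm (eigen_defect h (J v))"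
proof -
  obtain v where v: "AE \<xi> in M. f \<xi> = J v \<xi>" using J_surjective[OF f] by blast
  then have sv: "AE \<xi> in M. s *s f \<xi> = s *s J v \<xi>" by eventually_elim simp
  note X = eigenfunction_closed[OF f] smult_closed[OF eigenfunction_closed[OF f] s_scalar]
    J_closed smult_closed[OF J_closed s_scalar]
  show thesis
  proof (rule that[of v])
    show "eigenfunction s (J v)"
      using generator_cong_AE[OF f[unfolded eigenfunction_def] X(3) v X(4) sv]
      by (simp add: eigenfunction_def)
    show "nrm f = nrm (J v)" by (rule nrm_cong_AE[OF X(1,3) v])
    show "nrm (eigen_defect h f) = nrm (eigen_defect h (J v))" if "h \<ge> 0" for h
      by (rule nrm_generator_defect_cong_AE[OF that X v sv])
  qed
qed

lemma eigen_defect_uniform: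
  obtains \<delta> where "\<delta> > 0"
    "\<And>h f. 0 < h \<Longrightarrow> h < \<delta> \<Longrightarrow> eigenfunction s f \<Longrightarrow> nrm (eigen_defect h f) \<le> nrm f"
proof -
  obtain c where c: "c > 0" "\<And>v. c * norm v \<le> nrm (J v)"
    using definite_seminorm_lower_bound[OF seminorm_nrm_J J_injective] by blast
  obtain B where B: "B \<subseteq> {v. eigenfunction s (J v)}" "pairwise orthogonal B"
      "\<And>x. x \<in> B \<Longrightarrow> norm x = 1" and span: "span B = {v. eigenfunction s (J v)}"
    using orthonormal_basis_subspace[OF subspace_eigen] by metis
  interpret orthonormal_set B using B(2,3) by unfold_locales
  define q where "q = c / (real (card B) + 1)"
  have "q > 0" using c by (simp add: q_def)
  have "\<forall>\<^sub>F h in at_right 0. \<forall>v\<in>B. nrm (eigen_defect h (J v)) < q"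
  proof (intro eventually_ball_finite finite_B ballI)
    fix v assume "v \<in> B"
    then have "((\<lambda>h. nrm (eigen_defect h (J v))) \<longlongrightarrow> 0) (at_right 0)"
      using B(1) by (auto simp: eigenfunction_J_iff)
    then show "\<forall>\<^sub>F h in at_right 0. nrm (eigen_defect h (J v)) < q"
      using \<open>q > 0\<close> by (rule order_tendstoD)
  qed
  then obtain \<delta> where \<delta>: "\<delta> > 0"
      "\<And>h v. 0 < h \<Longrightarrow> h < \<delta> \<Longrightarrow> v \<in> B \<Longrightarrow> nrm (eigen_defect h (J v)) < q"
    unfolding eventually_at_right_field by blast
  have "nrm (eigen_defect h (J v)) \<le> nrm (J v)"
    if h: "0 < h" "h < \<delta>" and v: "eigenfunction s (J v)" for h v
  proof -
    have "nrm (eigen_defect h (J v)) \<le> real (card B) * q * norm v"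
      using h v span \<delta>(2)[OF h]
      by (intro seminorm_span_le seminorm_eigen_defect_J) (auto simp: less_imp_le)
    also have "\<dots> = real (card B) / (real (card B) + 1) * (c * norm v)" by (simp add: q_def)
    also have "\<dots> \<le> 1 * (c * norm v)" using c by (intro mult_right_mono) auto
    also have "\<dots> \<le> nrm (J v)" using c by simp
    finally show ?thesis .
  qed
  then have "nrm (eigen_defect h f) \<le> nrm f" if "0 < h" "h < \<delta>" "eigenfunction s f" for h f
    using eigenfunction_representative[OF that(3)] that(1,2) by (metis less_imp_le)
  then show thesis using that \<delta>(1) by blast
qed

lemma eigenfunction_growth:
  assumes f: "eigenfunction s f" and Re_s: "Re s \<ge> 1"
  shows "Re s * nrm f \<le> nrm (T 1 f)"
proof -
  note X = eigenfunction_closed[OF f]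
  obtain \<delta> where \<delta>: "\<delta> > 0"
    "\<And>h f. 0 < h \<Longrightarrow> h < \<delta> \<Longrightarrow> eigenfunction s f \<Longrightarrow> nrm (eigen_defect h f) \<le> nrm f"
    by (rule eigen_defect_uniform) (rule that)
  obtain n where n: "inverse (real (Suc n)) < \<delta>" using reals_Archimedean[OF \<delta>(1)] by blast
  define h where "h = inverse (real (Suc n))"
  define \<gamma> where "\<gamma> = 1 + h * (Re s - 1)"
  have h: "0 < h" "h < \<delta>" using n by (simp_all add: h_def)
  then have \<gamma>: "\<gamma> \<ge> 0" using Re_s by (simp add: \<gamma>_def)
  have power: "\<gamma> ^ k * nrm f \<le> nrm (T (real k * h) f)" for k
  proof (induction k)
    case 0
    show ?case using nrm_cong_AE[OF T_closed[OF order_refl X] X T_zero[OF X]] by simp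
  next
    case (Suc k)
    have time: "real k * h \<ge> 0" using h by simp
    note f' = eigenfunction_T[OF f time s_scalar]
    have "\<gamma> ^ Suc k * nrm f \<le> \<gamma> * nrm (T (real k * h) f)"
      using mult_left_mono[OF Suc \<gamma>] by (simp add: mult.assoc)
    also have "\<dots> \<le> nrm (T h (T (real k * h) f))"
      unfolding \<gamma>_def
      by (rule eigenfunction_growth_step[OF h(1) eigenfunction_closed[OF f'] s_scalar
        \<delta>(2)[OF h f']])
    also have "\<dots> = nrm (T (h + real k * h) f)"
      using h time X by (intro nrm_cong_AE[symmetric] T_add T_closed) auto
    also have "h + real k * h = real (Suc k) * h" by (simp add: algebra_simps)
    finally show ?case .
  qed
  have steps: "real (Suc n) * h = 1" by (simp add: h_def)
  then have "Re s = 1 + real (Suc n) * (h * (Re s - 1))" by (simp flip: mult.assoc)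
  also have "\<dots> \<le> \<gamma> ^ Suc n"
    unfolding \<gamma>_def by (rule Bernoulli_inequality) (use h Re_s in \<open>simp add: order_trans[of _ 0]\<close>)
  finally have "Re s * nrm f \<le> \<gamma> ^ Suc n * nrm f" by (rule mult_right_mono[OF _ nrm_nonneg[OF X]])
  also have "\<dots> \<le> nrm (T 1 f)" using power[of "Suc n"] unfolding steps .
  finally show ?thesis .
qed

end


section \<open>Complexification of a semigroup\<close>

locale complexified_semigroup =
  real: strongly_continuous_semigroup \<real> M XR nrm T + complex: function_space UNIV M X nrm
  for M X XR and nrm :: "('n::finite) state \<Rightarrow> real" and T +
  assumes XR_iff: "f \<in> XR \<longleftrightarrow> f \<in> X \<and> (AE \<xi> in M. f \<xi> \<in> Fvec \<real>)"
    and re_X: "f \<in> X \<Longrightarrow> (\<lambda>\<xi>. re_vec (f \<xi>)) \<in> X"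
    and nrm_re_le: "f \<in> X \<Longrightarrow> nrm (\<lambda>\<xi>. re_vec (f \<xi>)) \<le> nrm f"
begin

abbreviation re :: "'n state \<Rightarrow> 'n state" where "re f \<equiv> (\<lambda>\<xi>. re_vec (f \<xi>))"

abbreviation im :: "'n state \<Rightarrow> 'n state" where "im f \<equiv> (\<lambda>\<xi>. im_vec (f \<xi>))"

abbreviation pair :: "'n state \<Rightarrow> 'n state \<Rightarrow> 'n state" where
  "pair f g \<equiv> (\<lambda>\<xi>. f \<xi> + \<i> *s g \<xi>)"

lemma pair_closed: "f \<in> XR \<Longrightarrow> g \<in> XR \<Longrightarrow> pair f g \<in> X"
  using XR_iff by (intro complex.add_closed complex.smult_closed) auto

lemma re_closed: "f \<in> X \<Longrightarrow> re f \<in> XR"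
  by (simp add: XR_iff re_X)

lemma im_closed: "f \<in> X \<Longrightarrow> im f \<in> XR"
  unfolding im_vec_eq_re_vec by (intro re_closed complex.smult_closed) auto

lemma nrm_im_le: "f \<in> X \<Longrightarrow> nrm (im f) \<le> nrm f"
  using nrm_re_le[OF complex.smult_closed[of f "- \<i>"]] complex.nrm_smult[of f "- \<i>"]
  by (simp add: im_vec_eq_re_vec)

lemma nrm_pair_le: "f \<in> XR \<Longrightarrow> g \<in> XR \<Longrightarrow> nrm (pair f g) \<le> nrm f + nrm g"
  using complex.nrm_triangle[of f "\<lambda>\<xi>. \<i> *s g \<xi>"] complex.nrm_smult[of g \<i>]
  by (simp add: XR_iff complex.smult_closed)

lemma re_im_pair:
  assumes "f \<in> XR" "g \<in> XR"
  shows "AE \<xi> in M. re (pair f g) \<xi> = f \<xi>" "AE \<xi> in M. im (pair f g) \<xi> = g \<xi>"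
proof -
  have "AE \<xi> in M. f \<xi> \<in> Fvec \<real>" "AE \<xi> in M. g \<xi> \<in> Fvec \<real>" using assms by (auto simp: XR_iff)
  then show "AE \<xi> in M. re (pair f g) \<xi> = f \<xi>" "AE \<xi> in M. im (pair f g) \<xi> = g \<xi>"
    by (eventually_elim, simp add: re_vec_Reals_pair)+
qed

lemma tendsto_nrm_pair_iff:
  assumes f: "\<And>t. t > 0 \<Longrightarrow> f t \<in> XR" and g: "\<And>t. t > 0 \<Longrightarrow> g t \<in> XR"
  shows "((\<lambda>t. nrm (pair (f t) (g t))) \<longlongrightarrow> 0) (at_right (0::real)) \<longleftrightarrow>
    ((\<lambda>t. nrm (f t)) \<longlongrightarrow> 0) (at_right 0) \<and> ((\<lambda>t. nrm (g t)) \<longlongrightarrow> 0) (at_right 0)"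
proof -
  have le: "norm (nrm (pair (f t) (g t))) \<le> nrm (f t) + nrm (g t)"
      "norm (nrm (f t)) \<le> nrm (pair (f t) (g t))" "norm (nrm (g t)) \<le> nrm (pair (f t) (g t))"
    if t: "t > 0" for t
  proof -
    note X = f[OF t] g[OF t] pair_closed[OF f[OF t] g[OF t]]
    have "nrm (re (pair (f t) (g t))) = nrm (f t)" "nrm (im (pair (f t) (g t))) = nrm (g t)"
      using re_im_pair[OF X(1,2)] X by (auto intro!: real.nrm_cong_AE re_closed im_closed)
    then show "norm (nrm (pair (f t) (g t))) \<le> nrm (f t) + nrm (g t)"
      "norm (nrm (f t)) \<le> nrm (pair (f t) (g t))" "norm (nrm (g t)) \<le> nrm (pair (f t) (g t))"
      using nrm_pair_le[OF X(1,2)] nrm_re_le[OF X(3)] nrm_im_le[OF X(3)] X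
      by (simp_all add: real.nrm_nonneg complex.nrm_nonneg)
  qed
  note null = Lim_null_comparison[OF eventually_mono[OF eventually_at_right_less]]
  show ?thesis
  proof (intro iffI conjI)
    assume lim: "((\<lambda>t. nrm (pair (f t) (g t))) \<longlongrightarrow> 0) (at_right 0)"
    show "((\<lambda>t. nrm (f t)) \<longlongrightarrow> 0) (at_right 0)" by (rule null[OF le(2) lim])
    show "((\<lambda>t. nrm (g t)) \<longlongrightarrow> 0) (at_right 0)" by (rule null[OF le(3) lim])
  next
    assume "((\<lambda>t. nrm (f t)) \<longlongrightarrow> 0) (at_right 0) \<and> ((\<lambda>t. nrm (g t)) \<longlongrightarrow> 0) (at_right 0)"
    then have lim: "((\<lambda>t. nrm (f t) + nrm (g t)) \<longlongrightarrow> 0) (at_right 0)"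
      by (simp add: tendsto_add_zero)
    show "((\<lambda>t. nrm (pair (f t) (g t))) \<longlongrightarrow> 0) (at_right 0)" by (rule null[OF le(1) lim])
  qed
qed

definition T_complex :: "real \<Rightarrow> 'n state \<Rightarrow> 'n state" where
  "T_complex t f = pair (T t (re f)) (T t (im f))"

lemma T_complex_closed: "t \<ge> 0 \<Longrightarrow> f \<in> X \<Longrightarrow> T_complex t f \<in> X"
  unfolding T_complex_def by (intro pair_closed real.T_closed re_closed im_closed)

lemma T_real_lincomb:
  assumes "t \<ge> 0" "f \<in> XR" "g \<in> XR"
  shows "AE \<xi> in M. T t (\<lambda>\<eta>. p *\<^sub>R f \<eta> + q *\<^sub>R g \<eta>) \<xi> = p *\<^sub>R T t f \<xi> + q *\<^sub>R T t g \<xi>"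
  using real.T_lincomb[OF assms Reals_of_real[of p] Reals_of_real[of q]]
  by (simp add: of_real_vector_smult)

lemma T_complex_smult:
  assumes t: "t \<ge> 0" and f: "f \<in> X"
  shows "AE \<xi> in M. T_complex t (\<lambda>\<eta>. c *s f \<eta>) \<xi> = c *s T_complex t f \<xi>"
proof -
  note X = re_closed[OF f] im_closed[OF f]
  have re: "re (\<lambda>\<eta>. c *s f \<eta>) = (\<lambda>\<eta>. Re c *\<^sub>R re f \<eta> + (- Im c) *\<^sub>R im f \<eta>)"
    and im: "im (\<lambda>\<eta>. c *s f \<eta>) = (\<lambda>\<eta>. Im c *\<^sub>R re f \<eta> + Re c *\<^sub>R im f \<eta>)"
    by (simp_all add: fun_eq_iff re_vec_def im_vec_def vec_eq_iff complex_eq_iff)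
  show ?thesis
    using T_real_lincomb[OF t X, of "Re c" "- Im c"] T_real_lincomb[OF t X, of "Im c" "Re c"]
  proof eventually_elim
    case (elim \<xi>)
    show ?case
      unfolding T_complex_def re im elim by (simp add: vec_eq_iff complex_eq_iff algebra_simps)
  qed
qed

lemma T_complex_linear_add:
  assumes t: "t \<ge> 0" and f: "f \<in> X" and g: "g \<in> X"
  shows "AE \<xi> in M. T_complex t (\<lambda>\<eta>. f \<eta> + g \<eta>) \<xi> = T_complex t f \<xi> + T_complex t g \<xi>"
proof -
  have re: "re (\<lambda>\<eta>. f \<eta> + g \<eta>) = (\<lambda>\<eta>. 1 *\<^sub>R re f \<eta> + 1 *\<^sub>R re g \<eta>)"
    and im: "im (\<lambda>\<eta>. f \<eta> + g \<eta>) = (\<lambda>\<eta>. 1 *\<^sub>R im f \<eta> + 1 *\<^sub>R im g \<eta>)"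
    by (simp_all add: fun_eq_iff re_vec_def im_vec_def vec_eq_iff complex_eq_iff)
  show ?thesis
    using T_real_lincomb[OF t re_closed[OF f] re_closed[OF g], of 1 1]
      T_real_lincomb[OF t im_closed[OF f] im_closed[OF g], of 1 1]
  proof eventually_elim
    case (elim \<xi>)
    show ?case
      unfolding T_complex_def re im elim by (simp add: vec_eq_iff algebra_simps)
  qed
qed

lemma T_complex_semigroup:
  assumes t: "t \<ge> 0" and r: "r \<ge> 0" and f: "f \<in> X"
  shows "AE \<xi> in M. T_complex (t + r) f \<xi> = T_complex t (T_complex r f) \<xi>"
proof -
  note X = re_closed[OF f] im_closed[OF f]
  note Tr = real.T_closed[OF r X(1)] real.T_closed[OF r X(2)]
  note T_complex = T_complex_closed[OF r f]
  have "AE \<xi> in M. T t (re (T_complex r f)) \<xi> = T t (T r (re f)) \<xi>"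
    using re_im_pair(1)[OF Tr]
    by (intro real.T_cong_AE t re_closed T_complex Tr) (simp add: T_complex_def)
  moreover have "AE \<xi> in M. T t (im (T_complex r f)) \<xi> = T t (T r (im f)) \<xi>"
    using re_im_pair(2)[OF Tr]
    by (intro real.T_cong_AE t im_closed T_complex Tr) (simp add: T_complex_def)
  ultimately show ?thesis
    using real.T_add[OF t r X(1)] real.T_add[OF t r X(2)]
    by eventually_elim (simp add: T_complex_def[of t] T_complex_def[of "t + r"])
qed

lemma T_complex_difference_quotient:
  "(\<lambda>\<xi>. r *\<^sub>R (T_complex t f \<xi> - f \<xi>) - g \<xi>) =
    pair (\<lambda>\<xi>. r *\<^sub>R (T t (re f) \<xi> - re f \<xi>) - re g \<xi>)
      (\<lambda>\<xi>. r *\<^sub>R (T t (im f) \<xi> - im f \<xi>) - im g \<xi>)"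
proof
  fix \<xi>
  have "r *\<^sub>R (T_complex t f \<xi> - f \<xi>) - g \<xi> =
      r *\<^sub>R (T_complex t f \<xi> - (re f \<xi> + \<i> *s im f \<xi>)) - (re g \<xi> + \<i> *s im g \<xi>)"
    unfolding re_vec_add_im_vec ..
  then show "r *\<^sub>R (T_complex t f \<xi> - f \<xi>) - g \<xi> =
      r *\<^sub>R (T t (re f) \<xi> - re f \<xi>) - re g \<xi> + \<i> *s (r *\<^sub>R (T t (im f) \<xi> - im f \<xi>) - im g \<xi>)"
    by (simp add: T_complex_def vec_eq_iff complex_eq_iff algebra_simps)
qed

lemma T_complex_bounded:
  assumes t: "t \<ge> 0"
  shows "\<exists>C. \<forall>f\<in>X. nrm (T_complex t f) \<le> C * nrm f"
proof -
  obtain C where C: "C \<ge> 0" "\<And>f. f \<in> XR \<Longrightarrow> nrm (T t f) \<le> C * nrm f"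
    by (rule real.T_bounded[OF t]) (rule that)
  have "nrm (T_complex t f) \<le> (2 * C) * nrm f" if f: "f \<in> X" for f
  proof -
    note X = re_closed[OF f] im_closed[OF f]
    have "nrm (T_complex t f) \<le> nrm (T t (re f)) + nrm (T t (im f))"
      unfolding T_complex_def by (intro nrm_pair_le real.T_closed t X)
    also have "\<dots> \<le> C * nrm (re f) + C * nrm (im f)" by (intro add_mono C X)
    also have "\<dots> \<le> C * nrm f + C * nrm f"
      by (intro add_mono mult_left_mono nrm_re_le nrm_im_le f C)
    finally show ?thesis by simp
  qed
  then show ?thesis by blast
qed

lemma T_complex_tendsto:
  assumes f: "f \<in> X"
  shows "((\<lambda>t. nrm (\<lambda>\<xi>. T_complex t f \<xi> - f \<xi>)) \<longlongrightarrow> 0) (at_right 0)"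
proof -
  have diff: "(\<lambda>\<xi>. T_complex t f \<xi> - f \<xi>) =
      pair (\<lambda>\<xi>. T t (re f) \<xi> - re f \<xi>) (\<lambda>\<xi>. T t (im f) \<xi> - im f \<xi>)" for t
    using T_complex_difference_quotient[of 1 t f "\<lambda>_. 0"]
    by (simp add: re_vec_def im_vec_def flip: zero_vec_def)
  show ?thesis
    unfolding diff by (subst tendsto_nrm_pair_iff)
      (auto intro!: real.diff_closed real.T_closed real.T_tendsto re_closed im_closed f)
qed

lemma C0_semigroup_T_complex: "C0_semigroup UNIV X nrm T_complex"
  unfolding C0_semigroup_def
proof (intro conjI allI impI ballI)
  fix t :: real assume t: "t \<ge> 0"
  show "\<exists>C. \<forall>f\<in>X. nrm (T_complex t f) \<le> C * nrm f" by (rule T_complex_bounded[OF t])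
  fix f assume f: "f \<in> X"
  show "T_complex t f \<in> X" by (rule T_complex_closed[OF t f])
  fix g c d assume g: "g \<in> X"
  have "AE \<xi> in M. T_complex t (\<lambda>\<eta>. c *s f \<eta> + d *s g \<eta>) \<xi> =
      c *s T_complex t f \<xi> + d *s T_complex t g \<xi>"
    using T_complex_linear_add[OF t complex.smult_closed[OF f UNIV_I, of c]
        complex.smult_closed[OF g UNIV_I, of d]]
      T_complex_smult[OF t f, of c] T_complex_smult[OF t g, of d]
    by eventually_elim simp
  then show "nrm (\<lambda>\<xi>. T_complex t (\<lambda>\<eta>. c *s f \<eta> + d *s g \<eta>) \<xi> -
        (c *s T_complex t f \<xi> + d *s T_complex t g \<xi>)) = 0"
    by (subst complex.nrm_diff_eq_0_iff)
      (auto intro!: T_complex_closed complex.lincomb_closed t f g)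
next
  fix f assume f: "f \<in> X"
  have "AE \<xi> in M. T_complex 0 f \<xi> = f \<xi>"
    using real.T_zero[OF re_closed[OF f]] real.T_zero[OF im_closed[OF f]]
    by eventually_elim (simp add: T_complex_def re_vec_add_im_vec)
  then show "nrm (\<lambda>\<xi>. T_complex 0 f \<xi> - f \<xi>) = 0"
    by (subst complex.nrm_diff_eq_0_iff) (auto intro: T_complex_closed f)
  show "((\<lambda>t. nrm (\<lambda>\<xi>. T_complex t f \<xi> - f \<xi>)) \<longlongrightarrow> 0) (at_right 0)"
    by (rule T_complex_tendsto[OF f])
next
  fix t r :: real and f assume t: "t \<ge> 0" and r: "r \<ge> 0" and f: "f \<in> X"
  show "nrm (\<lambda>\<xi>. T_complex (t + r) f \<xi> - T_complex t (T_complex r f) \<xi>) = 0"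
    using T_complex_semigroup[OF t r f] t r
    by (subst complex.nrm_diff_eq_0_iff) (auto intro!: T_complex_closed f)
qed

lemma generator_T_complex_iff:
  assumes f: "f \<in> X" and g: "g \<in> X"
  shows "(f, g) \<in> generator X nrm T_complex \<longleftrightarrow>
    (re f, re g) \<in> generator XR nrm T \<and> (im f, im g) \<in> generator XR nrm T"
  unfolding generator_def mem_Collect_eq case_prod_conv T_complex_difference_quotient
  by (subst tendsto_nrm_pair_iff)
    (auto intro!: real.diff_closed real.scaleR_closed real.T_closed re_closed im_closed f g)

lemma generator_T_complex: "generator X nrm T_complex = complexification \<real> (generator XR nrm T)"
proof (intro subset_antisym subsetI)
  fix p assume p: "p \<in> generator X nrm T_complex"
  obtain f g where fg: "p = (f, g)" by (cases p)
  then have X: "f \<in> X" "g \<in> X" using p by (auto simp: generator_def)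
  have "p = (pair (re f) (im f), pair (re g) (im g))" by (simp add: fg re_vec_add_im_vec)
  moreover have "(re f, re g) \<in> generator XR nrm T" "(im f, im g) \<in> generator XR nrm T"
    using p generator_T_complex_iff[OF X] fg by auto
  ultimately show "p \<in> complexification \<real> (generator XR nrm T)"
    unfolding complexification_def if_P[OF refl] mem_Collect_eq
    by (intro exI[of _ "re f"] exI[of _ "im f"] exI[of _ "re g"] exI[of _ "im g"] conjI)
next
  fix p assume "p \<in> complexification \<real> (generator XR nrm T)"
  then obtain f1 f2 g1 g2 where p: "p = (pair f1 f2, pair g1 g2)"
    and gen: "(f1, g1) \<in> generator XR nrm T" "(f2, g2) \<in> generator XR nrm T"
    unfolding complexification_def if_P[OF refl] by blast
  then have XR: "f1 \<in> XR" "g1 \<in> XR" "f2 \<in> XR" "g2 \<in> XR" by (auto simp: generator_def)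
  note X = pair_closed[OF XR(1,3)] pair_closed[OF XR(2,4)]
  have "(re (pair f1 f2), re (pair g1 g2)) \<in> generator XR nrm T"
    using re_im_pair(1)[OF XR(1,3)] re_im_pair(1)[OF XR(2,4)]
    by (intro real.generator_cong_AE[OF gen(1)] re_closed X) (simp_all add: eq_commute)
  moreover have "(im (pair f1 f2), im (pair g1 g2)) \<in> generator XR nrm T"
    using re_im_pair(2)[OF XR(1,3)] re_im_pair(2)[OF XR(2,4)]
    by (intro real.generator_cong_AE[OF gen(2)] im_closed X) (simp_all add: eq_commute)
  ultimately show "p \<in> generator X nrm T_complex" unfolding p
    by (simp add: generator_T_complex_iff[OF X])
qed

end


section \<open>The energy norm\<close>

definition coercive :: "real \<Rightarrow> complex^'n^'n \<Rightarrow> bool" where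
  "coercive m A \<longleftrightarrow> (\<forall>x. m * (norm x)\<^sup>2 \<le> (A *v x) \<bullet> x)"

lemma
  fixes A :: "complex^'n^'n"
  assumes m: "m > 0" and coercive: "coercive m A"
  shows coercive_imp_invertible: "invertible A"
    and norm_matrix_inv_coercive_le: "norm (matrix_inv A *v x) \<le> 1 / m * norm x"
proof -
  have lower: "m * norm x \<le> norm (A *v x)" for x
  proof (cases "x = 0")
    case False
    have "m * (norm x)\<^sup>2 \<le> norm (A *v x) * norm x"
      using coercive unfolding coercive_def by (blast intro: order_trans norm_cauchy_schwarz)
    then show ?thesis using False by (simp add: power2_eq_square)
  qed simp
  show inv: "invertible A"
    unfolding invertible_iff_ker using lower m
    by (metis mult_le_0_iff norm_le_zero_iff norm_zero not_less)
  show "norm (matrix_inv A *v x) \<le> 1 / m * norm x"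
    using lower[of "matrix_inv A *v x"] m by (simp add: matrix_inv_vector[OF inv] field_simps)
qed

lemma coercive_nonneg:
  fixes x :: "complex^'n"
  assumes "m > 0" "coercive m A"
  shows "0 \<le> (A *v x) \<bullet> x"
proof -
  have "0 \<le> m * (norm x)\<^sup>2" using assms(1) by simp
  also have "\<dots> \<le> (A *v x) \<bullet> x" using assms(2) by (simp add: coercive_def)
  finally show ?thesis .
qed

lemma coercive_eq_0:
  fixes x :: "complex^'n"
  assumes "m > 0" "coercive m A" "(A *v x) \<bullet> x = 0"
  shows "x = 0"
proof -
  have "m * (norm x)\<^sup>2 \<le> 0" using assms(2,3) unfolding coercive_def by metis
  then show ?thesis using assms(1) by (simp add: mult_le_0_iff)
qed

locale hyperbolic_coefficients =
  fixes a b :: real and P1 :: "complex^'n^('n::finite)" and P0 H :: "real \<Rightarrow> complex^'n^'n"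
  assumes interval: "a < b" and P1_invertible: "invertible P1"
    and P0_Linf: "P0 \<in> Linf_mat UNIV a b" and H_Linf: "H \<in> Linf_mat UNIV a b"
    and H_self_adjoint: "AE \<xi> in lebesgue_on {a..b}. self_adjoint (H \<xi>)"
    and H_coercive: "\<exists>m>0. AE \<xi> in lebesgue_on {a..b}. coercive m (H \<xi>)"
begin

abbreviation M :: "real measure" where "M \<equiv> lebesgue_on {a..b}"

abbreviation X :: "'n state set" where "X \<equiv> L2 UNIV a b"

abbreviation nrm :: "'n state \<Rightarrow> real" where "nrm \<equiv> X_norm a b H"

lemma H_invertible: "AE \<xi> in M. invertible (H \<xi>)"
  using H_coercive by (auto elim!: eventually_mono intro: coercive_imp_invertible)

lemma H_inv_Linf: "(\<lambda>\<xi>. matrix_inv (H \<xi>)) \<in> Linf_mat UNIV a b"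
proof -
  obtain m where m: "m > 0" "AE \<xi> in M. coercive m (H \<xi>)"
    using H_coercive by blast
  have "AE \<xi> in M. norm (matrix_inv (H \<xi>)) \<le> real (CARD('n) * CARD('n)) * (1 / m)"
    using m(2)
  proof eventually_elim
    case (elim \<xi>)
    then show ?case by (intro norm_matrix_le norm_matrix_inv_coercive_le m(1))
  qed
  then show ?thesis
    using H_Linf by (auto simp: Linf_mat_UNIV_iff intro: borel_measurable_matrix_inv)
qed

definition energy :: "'n state \<Rightarrow> 'n state \<Rightarrow> real" where
  "energy f g = 1/2 * (LINT \<xi>|M. (H \<xi> *v f \<xi>) \<bullet> g \<xi>)"

lemma integrable_energy: "f \<in> X \<Longrightarrow> g \<in> X \<Longrightarrow> integrable M (\<lambda>\<xi>. (H \<xi> *v f \<xi>) \<bullet> g \<xi>)"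
  by (intro L2_bounded_bilinear_integrable bounded_bilinear_inner L2_Linf_mat H_Linf)

lemma X_norm_eq_sqrt_energy:
  assumes "f \<in> X"
  shows "nrm f = sqrt (energy f f)"
proof -
  have "integrable M (\<lambda>\<xi>. cinner (H \<xi> *v f \<xi>) (f \<xi>))"
    by (intro L2_bounded_bilinear_integrable bounded_bilinear_cinner L2_Linf_mat H_Linf assms)
  from integral_bounded_linear[OF bounded_linear_Re this] show ?thesis
    by (simp add: X_norm_def X_inner_def energy_def inner_eq_Re_cinner)
qed

lemma H_nonneg: "AE \<xi> in M. \<forall>x. 0 \<le> (H \<xi> *v x) \<bullet> x"
  using H_coercive by (auto elim!: eventually_mono intro: coercive_nonneg)

lemma energy_nonneg: "0 \<le> energy f f"
  using H_nonneg unfolding energy_def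
  by (intro mult_nonneg_nonneg integral_nonneg_AE) (auto elim: eventually_mono)

lemma X_norm_square: "f \<in> X \<Longrightarrow> (nrm f)\<^sup>2 = energy f f"
  by (simp add: X_norm_eq_sqrt_energy energy_nonneg)

lemma energy_commute:
  assumes "f \<in> X" "g \<in> X"
  shows "energy f g = energy g f"
proof -
  have "AE \<xi> in M. (H \<xi> *v f \<xi>) \<bullet> g \<xi> = (H \<xi> *v g \<xi>) \<bullet> f \<xi>"
    using H_self_adjoint by eventually_elim (metis self_adjoint_inner inner_commute)
  then show ?thesis
    unfolding energy_def using assms
    by (intro arg_cong2[where f="(*)"] refl integral_cong_AE borel_measurable_integrable
        integrable_energy)
qed

lemma energy_add_scaleR:
  assumes f: "f \<in> X" and g: "g \<in> X"
  shows "energy (\<lambda>\<xi>. f \<xi> + t *\<^sub>R g \<xi>) (\<lambda>\<xi>. f \<xi> + t *\<^sub>R g \<xi>) =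
    energy f f + 2 * t * energy f g + t\<^sup>2 * energy g g"
proof -
  let ?e = "\<lambda>f g \<xi>. (H \<xi> *v f \<xi>) \<bullet> g \<xi>"
  have "(LINT \<xi>|M. ?e (\<lambda>\<xi>. f \<xi> + t *\<^sub>R g \<xi>) (\<lambda>\<xi>. f \<xi> + t *\<^sub>R g \<xi>) \<xi>) =
      (LINT \<xi>|M. ?e f f \<xi> + (t * ?e f g \<xi> + t * ?e g f \<xi>) + t\<^sup>2 * ?e g g \<xi>)"
    by (rule Bochner_Integration.integral_cong)
      (simp_all add: matrix_vector_right_distrib matrix_vector_mult.scaleR_right inner_add_left
        inner_add_right power2_eq_square algebra_simps)
  also have "\<dots> = (LINT \<xi>|M. ?e f f \<xi>) + (t * (LINT \<xi>|M. ?e f g \<xi>) + t * (LINT \<xi>|M. ?e g f \<xi>)) +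
      t\<^sup>2 * (LINT \<xi>|M. ?e g g \<xi>)"
    by (simp add: integrable_energy f g)
  finally show ?thesis
    using energy_commute[OF f g] by (simp add: energy_def algebra_simps)
qed

lemma energy_le_X_norm:
  assumes f: "f \<in> X" and g: "g \<in> X"
  shows "energy f g \<le> nrm f * nrm g"
proof -
  have "0 \<le> energy f f + 2 * t * energy f g + t\<^sup>2 * energy g g" for t
    unfolding energy_add_scaleR[OF f g, symmetric] by (rule energy_nonneg)
  then have "(energy f g)\<^sup>2 \<le> energy f f * energy g g"
    by (rule nonneg_quadratic_discriminant) (rule energy_nonneg)
  then have "energy f g \<le> sqrt (energy f f * energy g g)" by (rule real_le_rsqrt)
  then show ?thesis using f g by (simp add: X_norm_eq_sqrt_energy real_sqrt_mult)
qed

lemma X_norm_triangle: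
  assumes f: "f \<in> X" and g: "g \<in> X"
  shows "nrm (\<lambda>\<xi>. f \<xi> + g \<xi>) \<le> nrm f + nrm g"
proof (rule power2_le_imp_le)
  have "(nrm (\<lambda>\<xi>. f \<xi> + g \<xi>))\<^sup>2 = energy f f + 2 * energy f g + energy g g"
    using energy_add_scaleR[OF f g, of 1] by (simp add: X_norm_square L2_add f g)
  also have "\<dots> \<le> (nrm f + nrm g)\<^sup>2"
    using energy_le_X_norm[OF f g] by (simp add: power2_sum X_norm_square f g)
  finally show "(nrm (\<lambda>\<xi>. f \<xi> + g \<xi>))\<^sup>2 \<le> (nrm f + nrm g)\<^sup>2" .
qed (simp add: X_norm_eq_sqrt_energy f g energy_nonneg)

lemma X_norm_smult:
  assumes "f \<in> X"
  shows "nrm (\<lambda>\<xi>. c *s f \<xi>) = cmod c * nrm f"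
proof -
  have "energy (\<lambda>\<xi>. c *s f \<xi>) (\<lambda>\<xi>. c *s f \<xi>) = (cmod c)\<^sup>2 * energy f f"
    by (simp add: energy_def inner_eq_Re_cinner vector_scalar_commute cinner_vector_smult)
  then show ?thesis using assms
    by (simp add: X_norm_eq_sqrt_energy L2_vector_smult real_sqrt_mult)
qed

lemma X_norm_eq_0_iff:
  assumes f: "f \<in> X"
  shows "nrm f = 0 \<longleftrightarrow> (AE \<xi> in M. f \<xi> = 0)"
proof -
  obtain m where m: "m > 0" "AE \<xi> in M. coercive m (H \<xi>)"
    using H_coercive by blast
  have nonneg: "AE \<xi> in M. 0 \<le> (H \<xi> *v f \<xi>) \<bullet> f \<xi>"
    using H_nonneg by (auto elim: eventually_mono)
  have "nrm f = 0 \<longleftrightarrow> (AE \<xi> in M. (H \<xi> *v f \<xi>) \<bullet> f \<xi> = 0)"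
    using integral_nonneg_eq_0_iff_AE[OF integrable_energy[OF f f] nonneg]
    by (simp add: X_norm_eq_sqrt_energy f energy_def)
  also have "\<dots> \<longleftrightarrow> (AE \<xi> in M. f \<xi> = 0)"
  proof
    assume "AE \<xi> in M. (H \<xi> *v f \<xi>) \<bullet> f \<xi> = 0"
    with m(2) show "AE \<xi> in M. f \<xi> = 0" by eventually_elim (rule coercive_eq_0[OF m(1)])
  qed (auto elim: eventually_mono)
  finally show ?thesis .
qed

lemma function_space_L2:
  assumes "F = \<real> \<or> F = UNIV"
  shows "function_space F M (L2 F a b) nrm"
proof
  show "(\<lambda>\<xi>. c *s f \<xi> + d *s g \<xi>) \<in> L2 F a b"
    if "f \<in> L2 F a b" "g \<in> L2 F a b" "c \<in> F" "d \<in> F" for f g c d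
    by (rule L2_lincomb[OF assms that])
qed (auto simp: assms L2_iff[of _ F] X_norm_triangle X_norm_smult X_norm_eq_0_iff)

sublocale function_space UNIV M X nrm
  by (rule function_space_L2) simp

lemma X_norm_le_sup:
  obtains C where "C \<ge> 0"
    "\<And>f B. f \<in> X \<Longrightarrow> B \<ge> 0 \<Longrightarrow> AE \<xi> in M. norm (f \<xi>) \<le> B \<Longrightarrow> nrm f \<le> C * B"
proof -
  interpret finite_measure M by (rule finite_measure_lebesgue_on) auto
  obtain c where c: "c \<ge> 0" "AE \<xi> in M. \<forall>x. norm (H \<xi> *v x) \<le> c * norm x"
    by (rule Linf_mat_mult_vec_bound[OF H_Linf])
  have "nrm f \<le> sqrt (1/2 * (c * (b - a))) * B"
    if f: "f \<in> X" and B: "B \<ge> 0" "AE \<xi> in M. norm (f \<xi>) \<le> B" for f B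
  proof -
    have "AE \<xi> in M. (H \<xi> *v f \<xi>) \<bullet> f \<xi> \<le> c * B\<^sup>2"
      using c(2) B(2)
    proof eventually_elim
      case (elim \<xi>)
      have "(H \<xi> *v f \<xi>) \<bullet> f \<xi> \<le> norm (H \<xi> *v f \<xi>) * norm (f \<xi>)" by (rule norm_cauchy_schwarz)
      also have "\<dots> \<le> (c * norm (f \<xi>)) * norm (f \<xi>)" using elim by (intro mult_right_mono) auto
      also have "\<dots> \<le> (c * B) * B" using elim B(1) c(1) by (intro mult_mono) auto
      finally show ?case by (simp add: power2_eq_square)
    qed
    then have "(LINT \<xi>|M. (H \<xi> *v f \<xi>) \<bullet> f \<xi>) \<le> (LINT \<xi>|M. c * B\<^sup>2)"
      by (intro integral_mono_AE integrable_energy f) auto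
    also have "\<dots> = c * (b - a) * B\<^sup>2" using interval by (simp add: measure_restrict_space)
    finally have "nrm f \<le> sqrt (1/2 * (c * (b - a))) * sqrt (B\<^sup>2)"
      unfolding X_norm_eq_sqrt_energy[OF f] energy_def real_sqrt_mult[symmetric]
      by (intro real_sqrt_le_mono) simp
    then show ?thesis using B(1) by simp
  qed
  then show thesis using that[of "sqrt (1/2 * (c * (b - a)))"] c(1) interval by simp
qed

lemma L1_norm_le_X_norm:
  obtains C where "C \<ge> 0" "\<And>f. f \<in> X \<Longrightarrow> (LINT \<xi>|M. norm (f \<xi>)) \<le> C * nrm f"
proof -
  obtain m where m: "m > 0" "AE \<xi> in M. coercive m (H \<xi>)"
    using H_coercive by blast
  have "(LINT \<xi>|M. norm (f \<xi>)) \<le> sqrt (b - a) * sqrt (2 / m) * nrm f" if f: "f \<in> X" for f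
  proof -
    have "(LINT \<xi>|M. m * (norm (f \<xi>))\<^sup>2) \<le> (LINT \<xi>|M. (H \<xi> *v f \<xi>) \<bullet> f \<xi>)"
      using m(2) f
      by (intro integral_mono_AE integrable_energy)
        (auto simp: L2_UNIV_iff coercive_def elim: eventually_mono)
    then have "(LINT \<xi>|M. (norm (f \<xi>))\<^sup>2) \<le> 2 / m * energy f f"
      using m(1) by (simp add: energy_def field_simps)
    then have "sqrt (LINT \<xi>|M. (norm (f \<xi>))\<^sup>2) \<le> sqrt (2 / m) * nrm f"
      unfolding X_norm_eq_sqrt_energy[OF f] by (simp flip: real_sqrt_mult)
    then have "sqrt (b - a) * sqrt (LINT \<xi>|M. (norm (f \<xi>))\<^sup>2) \<le>
        sqrt (b - a) * (sqrt (2 / m) * nrm f)"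
      using interval by (intro mult_left_mono) auto
    then show ?thesis
      using L1_norm_le_L2_norm[OF less_imp_le[OF interval] f] by (simp add: mult.assoc)
  qed
  then show thesis using that[of "sqrt (b - a) * sqrt (2 / m)"] m(1) interval by simp
qed

end


section \<open>The resolvent equation\<close>

context hyperbolic_coefficients
begin

definition ode_mat :: "complex \<Rightarrow> real \<Rightarrow> complex^'n^'n" where
  "ode_mat s \<tau> = - (matrix_inv P1 ** (P0 \<tau> - mat s ** matrix_inv (H \<tau>)))"

lemma ode_mat_mult_vec:
  "ode_mat s \<tau> *v x = matrix_inv P1 *v (s *s (matrix_inv (H \<tau>) *v x) - P0 \<tau> *v x)"
  by (simp add: ode_mat_def matrix_vector_mult.minus_left matrix_vector_mult_diff_rdistrib
      matrix_vector_mult_diff_distrib mat_mult_vec flip: matrix_vector_mul_assoc)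

lemma ode_mat_Linf: "ode_mat s \<in> Linf_mat UNIV a b"
proof -
  have "(\<lambda>\<tau>. 0 - matrix_inv P1 ** (P0 \<tau> - mat s ** matrix_inv (H \<tau>))) \<in> Linf_mat UNIV a b"
    by (intro Linf_mat_diff Linf_mat_mult Linf_mat_const P0_Linf H_inv_Linf)
  then show ?thesis by (simp add: ode_mat_def[abs_def])
qed

sublocale vec: linear_volterra "(*v)" a b "ode_mat s" for s
  using interval ode_mat_Linf[of s]
  by unfold_locales (auto simp: Linf_mat_UNIV_iff)

sublocale mat: linear_volterra "(**)" a b "ode_mat s" for s
  using interval ode_mat_Linf[of s]
  by unfold_locales (auto simp: Linf_mat_UNIV_iff)

abbreviation \<Psi> :: "complex \<Rightarrow> real \<Rightarrow> complex^'n^'n" where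
  "\<Psi> s \<equiv> fundamental_solution a b P1 P0 H s"

lemma is_fundamental_solution_iff:
  "is_fundamental_solution a b P1 P0 H s \<Phi> \<longleftrightarrow> mat.volterra_solution s (\<lambda>_. mat 1) \<Phi>"
  unfolding is_fundamental_solution_def mat.volterra_solution_def mat.volterra_def ode_mat_def
  by (simp add: matrix_matrix_mult.minus_left)

lemma volterra_solution_\<Psi>: "mat.volterra_solution s (\<lambda>_. mat 1) (\<Psi> s)"
proof -
  obtain \<Phi> where "mat.volterra_solution s (\<lambda>_. mat 1) \<Phi>"
    by (rule mat.volterra_solution_exists[OF continuous_on_const])
  then have "is_fundamental_solution a b P1 P0 H s \<Phi>" by (simp add: is_fundamental_solution_iff)
  then have "is_fundamental_solution a b P1 P0 H s (\<Psi> s)"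
    unfolding fundamental_solution_def by (rule someI[of "is_fundamental_solution a b P1 P0 H s"])
  then show ?thesis by (simp add: is_fundamental_solution_iff)
qed

lemma continuous_on_\<Psi>: "continuous_on {a..b} (\<Psi> s)"
  and \<Psi>_eq: "\<zeta> \<in> {a..b} \<Longrightarrow> \<Psi> s \<zeta> = mat 1 + mat.volterra s (\<Psi> s) \<zeta>"
  using volterra_solution_\<Psi>[of s] unfolding mat.volterra_solution_def by blast+

lemma \<Psi>_a: "\<Psi> s a = mat 1"
  using \<Psi>_eq[of a s] interval by (simp add: mat.volterra_at_left_end)

lemma continuous_on_\<Psi>_mult_vec: "continuous_on {a..b} (\<lambda>\<zeta>. \<Psi> s \<zeta> *v v)"
  by (intro matrix_vector_mult.continuous_on continuous_on_\<Psi> continuous_on_const)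

lemma \<Psi>_mult_vec_eq:
  assumes "\<zeta> \<in> {a..b}"
  shows "\<Psi> s \<zeta> *v v = v + vec.volterra s (\<lambda>\<tau>. \<Psi> s \<tau> *v v) \<zeta>"
proof -
  have "vec.volterra s (\<lambda>\<tau>. \<Psi> s \<tau> *v v) \<zeta> =
      (LINT \<tau>|lebesgue_on {a..\<zeta>}. (ode_mat s \<tau> ** \<Psi> s \<tau>) *v v)"
    by (simp add: vec.volterra_def matrix_vector_mul_assoc)
  also have "\<dots> = mat.volterra s (\<Psi> s) \<zeta> *v v"
    unfolding mat.volterra_def
    by (rule integral_bounded_linear[OF matrix_vector_mult.bounded_linear_left
          mat.integrable_kernel[OF continuous_on_\<Psi> assms]])
  finally show ?thesis
    using \<Psi>_eq[OF assms, of s] by (simp add: matrix_vector_mult_add_rdistrib)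
qed

text \<open>The first-order system for \<open>w = \<H> f\<close> that is equivalent to \<open>s f - A f = g\<close>.\<close>

definition resolvent_ode :: "complex \<Rightarrow> 'n state \<Rightarrow> 'n state \<Rightarrow> bool" where
  "resolvent_ode s g w \<longleftrightarrow> H1 UNIV a b w (\<lambda>\<tau>. ode_mat s \<tau> *v w \<tau> - matrix_inv P1 *v g \<tau>)"

definition source :: "'n state \<Rightarrow> 'n state" where
  "source g \<zeta> = (LINT \<tau>|lebesgue_on {a..\<zeta>}. matrix_inv P1 *v g \<tau>)"

lemma source_at_left_end: "source g a = 0"
  by (simp add: source_def LINT_singleton)

lemma L2_matrix_inv_P1: "g \<in> X \<Longrightarrow> (\<lambda>\<tau>. matrix_inv P1 *v g \<tau>) \<in> X"
  by (rule L2_bounded_linear[OF matrix_vector_mul_bounded_linear])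

lemma continuous_on_source: "g \<in> X \<Longrightarrow> continuous_on {a..b} (source g)"
  unfolding source_def[abs_def] using interval
  by (intro continuous_on_indefinite_LINT L2_integrable[OF L2_matrix_inv_P1]) auto

lemma norm_source_le:
  obtains C where "C \<ge> 0" "\<And>g \<zeta>. g \<in> X \<Longrightarrow> \<zeta> \<in> {a..b} \<Longrightarrow> norm (source g \<zeta>) \<le> C * nrm g"
proof -
  obtain D where D: "D \<ge> 0" "\<And>f. f \<in> X \<Longrightarrow> (LINT \<xi>|M. norm (f \<xi>)) \<le> D * nrm f"
    by (rule L1_norm_le_X_norm) (rule that)
  obtain k where k: "k > 0" "\<And>x. norm (matrix_inv P1 *v x) \<le> norm x * k"
    using bounded_linear.pos_bounded[OF matrix_vector_mul_bounded_linear, of "matrix_inv P1"]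
    by blast
  have "norm (source g \<zeta>) \<le> (k * D) * nrm g" if g: "g \<in> X" and \<zeta>: "\<zeta> \<in> {a..b}" for g \<zeta>
  proof -
    have "norm (source g \<zeta>) \<le> (LINT \<tau>|lebesgue_on {a..\<zeta>}. norm (matrix_inv P1 *v g \<tau>))"
      unfolding source_def by (rule integral_norm_bound)
    also have "\<dots> \<le> (LINT \<tau>|M. k * norm (g \<tau>))"
      using \<zeta> k interval L2_integrable[OF g, of b]
      by (intro integral_mono_lebesgue_on_AE) (auto simp: mult.commute)
    also have "\<dots> \<le> k * (D * nrm g)" using D(2)[OF g] k(1) by simp
    finally show ?thesis by simp
  qed
  then show thesis using that[of "k * D"] k(1) D(1) by simp
qed

lemma resolvent_ode_continuous_on: "resolvent_ode s g w \<Longrightarrow> continuous_on {a..b} w"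
  unfolding resolvent_ode_def by (rule H1_continuous_on)

lemma resolvent_ode_iff_volterra:
  assumes g: "g \<in> X"
  shows "resolvent_ode s g w \<longleftrightarrow> vec.volterra_solution s (\<lambda>\<zeta>. w a - source g \<zeta>) w"
proof (cases "continuous_on {a..b} w")
  case w: True
  note P1g = L2_matrix_inv_P1[OF g]
  have "(\<lambda>\<tau>. ode_mat s \<tau> *v w \<tau> - matrix_inv P1 *v g \<tau>) \<in> X"
    by (intro L2_diff P1g L2_Linf_mat[OF ode_mat_Linf L2_continuous[OF w]])
  moreover have "(LINT \<tau>|lebesgue_on {a..\<zeta>}. ode_mat s \<tau> *v w \<tau> - matrix_inv P1 *v g \<tau>) =
      vec.volterra s w \<zeta> - source g \<zeta>" if "\<zeta> \<in> {a..b}" for \<zeta>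
    unfolding vec.volterra_def source_def
    by (rule Bochner_Integration.integral_diff[OF vec.integrable_kernel[OF w that]
          L2_integrable[OF P1g that]])
  ultimately show ?thesis
    using w by (auto simp: resolvent_ode_def H1_def vec.volterra_solution_def)
next
  case False
  then show ?thesis using resolvent_ode_continuous_on vec.volterra_solution_def by blast
qed

lemma resolvent_ode_homogeneous: "resolvent_ode s (\<lambda>_. 0) (\<lambda>\<zeta>. \<Psi> s \<zeta> *v v)"
  using \<Psi>_mult_vec_eq[of _ s v] continuous_on_\<Psi>_mult_vec
  by (auto simp: resolvent_ode_iff_volterra[OF L2_zero] vec.volterra_solution_def source_def \<Psi>_a)

lemma resolvent_ode_add:
  assumes "resolvent_ode s g w" "resolvent_ode s g' w'"
  shows "resolvent_ode s (\<lambda>\<xi>. g \<xi> + g' \<xi>) (\<lambda>\<xi>. w \<xi> + w' \<xi>)"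
proof -
  have "(\<lambda>\<tau>. ode_mat s \<tau> *v (w \<tau> + w' \<tau>) - matrix_inv P1 *v (g \<tau> + g' \<tau>)) =
      (\<lambda>\<tau>. (ode_mat s \<tau> *v w \<tau> - matrix_inv P1 *v g \<tau>) +
        (ode_mat s \<tau> *v w' \<tau> - matrix_inv P1 *v g' \<tau>))"
    by (simp add: fun_eq_iff matrix_vector_right_distrib)
  then show ?thesis using H1_add[OF assms[unfolded resolvent_ode_def]]
    by (simp add: resolvent_ode_def)
qed

lemma resolvent_ode_unique:
  assumes g: "g \<in> X" and w: "resolvent_ode s g w" "resolvent_ode s g w'" "w a = w' a"
    and \<zeta>: "\<zeta> \<in> {a..b}"
  shows "w \<zeta> = w' \<zeta>"
  using w unfolding resolvent_ode_iff_volterra[OF g]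
  by (intro vec.volterra_solution_unique[OF _ _ \<zeta>, of s "\<lambda>\<zeta>. w a - source g \<zeta>"]) simp_all

lemma resolvent_ode_exists:
  assumes g: "g \<in> X"
  obtains w where "resolvent_ode s g w" "w a = 0"
proof -
  have "continuous_on {a..b} (\<lambda>\<zeta>. - source g \<zeta>)"
    by (intro continuous_on_minus continuous_on_source g)
  then obtain w where w: "vec.volterra_solution s (\<lambda>\<zeta>. - source g \<zeta>) w"
    by (rule vec.volterra_solution_exists)
  then have "w a = - source g a + vec.volterra s w a"
    using interval unfolding vec.volterra_solution_def by simp
  then have "w a = 0" by (simp add: source_at_left_end vec.volterra_at_left_end)
  moreover from this have "resolvent_ode s g w" using w
    by (simp add: resolvent_ode_iff_volterra[OF g])
  ultimately show thesis by (rule that[rotated])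
qed

lemma resolvent_ode_bound:
  obtains C where "C \<ge> 0" "\<And>g w \<zeta>. g \<in> X \<Longrightarrow> resolvent_ode s g w \<Longrightarrow> \<zeta> \<in> {a..b} \<Longrightarrow>
    norm (w \<zeta>) \<le> C * (norm (w a) + nrm g)"
proof -
  obtain C where C: "C \<ge> 0" "\<And>w p P \<zeta>. vec.volterra_solution s p w \<Longrightarrow>
      (\<And>\<tau>. \<tau> \<in> {a..b} \<Longrightarrow> norm (p \<tau>) \<le> P) \<Longrightarrow> \<zeta> \<in> {a..b} \<Longrightarrow> norm (w \<zeta>) \<le> C * P"
    by (rule vec.volterra_solution_bound[of s]) metis
  obtain D where D: "D \<ge> 0" "\<And>g \<zeta>. g \<in> X \<Longrightarrow> \<zeta> \<in> {a..b} \<Longrightarrow> norm (source g \<zeta>) \<le> D * nrm g"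
    by (rule norm_source_le) (rule that)
  have "norm (w \<zeta>) \<le> (C * (1 + D)) * (norm (w a) + nrm g)"
    if g: "g \<in> X" and w: "resolvent_ode s g w" and \<zeta>: "\<zeta> \<in> {a..b}" for g w \<zeta>
  proof -
    have "norm (w a - source g \<tau>) \<le> norm (w a) + D * nrm g" if "\<tau> \<in> {a..b}" for \<tau>
      using norm_triangle_ineq4[of "w a" "source g \<tau>"] D(2)[OF g that] by linarith
    with w have "norm (w \<zeta>) \<le> C * (norm (w a) + D * nrm g)"
      unfolding resolvent_ode_iff_volterra[OF g] by (rule C(2)[OF _ _ \<zeta>])
    also have "\<dots> \<le> C * ((1 + D) * (norm (w a) + nrm g))"
      using D(1) nrm_nonneg[OF g] by (intro mult_left_mono C(1)) (simp add: algebra_simps)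
    finally show ?thesis by (simp add: mult.assoc)
  qed
  then show thesis using that[of "C * (1 + D)"] C(1) D(1) by simp
qed

lemma variation_of_constants:
  assumes g: "g \<in> X" and w: "resolvent_ode s g w" and p: "resolvent_ode s g p" "p a = 0"
    and \<zeta>: "\<zeta> \<in> {a..b}"
  shows "w \<zeta> = \<Psi> s \<zeta> *v w a + p \<zeta>"
proof -
  have "resolvent_ode s g (\<lambda>\<zeta>. \<Psi> s \<zeta> *v w a + p \<zeta>)"
    using resolvent_ode_add[OF resolvent_ode_homogeneous p(1)] by simp
  from resolvent_ode_unique[OF g w this _ \<zeta>] show ?thesis by (simp add: \<Psi>_a p(2))
qed

lemma homogeneous_solution:
  assumes "resolvent_ode s (\<lambda>_. 0) w" "\<zeta> \<in> {a..b}"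
  shows "w \<zeta> = \<Psi> s \<zeta> *v w a"
  by (rule resolvent_ode_unique[OF L2_zero assms(1) resolvent_ode_homogeneous _ assms(2)])
    (simp add: \<Psi>_a)

definition resolvent_solution :: "complex \<Rightarrow> 'n state \<Rightarrow> 'n state \<Rightarrow> 'n state \<Rightarrow> bool" where
  "resolvent_solution s g f w \<longleftrightarrow> f \<in> X \<and> (\<exists>w'. H1 UNIV a b w w' \<and> (AE \<xi> in M. H \<xi> *v f \<xi> = w \<xi>) \<and>
    (AE \<xi> in M. s *s f \<xi> - g \<xi> = P1 *v w' \<xi> + P0 \<xi> *v (H \<xi> *v f \<xi>)))"

lemma resolvent_solution_iff:
  "resolvent_solution s g f w \<longleftrightarrow>
    f \<in> X \<and> resolvent_ode s g w \<and> (AE \<xi> in M. f \<xi> = matrix_inv (H \<xi>) *v w \<xi>)"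
proof -
  let ?rhs = "\<lambda>\<xi>. ode_mat s \<xi> *v w \<xi> - matrix_inv P1 *v g \<xi>"
  have state: "(AE \<xi> in M. H \<xi> *v f \<xi> = w \<xi>) \<longleftrightarrow> (AE \<xi> in M. f \<xi> = matrix_inv (H \<xi>) *v w \<xi>)"
    using H_invertible
    by (intro eventually_subst) (auto elim!: eventually_mono simp: invertible_mult_vec_eq_iff)
  have deriv: "(AE \<xi> in M. s *s f \<xi> - g \<xi> = P1 *v w' \<xi> + P0 \<xi> *v (H \<xi> *v f \<xi>)) \<longleftrightarrow>
      (AE \<xi> in M. w' \<xi> = ?rhs \<xi>)"
    if w: "AE \<xi> in M. H \<xi> *v f \<xi> = w \<xi>" for w'
  proof (rule eventually_subst)
    show "AE \<xi> in M. (s *s f \<xi> - g \<xi> = P1 *v w' \<xi> + P0 \<xi> *v (H \<xi> *v f \<xi>)) = (w' \<xi> = ?rhs \<xi>)"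
      using w w[unfolded state]
    proof eventually_elim
      case (elim \<xi>)
      have "w' \<xi> = ?rhs \<xi> \<longleftrightarrow> w' \<xi> = matrix_inv P1 *v (s *s f \<xi> - P0 \<xi> *v w \<xi> - g \<xi>)"
        by (simp add: ode_mat_mult_vec matrix_vector_mult_diff_distrib flip: elim(2))
      also have "\<dots> \<longleftrightarrow> P1 *v w' \<xi> = s *s f \<xi> - P0 \<xi> *v w \<xi> - g \<xi>"
        by (simp add: invertible_mult_vec_eq_iff[OF P1_invertible])
      also have "\<dots> \<longleftrightarrow> s *s f \<xi> - g \<xi> = P1 *v w' \<xi> + P0 \<xi> *v w \<xi>"
        by (auto simp: algebra_simps)
      finally show ?case by (simp add: elim(1))
    qed
  qed
  show ?thesis
  proof
    assume "resolvent_solution s g f w"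
    then obtain w' where "f \<in> X" "H1 UNIV a b w w'"
        "AE \<xi> in M. H \<xi> *v f \<xi> = w \<xi>" "AE \<xi> in M. w' \<xi> = ?rhs \<xi>"
      using deriv unfolding resolvent_solution_def by blast
    then show "f \<in> X \<and> resolvent_ode s g w \<and> (AE \<xi> in M. f \<xi> = matrix_inv (H \<xi>) *v w \<xi>)"
      unfolding resolvent_ode_def state[symmetric] by (blast intro: H1_AE_cong)
  next
    assume "f \<in> X \<and> resolvent_ode s g w \<and> (AE \<xi> in M. f \<xi> = matrix_inv (H \<xi>) *v w \<xi>)"
    then show "resolvent_solution s g f w"
      unfolding resolvent_ode_def state[symmetric] resolvent_solution_def using deriv[of ?rhs]
      by auto
  qed
qed

end


section \<open>Resolvent set and transfer function\<close>

context hyperbolic_coefficients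
begin

abbreviation Op :: "complex^('n + 'n)^'n \<Rightarrow> ('n state \<times> 'n state) set" where
  "Op W \<equiv> hbcs_operator UNIV a b P1 P0 H W"

lemma Op_iff_resolvent_solution:
  "(f, h) \<in> Op W \<longleftrightarrow>
    h \<in> X \<and> (\<exists>w. resolvent_solution s (\<lambda>\<xi>. s *s f \<xi> - h \<xi>) f w \<and> W *v vstack (w b) (w a) = 0)"
  by (auto simp: hbcs_operator_def resolvent_solution_def)

lemma bvp_solution_iff_resolvent_solution:
  "bvp_solution a b P1 P0 H W s u f w \<longleftrightarrow>
    resolvent_solution s (\<lambda>_. 0) f w \<and> u = W *v vstack (w b) (w a)"
  by (auto simp: bvp_solution_def resolvent_solution_def)

definition mode :: "complex \<Rightarrow> complex^'n \<Rightarrow> 'n state" where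
  "mode s v = (\<lambda>\<xi>. matrix_inv (H \<xi>) *v (\<Psi> s \<xi> *v v))"

lemma mode_closed: "mode s v \<in> X"
  unfolding mode_def by (intro L2_Linf_mat H_inv_Linf L2_continuous continuous_on_\<Psi>_mult_vec)

lemma linear_mode: "linear (\<lambda>v. mode s v \<xi>)"
  by (auto intro!: linearI
      simp: mode_def matrix_vector_right_distrib matrix_vector_mult.scaleR_right)

lemma mode_resolvent_solution: "resolvent_solution s (\<lambda>_. 0) (mode s v) (\<lambda>\<zeta>. \<Psi> s \<zeta> *v v)"
  using mode_closed by (simp add: resolvent_solution_iff resolvent_ode_homogeneous mode_def)

lemma resolvent_solution_homogeneous:
  assumes "resolvent_solution s (\<lambda>_. 0) f w"
  shows "\<zeta> \<in> {a..b} \<Longrightarrow> w \<zeta> = \<Psi> s \<zeta> *v w a" and "AE \<xi> in M. f \<xi> = mode s (w a) \<xi>"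
proof -
  have w: "resolvent_ode s (\<lambda>_. 0) w" and f: "AE \<xi> in M. f \<xi> = matrix_inv (H \<xi>) *v w \<xi>"
    using assms by (simp_all add: resolvent_solution_iff)
  show "w \<zeta> = \<Psi> s \<zeta> *v w a" if "\<zeta> \<in> {a..b}" for \<zeta> by (rule homogeneous_solution[OF w that])
  then have "AE \<xi> in M. w \<xi> = \<Psi> s \<xi> *v w a" by (rule AE_lebesgue_on_IccI)
  with f show "AE \<xi> in M. f \<xi> = mode s (w a) \<xi>" by eventually_elim (simp add: mode_def)
qed

lemma nrm_mode_eq_0:
  assumes "nrm (mode s v) = 0"
  shows "v = 0"
proof -
  have "AE \<xi> in M. mode s v \<xi> = 0" using assms by (simp add: nrm_eq_0_iff mode_closed)
  with H_invertible have "AE \<xi> in M. \<Psi> s \<xi> *v v = 0"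
    by eventually_elim (metis mode_def matrix_inv_vector(1) matrix_vector_mult_0_right)
  then have "\<Psi> s a *v v = 0"
    by (rule continuous_AE_zero_imp_zero[OF continuous_on_\<Psi>_mult_vec _ interval])
      (use interval in simp)
  then show ?thesis by (simp add: \<Psi>_a)
qed

definition boundary_matrix :: "complex^('n + 'n)^'n \<Rightarrow> complex \<Rightarrow> complex^'n^'n" where
  "boundary_matrix W s = W ** vblock (\<Psi> s b) (mat 1)"

lemma boundary_matrix_mult_vec: "boundary_matrix W s *v v = W *v vstack (\<Psi> s b *v v) v"
  by (simp add: boundary_matrix_def vblock_mult_vec flip: matrix_vector_mul_assoc)

lemma mode_eigenfunction:
  assumes "boundary_matrix W s *v v = 0"
  shows "(mode s v, \<lambda>\<xi>. s *s mode s v \<xi>) \<in> Op W"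
  unfolding Op_iff_resolvent_solution[of _ _ W s]
  using assms mode_resolvent_solution[of s v] mode_closed[of s v]
  by (auto simp: boundary_matrix_mult_vec \<Psi>_a L2_vector_smult)

lemma Op_eigenfunction:
  assumes "(f, \<lambda>\<xi>. s *s f \<xi>) \<in> Op W"
  obtains v where "boundary_matrix W s *v v = 0" "AE \<xi> in M. f \<xi> = mode s v \<xi>"
proof -
  obtain w where w: "resolvent_solution s (\<lambda>_. 0) f w" "W *v vstack (w b) (w a) = 0"
    using assms unfolding Op_iff_resolvent_solution[of _ _ W s] by auto
  then have "boundary_matrix W s *v w a = 0"
    using resolvent_solution_homogeneous(1)[OF w(1), of b] interval
    by (simp add: boundary_matrix_mult_vec)
  then show thesis using resolvent_solution_homogeneous(2)[OF w(1)] by (rule that)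
qed

lemma resolvent_set_imp_invertible:
  assumes "s \<in> resolvent_set X nrm (Op W)"
  shows "invertible (boundary_matrix W s)"
  unfolding invertible_iff_ker
proof (intro allI impI)
  fix v assume v: "boundary_matrix W s *v v = 0"
  obtain C where C: "\<forall>(f, h)\<in>Op W. nrm f \<le> C * nrm (\<lambda>\<xi>. s *s f \<xi> - h \<xi>)"
    using assms unfolding resolvent_set_def by blast
  have "nrm (mode s v) \<le> C * nrm (\<lambda>\<xi>. s *s mode s v \<xi> - s *s mode s v \<xi>)"
    using C mode_eigenfunction[OF v] by fast
  also have "\<dots> = 0" by (simp add: nrm_eq_0_iff L2_zero)
  finally show "v = 0" using nrm_nonneg[OF mode_closed] by (intro nrm_mode_eq_0 antisym)
qed

lemma boundary_condition_iff:
  assumes inv: "invertible (boundary_matrix W s)" and g: "g \<in> X"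
    and w: "resolvent_ode s g w" and p: "resolvent_ode s g p" "p a = 0"
  shows "W *v vstack (w b) (w a) = 0 \<longleftrightarrow>
    w a = matrix_inv (boundary_matrix W s) *v (- (W *v vstack (p b) 0))"
proof -
  have "w b = \<Psi> s b *v w a + p b"
    by (rule variation_of_constants[OF g w p]) (use interval in simp)
  then have "vstack (w b) (w a) = vstack (\<Psi> s b *v w a) (w a) + vstack (p b) 0"
    by (simp flip: vstack_add)
  then have "W *v vstack (w b) (w a) = boundary_matrix W s *v w a + W *v vstack (p b) 0"
    by (simp add: boundary_matrix_mult_vec matrix_vector_right_distrib)
  then show ?thesis
    unfolding invertible_mult_vec_eq_iff[OF inv, symmetric] by (simp add: eq_neg_iff_add_eq_0)
qed

lemma resolvent_surjective:
  assumes inv: "invertible (boundary_matrix W s)" and g: "g \<in> X"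
  shows "\<exists>(f, h)\<in>Op W. nrm (\<lambda>\<xi>. (s *s f \<xi> - h \<xi>) - g \<xi>) = 0"
proof -
  obtain p where p: "resolvent_ode s g p" "p a = 0" by (rule resolvent_ode_exists[OF g])
  define v where "v = matrix_inv (boundary_matrix W s) *v (- (W *v vstack (p b) 0))"
  define w where "w = (\<lambda>\<zeta>. \<Psi> s \<zeta> *v v + p \<zeta>)"
  have w: "resolvent_ode s g w"
    using resolvent_ode_add[OF resolvent_ode_homogeneous p(1)] by (simp add: w_def)
  moreover have "w a = v" by (simp add: w_def \<Psi>_a p)
  ultimately have bc: "W *v vstack (w b) (w a) = 0"
    using boundary_condition_iff[OF inv g w p] by (simp add: v_def)
  define f where "f = (\<lambda>\<xi>. matrix_inv (H \<xi>) *v w \<xi>)"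
  define h where "h = (\<lambda>\<xi>. s *s f \<xi> - g \<xi>)"
  have f: "f \<in> X"
    unfolding f_def
    by (intro L2_Linf_mat H_inv_Linf L2_continuous resolvent_ode_continuous_on[OF w])
  then have h: "h \<in> X" unfolding h_def by (intro L2_diff L2_vector_smult g)
  have "resolvent_solution s (\<lambda>\<xi>. s *s f \<xi> - h \<xi>) f w"
    using f w by (simp add: resolvent_solution_iff h_def f_def)
  then have "(f, h) \<in> Op W" using h bc unfolding Op_iff_resolvent_solution[of _ _ W s] by blast
  moreover have "nrm (\<lambda>\<xi>. (s *s f \<xi> - h \<xi>) - g \<xi>) = 0" by (simp add: h_def nrm_eq_0_iff L2_zero)
  ultimately show ?thesis by blast
qed

lemma X_norm_H_inv_le_sup:
  obtains C where "C \<ge> 0" "\<And>f w B. f \<in> X \<Longrightarrow> AE \<xi> in M. f \<xi> = matrix_inv (H \<xi>) *v w \<xi> \<Longrightarrow>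
    B \<ge> 0 \<Longrightarrow> \<forall>\<zeta>\<in>{a..b}. norm (w \<zeta>) \<le> B \<Longrightarrow> nrm f \<le> C * B"
proof -
  obtain D where D: "D \<ge> 0"
      "\<And>f B. f \<in> X \<Longrightarrow> B \<ge> 0 \<Longrightarrow> AE \<xi> in M. norm (f \<xi>) \<le> B \<Longrightarrow> nrm f \<le> D * B"
    by (rule X_norm_le_sup) metis
  obtain E where E: "E \<ge> 0" "AE \<xi> in M. \<forall>x. norm (matrix_inv (H \<xi>) *v x) \<le> E * norm x"
    by (rule Linf_mat_mult_vec_bound[OF H_inv_Linf])
  have "nrm f \<le> (D * E) * B"
    if f: "f \<in> X" "AE \<xi> in M. f \<xi> = matrix_inv (H \<xi>) *v w \<xi>"
      and B: "B \<ge> 0" and w: "\<forall>\<zeta>\<in>{a..b}. norm (w \<zeta>) \<le> B" for f w B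
  proof -
    have "AE \<xi> in M. norm (w \<xi>) \<le> B" by (rule AE_lebesgue_on_IccI) (rule bspec[OF w])
    with f(2) E(2) have "AE \<xi> in M. norm (f \<xi>) \<le> E * B"
      by eventually_elim (metis E(1) mult_left_mono order_trans)
    then show ?thesis using D(2)[OF f(1)] E(1) B by (simp add: mult.assoc)
  qed
  then show thesis using that[of "D * E"] D(1) E(1) by simp
qed

lemma resolvent_bounded:
  assumes inv: "invertible (boundary_matrix W s)"
  shows "\<exists>C. \<forall>(f, h)\<in>Op W. nrm f \<le> C * nrm (\<lambda>\<xi>. s *s f \<xi> - h \<xi>)"
proof -
  obtain C where C: "C \<ge> 0" "\<And>g w \<zeta>. g \<in> X \<Longrightarrow> resolvent_ode s g w \<Longrightarrow> \<zeta> \<in> {a..b} \<Longrightarrow>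
      norm (w \<zeta>) \<le> C * (norm (w a) + nrm g)"
    by (rule resolvent_ode_bound[of s]) metis
  define L where "L y = matrix_inv (boundary_matrix W s) *v (- (W *v vstack y 0))"
    for y :: "complex^'n"
  have "bounded_linear L" unfolding L_def[abs_def]
    by (intro bounded_linear_compose[OF matrix_vector_mul_bounded_linear] bounded_linear_minus
        bounded_linear_compose[OF matrix_vector_mul_bounded_linear bounded_linear_vstack_zero])
  then obtain k where k: "k > 0" "\<And>y. norm (L y) \<le> norm y * k"
    using bounded_linear.pos_bounded by blast
  obtain D where D: "D \<ge> 0"
      "\<And>f w B. f \<in> X \<Longrightarrow> AE \<xi> in M. f \<xi> = matrix_inv (H \<xi>) *v w \<xi> \<Longrightarrow> B \<ge> 0 \<Longrightarrow>
        \<forall>\<zeta>\<in>{a..b}. norm (w \<zeta>) \<le> B \<Longrightarrow> nrm f \<le> D * B"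
    by (rule X_norm_H_inv_le_sup) (rule that)
  have "nrm f \<le> D * (C * (C * k + 1)) * nrm (\<lambda>\<xi>. s *s f \<xi> - h \<xi>)" if fh: "(f, h) \<in> Op W" for f h
  proof -
    let ?g = "\<lambda>\<xi>. s *s f \<xi> - h \<xi>"
    obtain w where w: "resolvent_ode s ?g w" "W *v vstack (w b) (w a) = 0"
      and f: "f \<in> X" "AE \<xi> in M. f \<xi> = matrix_inv (H \<xi>) *v w \<xi>" and h: "h \<in> X"
      using fh unfolding Op_iff_resolvent_solution[of _ _ W s] resolvent_solution_iff by blast
    have g: "?g \<in> X" by (intro L2_diff L2_vector_smult f h)
    obtain p where p: "resolvent_ode s ?g p" "p a = 0" by (rule resolvent_ode_exists[OF g])
    have "norm (p b) \<le> C * nrm ?g" using C(2)[OF g p(1), of b] interval p(2) by simp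
    moreover have "w a = L (p b)" using boundary_condition_iff[OF inv g w(1) p] w(2)
      by (simp add: L_def)
    ultimately have "norm (w a) \<le> C * nrm ?g * k"
      using k(1) by (auto intro: order_trans[OF k(2) mult_right_mono])
    then have "norm (w a) + nrm ?g \<le> (C * k + 1) * nrm ?g" by (simp add: algebra_simps)
    then have "norm (w \<zeta>) \<le> C * ((C * k + 1) * nrm ?g)" if "\<zeta> \<in> {a..b}" for \<zeta>
      using C(2)[OF g w(1) that] C(1) by (meson mult_left_mono order_trans)
    then have "nrm f \<le> D * (C * ((C * k + 1) * nrm ?g))"
      using C(1) k(1) nrm_nonneg[OF g] by (intro D(2)[OF f]) auto
    then show ?thesis by (simp add: mult.assoc)
  qed
  then show ?thesis by blast
qed

lemma resolvent_set_Op_iff: "s \<in> resolvent_set X nrm (Op W) \<longleftrightarrow> invertible (boundary_matrix W s)"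
  using resolvent_set_imp_invertible resolvent_surjective resolvent_bounded
  unfolding resolvent_set_def mem_Collect_eq by blast

lemma bvp_solution_mode:
  assumes inv: "invertible (boundary_matrix W s)"
  defines "v \<equiv> \<lambda>u. matrix_inv (boundary_matrix W s) *v u"
  shows "bvp_solution a b P1 P0 H W s u (mode s (v u)) (\<lambda>\<zeta>. \<Psi> s \<zeta> *v v u)"
    and "bvp_solution a b P1 P0 H W s u f w \<Longrightarrow>
      vstack (w b) (w a) = vstack (\<Psi> s b *v v u) (v u) \<and> (AE \<xi> in M. f \<xi> = mode s (v u) \<xi>)"
proof -
  have "W *v vstack (\<Psi> s b *v v u) (\<Psi> s a *v v u) = u"
    by (simp add: \<Psi>_a v_def matrix_inv_vector[OF inv] flip: boundary_matrix_mult_vec)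
  then show "bvp_solution a b P1 P0 H W s u (mode s (v u)) (\<lambda>\<zeta>. \<Psi> s \<zeta> *v v u)"
    by (simp add: bvp_solution_iff_resolvent_solution mode_resolvent_solution)
  assume "bvp_solution a b P1 P0 H W s u f w"
  then have w: "resolvent_solution s (\<lambda>_. 0) f w" "u = W *v vstack (w b) (w a)"
    by (simp_all add: bvp_solution_iff_resolvent_solution)
  have wb: "w b = \<Psi> s b *v w a"
    by (rule resolvent_solution_homogeneous(1)[OF w(1)]) (use interval in simp)
  then have "w a = v u"
    by (simp add: w(2) v_def matrix_inv_vector[OF inv] flip: boundary_matrix_mult_vec)
  then show "vstack (w b) (w a) = vstack (\<Psi> s b *v v u) (v u) \<and> (AE \<xi> in M. f \<xi> = mode s (v u) \<xi>)"
    using wb resolvent_solution_homogeneous(2)[OF w(1)] by simp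
qed

lemma transfer_function_eq:
  assumes inv: "invertible (boundary_matrix W s)"
  shows "transfer_function a b P1 P0 H W WC s =
    WC ** vblock (\<Psi> s b) (mat 1) ** matrix_inv (boundary_matrix W s)"
proof -
  let ?G = "WC ** vblock (\<Psi> s b) (mat 1) ** matrix_inv (boundary_matrix W s)"
  let ?v = "\<lambda>u. matrix_inv (boundary_matrix W s) *v u"
  note solution = bvp_solution_mode(1)[OF inv] and unique = bvp_solution_mode(2)[OF inv]
  have G: "?G *v u = WC *v vstack (\<Psi> s b *v ?v u) (?v u)" for u
    by (simp add: vblock_mult_vec flip: matrix_vector_mul_assoc)
  show ?thesis unfolding transfer_function_def
  proof (rule the_equality, intro allI)
    fix u
    show "\<exists>f w. bvp_solution a b P1 P0 H W s u f w \<and>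
        (\<forall>f' w'. bvp_solution a b P1 P0 H W s u f' w' \<longrightarrow> (AE \<xi> in M. f' \<xi> = f \<xi>)) \<and>
        ?G *v u = WC *v vstack (w b) (w a)"
      using solution[of u] unique
      by (intro exI[of _ "mode s (?v u)"] exI[of _ "\<lambda>\<zeta>. \<Psi> s \<zeta> *v ?v u"]) (simp add: G \<Psi>_a)
  next
    fix G' assume G': "\<forall>u. \<exists>f w. bvp_solution a b P1 P0 H W s u f w \<and>
        (\<forall>f' w'. bvp_solution a b P1 P0 H W s u f' w' \<longrightarrow> (AE \<xi> in M. f' \<xi> = f \<xi>)) \<and>
        G' *v u = WC *v vstack (w b) (w a)"
    have "G' *v u = ?G *v u" for u using G' unique unfolding G by metis
    then show "G' = ?G" by (simp add: matrix_eq)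
  qed
qed

lemma invertible_boundary_matrix_half_plane:
  assumes C0: "C0_semigroup UNIV X nrm T" and gen: "generator X nrm T = Op W"
  obtains \<omega> where "\<And>s. Re s > \<omega> \<Longrightarrow> invertible (boundary_matrix W s)"
proof -
  interpret strongly_continuous_semigroup UNIV M X nrm T by unfold_locales (rule C0)
  obtain C where C: "C \<ge> 0" "\<And>f. f \<in> X \<Longrightarrow> nrm (T 1 f) \<le> C * nrm f"
    by (rule T_bounded[of 1]) (simp, rule that)
  have "invertible (boundary_matrix W s)" if s: "Re s > max C 1" for s
    unfolding invertible_iff_ker
  proof (intro allI impI)
    fix v assume v: "boundary_matrix W s *v v = 0"
    interpret finite_dimensional_eigenspace UNIV M X nrm T s "mode s"
    proof (intro finite_dimensional_eigenspace.intro finite_dimensional_eigenspace_axioms.intro)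
      show "\<exists>v. AE \<xi> in M. f \<xi> = mode s v \<xi>" if "eigenfunction s f" for f
        using Op_eigenfunction that unfolding eigenfunction_def gen by metis
    qed (simp_all add: strongly_continuous_semigroup_axioms mode_closed linear_mode nrm_mode_eq_0)
    have "eigenfunction s (mode s v)"
      unfolding eigenfunction_def gen by (rule mode_eigenfunction[OF v])
    then have "Re s * nrm (mode s v) \<le> nrm (T 1 (mode s v))"
      using s by (intro eigenfunction_growth) auto
    also have "\<dots> \<le> C * nrm (mode s v)" by (intro C(2) mode_closed)
    finally have "(Re s - C) * nrm (mode s v) \<le> 0" by (simp add: algebra_simps)
    then have "nrm (mode s v) \<le> 0" using s by (simp add: mult_le_0_iff)
    then show "v = 0" using nrm_nonneg[OF mode_closed] by (intro nrm_mode_eq_0 antisym)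
  qed
  then show thesis by (rule that)
qed

end


section \<open>The complexified operator\<close>

context hyperbolic_coefficients
begin

lemma Op_add_smult:
  assumes "(f, g) \<in> Op W" "(f', g') \<in> Op W"
  shows "(\<lambda>\<xi>. f \<xi> + c *s f' \<xi>, \<lambda>\<xi>. g \<xi> + c *s g' \<xi>) \<in> Op W"
proof -
  obtain w w' v v' where w: "f \<in> X" "g \<in> X" "H1 UNIV a b w w'" "AE \<xi> in M. H \<xi> *v f \<xi> = w \<xi>"
      "W *v vstack (w b) (w a) = 0" "AE \<xi> in M. g \<xi> = P1 *v w' \<xi> + P0 \<xi> *v (H \<xi> *v f \<xi>)"
    and v: "f' \<in> X" "g' \<in> X" "H1 UNIV a b v v'" "AE \<xi> in M. H \<xi> *v f' \<xi> = v \<xi>"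
      "W *v vstack (v b) (v a) = 0" "AE \<xi> in M. g' \<xi> = P1 *v v' \<xi> + P0 \<xi> *v (H \<xi> *v f' \<xi>)"
    using assms by (auto simp: hbcs_operator_def)
  let ?u = "\<lambda>\<xi>. w \<xi> + c *s v \<xi>" and ?u' = "\<lambda>\<xi>. w' \<xi> + c *s v' \<xi>"
  let ?f = "\<lambda>\<xi>. f \<xi> + c *s f' \<xi>"
  have "H1 UNIV a b ?u ?u'"
    by (intro H1_add[OF w(3)] H1_bounded_linear[OF bounded_linear_vector_smult v(3)]) simp
  moreover have "AE \<xi> in M. H \<xi> *v ?f \<xi> = ?u \<xi>"
    using w(4) v(4)
    by eventually_elim (simp add: matrix_vector_right_distrib vector_scalar_commute)
  moreover have "W *v vstack (?u b) (?u a) = 0"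
    using w(5) v(5)
    by (simp add: vstack_add vstack_smult matrix_vector_right_distrib vector_scalar_commute)
  moreover have "AE \<xi> in M. g \<xi> + c *s g' \<xi> = P1 *v ?u' \<xi> + P0 \<xi> *v (H \<xi> *v ?f \<xi>)"
    using w(6) v(6)
    by eventually_elim
      (simp add: matrix_vector_right_distrib vector_scalar_commute vector_add_ldistrib)
  ultimately show ?thesis
    unfolding hbcs_operator_def using L2_add L2_vector_smult w(1,2) v(1,2) by blast
qed

end

locale real_hyperbolic_coefficients = hyperbolic_coefficients a b P1 P0 H
  for a b and P1 :: "complex^'n^('n::finite)" and P0 H +
  assumes P1_real: "P1 \<in> Fmat \<real>"
    and P0_real: "AE \<xi> in M. P0 \<xi> \<in> Fmat \<real>" and H_real: "AE \<xi> in M. H \<xi> \<in> Fmat \<real>"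
begin

abbreviation OpR :: "complex^('n + 'n)^'n \<Rightarrow> ('n state \<times> 'n state) set" where
  "OpR W \<equiv> hbcs_operator \<real> a b P1 P0 H W"

lemma OpR_subset: "OpR W \<subseteq> Op W"
proof
  fix p assume "p \<in> OpR W"
  then show "p \<in> Op W"
    unfolding hbcs_operator_def by (auto simp: L2_iff[of _ \<real>] intro: H1_UNIV)
qed

lemma L2_re_vec: "f \<in> X \<Longrightarrow> (\<lambda>\<xi>. re_vec (f \<xi>)) \<in> L2 \<real> a b"
  by (simp add: L2_iff[of _ \<real>] L2_bounded_linear[OF bounded_linear_re_vec])

lemma nrm_re_vec_le:
  assumes f: "f \<in> X"
  shows "nrm (\<lambda>\<xi>. re_vec (f \<xi>)) \<le> nrm f"
proof -
  have re: "(\<lambda>\<xi>. re_vec (f \<xi>)) \<in> X" by (rule L2_bounded_linear[OF bounded_linear_re_vec f])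
  have "AE \<xi> in M. (H \<xi> *v re_vec (f \<xi>)) \<bullet> re_vec (f \<xi>) \<le> (H \<xi> *v f \<xi>) \<bullet> f \<xi>"
    using H_real H_nonneg
  proof eventually_elim
    case (elim \<xi>)
    then show ?case using inner_re_vec_im_vec[of "H \<xi>" "f \<xi>"] by simp
  qed
  then have "energy (\<lambda>\<xi>. re_vec (f \<xi>)) (\<lambda>\<xi>. re_vec (f \<xi>)) \<le> energy f f"
    unfolding energy_def by (intro mult_left_mono integral_mono_AE integrable_energy re f) auto
  then show ?thesis by (simp add: X_norm_eq_sqrt_energy re f)
qed

lemma Op_re_vec:
  assumes W: "W \<in> Fmat \<real>" and fg: "(f, g) \<in> Op W"
  shows "(\<lambda>\<xi>. re_vec (f \<xi>), \<lambda>\<xi>. re_vec (g \<xi>)) \<in> OpR W"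
proof -
  obtain w w' where w: "f \<in> X" "g \<in> X" "H1 UNIV a b w w'" "AE \<xi> in M. H \<xi> *v f \<xi> = w \<xi>"
      "W *v vstack (w b) (w a) = 0" "AE \<xi> in M. g \<xi> = P1 *v w' \<xi> + P0 \<xi> *v (H \<xi> *v f \<xi>)"
    using fg by (auto simp: hbcs_operator_def)
  note linear = bounded_linear.linear[OF bounded_linear_re_vec]
  have "H1 \<real> a b (\<lambda>\<xi>. re_vec (w \<xi>)) (\<lambda>\<xi>. re_vec (w' \<xi>))"
    by (rule H1_bounded_linear[OF bounded_linear_re_vec w(3)]) auto
  moreover have "AE \<xi> in M. H \<xi> *v re_vec (f \<xi>) = re_vec (w \<xi>)"
    using w(4) H_real by eventually_elim (metis re_vec_matrix_vector_mult)
  moreover have "W *v vstack (re_vec (w b)) (re_vec (w a)) = 0"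
    using w(5) by (simp add: re_vec_vstack linear_0[OF linear]
        flip: re_vec_matrix_vector_mult[OF W])
  moreover have "AE \<xi> in M. re_vec (g \<xi>) = P1 *v re_vec (w' \<xi>) + P0 \<xi> *v (H \<xi> *v re_vec (f \<xi>))"
    using w(6) H_real P0_real
    by eventually_elim
      (simp add: linear_add[OF linear] re_vec_matrix_vector_mult P1_real)
  ultimately show ?thesis unfolding hbcs_operator_def using L2_re_vec w(1,2) by blast
qed

lemma complexification_OpR:
  assumes W: "W \<in> Fmat \<real>"
  shows "complexification \<real> (OpR W) = Op W"
proof (intro subset_antisym subsetI)
  fix p assume "p \<in> complexification \<real> (OpR W)"
  then obtain f1 f2 g1 g2 where "(f1, g1) \<in> OpR W" "(f2, g2) \<in> OpR W"
      and p: "p = (\<lambda>\<xi>. f1 \<xi> + \<i> *s f2 \<xi>, \<lambda>\<xi>. g1 \<xi> + \<i> *s g2 \<xi>)"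
    unfolding complexification_def if_P[OF refl] by blast
  then show "p \<in> Op W" unfolding p using OpR_subset by (intro Op_add_smult) blast+
next
  fix p assume p: "p \<in> Op W"
  obtain f g where fg: "p = (f, g)" by (cases p)
  let ?re = "\<lambda>f \<xi>. re_vec (f \<xi>)" and ?im = "\<lambda>f \<xi>. im_vec (f \<xi>)"
  have "(\<lambda>\<xi>. f \<xi> + (- 1 - \<i>) *s f \<xi>, \<lambda>\<xi>. g \<xi> + (- 1 - \<i>) *s g \<xi>) \<in> Op W"
    using p by (intro Op_add_smult) (simp_all add: fg)
  then have "(\<lambda>\<xi>. (- \<i>) *s f \<xi>, \<lambda>\<xi>. (- \<i>) *s g \<xi>) \<in> Op W"
    by (simp add: vec_eq_iff algebra_simps)
  from Op_re_vec[OF W this] have im: "(?im f, ?im g) \<in> OpR W"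
    by (simp add: im_vec_eq_re_vec)
  have re: "(?re f, ?re g) \<in> OpR W" using Op_re_vec[OF W] p by (simp add: fg)
  have "p = (\<lambda>\<xi>. ?re f \<xi> + \<i> *s ?im f \<xi>, \<lambda>\<xi>. ?re g \<xi> + \<i> *s ?im g \<xi>)"
    by (simp add: fg re_vec_add_im_vec)
  with re im show "p \<in> complexification \<real> (OpR W)"
    unfolding complexification_def if_P[OF refl] mem_Collect_eq
    by (intro exI[of _ "?re f"] exI[of _ "?im f"] exI[of _ "?re g"] exI[of _ "?im g"] conjI)
qed

lemma generates_C0_semigroup_complexification:
  assumes "generates_C0_semigroup \<real> (L2 \<real> a b) nrm A"
  shows "generates_C0_semigroup UNIV X nrm (complexification \<real> A)"
proof -
  obtain T where T: "C0_semigroup \<real> (L2 \<real> a b) nrm T" "generator (L2 \<real> a b) nrm T = A"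
    using assms unfolding generates_C0_semigroup_def by blast
  interpret real: function_space \<real> M "L2 \<real> a b" nrm by (rule function_space_L2) simp
  interpret complexified_semigroup M X "L2 \<real> a b" nrm T
    by unfold_locales
      (auto simp: T(1) L2_iff[of _ \<real>] nrm_re_vec_le L2_bounded_linear[OF bounded_linear_re_vec])
  show ?thesis
    using C0_semigroup_T_complex generator_T_complex T(2) unfolding generates_C0_semigroup_def
    by blast
qed

end


section \<open>The transfer function of a hyperbolic boundary control system\<close>

lemma loewner_le_coercive:
  assumes F: "F = \<real> \<or> F = UNIV" and A: "A \<in> Fmat F"
    and loewner: "loewner_le F (mat (complex_of_real m)) A"
  shows "coercive m A"
  unfolding coercive_def
proof
  fix x
  have scalar: "m * (norm v)\<^sup>2 \<le> (A *v v) \<bullet> v" if "v \<in> Fvec F" for v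
  proof -
    have "0 \<le> ((A - mat (complex_of_real m)) *v v) \<bullet> v"
      using loewner that by (simp add: loewner_le_def inner_eq_Re_cinner)
    then show ?thesis
      by (simp add: matrix_vector_mult_diff_rdistrib mat_mult_vec of_real_vector_smult
          inner_diff_left dot_square_norm)
  qed
  show "m * (norm x)\<^sup>2 \<le> (A *v x) \<bullet> x"
  proof (cases "F = \<real>")
    case True
    then show ?thesis
      using scalar[of "re_vec x"] scalar[of "im_vec x"] inner_re_vec_im_vec[of A x]
        norm_re_vec_im_vec[of x] A
      by (simp add: distrib_left)
  next
    case False
    then show ?thesis using scalar F by simp
  qed
qed

lemma hblock_Fmat: "A \<in> Fmat F \<Longrightarrow> B \<in> Fmat F \<Longrightarrow> hblock A B \<in> Fmat F"
  by (auto simp: Fmat_def hblock_def vstack_def split: sum.split)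

lemma Linf_mat_UNIV: "P \<in> Linf_mat F a b \<Longrightarrow> P \<in> Linf_mat UNIV a b"
  by (simp add: Linf_mat_def)

sublocale hbcs \<subseteq> hyperbolic_coefficients a b P1 P0 H
proof
  show "P0 \<in> Linf_mat UNIV a b" "H \<in> Linf_mat UNIV a b"
    using P0_Linf H_Linf by (auto intro: Linf_mat_UNIV)
  have HF: "AE \<xi> in lebesgue_on {a..b}. H \<xi> \<in> Fmat F" using H_Linf by (simp add: Linf_mat_def)
  obtain m where m: "m > 0"
      "AE \<xi> in lebesgue_on {a..b}. loewner_le F (mat (complex_of_real m)) (H \<xi>)"
    using H_bounds by (auto elim!: eventually_mono)
  have "AE \<xi> in lebesgue_on {a..b}. coercive m (H \<xi>)"
    using HF m(2) by eventually_elim (rule loewner_le_coercive[OF field])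
  then show "\<exists>m>0. AE \<xi> in lebesgue_on {a..b}. coercive m (H \<xi>)"
    using m(1) by blast
qed (rule interval P1_invertible H_self_adjoint)+

context hbcs
begin

lemma real_hyperbolic_coefficients:
  "F = \<real> \<Longrightarrow> real_hyperbolic_coefficients a b P1 P0 H"
  using P1_mat P0_Linf H_Linf by unfold_locales (auto simp: Linf_mat_def)

lemma complexification_Op:
  assumes W: "W \<in> Fmat F"
  shows "complexification F (hbcs_operator F a b P1 P0 H W) = Op W"
proof (cases "F = \<real>")
  case True
  interpret real_hyperbolic_coefficients a b P1 P0 H
    by (rule real_hyperbolic_coefficients[OF True])
  show ?thesis using complexification_OpR W True by simp
next
  case False
  then show ?thesis using field by (auto simp: complexification_def)
qed

lemma generates_C0_semigroup_Op: "generates_C0_semigroup UNIV X nrm (Op WB)"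
proof (cases "F = \<real>")
  case True
  interpret real_hyperbolic_coefficients a b P1 P0 H
    by (rule real_hyperbolic_coefficients[OF True])
  show ?thesis
    using generates_C0_semigroup_complexification generates complexification_Op[OF WB_mat] True
    by metis
next
  case False
  then show ?thesis using field generates by auto
qed

lemma hbcs_resolvent_set_iff:
  "W \<in> Fmat F \<Longrightarrow> s \<in> hbcs_resolvent_set F a b P1 P0 H W \<longleftrightarrow> invertible (boundary_matrix W s)"
  by (simp add: hbcs_resolvent_set_def complexification_Op resolvent_set_Op_iff)

lemma half_plane_subset_resolvent_set:
  obtains \<omega> where "right_half_plane \<omega> \<subseteq> hbcs_resolvent_set F a b P1 P0 H WB"
proof -
  obtain T where "C0_semigroup UNIV X nrm T" "generator X nrm T = Op WB"
    using generates_C0_semigroup_Op unfolding generates_C0_semigroup_def by blast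
  then obtain \<omega> where "\<And>s. Re s > \<omega> \<Longrightarrow> invertible (boundary_matrix WB s)"
    by (rule invertible_boundary_matrix_half_plane) (rule that)
  then show thesis
    by (intro that[of \<omega>]) (auto simp: right_half_plane_def hbcs_resolvent_set_iff[OF WB_mat])
qed

lemma Q_mat_Fmat: "Q_mat F P1 \<sigma> \<in> Fmat F"
  using field P1_mat P1_self_adjoint Q_mat_Reals by auto

lemma V_fun_eq_boundary_matrix:
  "V_fun F a b P1 P0 H s = boundary_matrix (hblock (Q_plus F P1) (Q_minus F P1)) s"
  by (simp add: matrix_eq V_fun_def boundary_matrix_mult_vec hblock_mult_vstack
      matrix_vector_mult_add_rdistrib add.commute flip: matrix_vector_mul_assoc)

lemma boundary_matrix_factorization:
  fixes K M :: "complex^'n^'n"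
  assumes WB: "WB = K ** hblock (Q_plus F P1 - M ** Q_minus F P1) (Q_minus F P1 - M ** Q_plus F P1)"
    and V: "invertible (V_fun F a b P1 P0 H s)"
  shows "boundary_matrix WB s =
      K ** ((mat 1 - M ** U_fun F a b P1 P0 H s) ** V_fun F a b P1 P0 H s)"
proof -
  let ?V = "V_fun F a b P1 P0 H s" and ?U = "U_fun F a b P1 P0 H s"
  let ?Qp = "Q_plus F P1" and ?Qm = "Q_minus F P1"
  have UV: "?U ** ?V = ?Qp + ?Qm ** \<Psi> s b"
    by (simp add: U_fun_def matrix_inv_left[OF V] flip: matrix_mul_assoc)
  have "((mat 1 - M ** ?U) ** ?V) *v v = (?Qp - M ** ?Qm) *v (\<Psi> s b *v v) + (?Qm - M ** ?Qp) *v v"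
      for v
  proof -
    have "((mat 1 - M ** ?U) ** ?V) *v v = ?V *v v - M *v ((?U ** ?V) *v v)"
      by (simp add: matrix_vector_mult_diff_rdistrib flip: matrix_vector_mul_assoc)
    also have "\<dots> = (?Qp - M ** ?Qm) *v (\<Psi> s b *v v) + (?Qm - M ** ?Qp) *v v"
      unfolding UV by (simp add: V_fun_def matrix_vector_mult_add_rdistrib
          matrix_vector_mult_diff_rdistrib matrix_vector_right_distrib
          flip: matrix_vector_mul_assoc)
    finally show ?thesis .
  qed
  then show ?thesis
    by (simp add: matrix_eq boundary_matrix_mult_vec WB hblock_mult_vstack
        flip: matrix_vector_mul_assoc)
qed

lemma transfer_function_formula:
  fixes K M :: "complex^'n^'n"
  assumes WB: "WB = K ** hblock (Q_plus F P1 - M ** Q_minus F P1) (Q_minus F P1 - M ** Q_plus F P1)"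
    and K: "invertible K"
    and s: "s \<in> hbcs_resolvent_set F a b P1 P0 H WB"
      "s \<in> hbcs_resolvent_set F a b P1 P0 H (hblock (Q_plus F P1) (Q_minus F P1))"
  shows "invertible (V_fun F a b P1 P0 H s)"
    and "invertible (mat 1 - M ** U_fun F a b P1 P0 H s)"
    and "transfer_function a b P1 P0 H WB WC s =
      Z_fun F a b P1 P0 H WC s ** matrix_inv (mat 1 - M ** U_fun F a b P1 P0 H s) ** matrix_inv K"
proof -
  let ?V = "V_fun F a b P1 P0 H s" and ?D = "mat 1 - M ** U_fun F a b P1 P0 H s"
  have "hblock (Q_plus F P1) (Q_minus F P1) \<in> Fmat F" by (intro hblock_Fmat Q_mat_Fmat)
  then show V: "invertible ?V" using s(2)
    by (simp add: hbcs_resolvent_set_iff V_fun_eq_boundary_matrix)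
  have N: "invertible (boundary_matrix WB s)" using s(1)
    by (simp add: hbcs_resolvent_set_iff WB_mat)
  note factorization = boundary_matrix_factorization[OF WB V]
  show D: "invertible ?D"
    using N unfolding factorization by (simp add: invertible_det_nz det_mul)
  show "transfer_function a b P1 P0 H WB WC s =
      Z_fun F a b P1 P0 H WC s ** matrix_inv ?D ** matrix_inv K"
    using transfer_function_eq[OF N, of WC]
    by (simp add: factorization matrix_inv_mult K D V invertible_mult Z_fun_def matrix_mul_assoc)
qed

end

theorem lemma16:
  fixes F :: "complex set" and a b \<alpha> :: real
    and P1 :: "complex^'n^('n::finite)"
    and P0 H :: "real \<Rightarrow> complex^'n^'n"
    and WB WC :: "complex^('n + 'n)^'n"
    and K M :: "complex^'n^'n"
  assumes "hbcs F a b P1 P0 H WB WC"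
    and "K \<in> Fmat F" and "M \<in> Fmat F" and "invertible K"
    and "WB = K ** hblock (Q_plus F P1 - M ** Q_minus F P1) (Q_minus F P1 - M ** Q_plus F P1)"
    and "right_half_plane \<alpha> \<subseteq> hbcs_resolvent_set F a b P1 P0 H (hblock (Q_plus F P1) (Q_minus F P1))"
  shows "(\<forall>s \<in> hbcs_resolvent_set F a b P1 P0 H WB \<inter> right_half_plane \<alpha>.
            invertible (V_fun F a b P1 P0 H s) \<and>
            invertible (mat 1 - M ** U_fun F a b P1 P0 H s) \<and>
            transfer_function a b P1 P0 H WB WC s =
              Z_fun F a b P1 P0 H WC s ** matrix_inv (mat 1 - M ** U_fun F a b P1 P0 H s) ** matrix_inv K) \<and>
         (\<exists>\<alpha>'\<ge>\<alpha>. right_half_plane \<alpha>' \<subseteq> hbcs_resolvent_set F a b P1 P0 H WB \<inter> right_half_plane \<alpha> \<and>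
            (\<forall>s \<in> right_half_plane \<alpha>'.
               transfer_function a b P1 P0 H WB WC s =
                 Z_fun F a b P1 P0 H WC s ** matrix_inv (mat 1 - M ** U_fun F a b P1 P0 H s) ** matrix_inv K))"
proof -
  interpret hbcs F a b P1 P0 H WB WC by (rule assms(1))
  note formula = transfer_function_formula[OF assms(5,4)]
  have resolvent: "s \<in> hbcs_resolvent_set F a b P1 P0 H (hblock (Q_plus F P1) (Q_minus F P1))"
    if "s \<in> right_half_plane \<alpha>" for s
    using assms(6) that by blast
  obtain \<omega> where \<omega>: "right_half_plane \<omega> \<subseteq> hbcs_resolvent_set F a b P1 P0 H WB"
    by (rule half_plane_subset_resolvent_set)
  have "right_half_plane (max \<alpha> \<omega>) \<subseteq> right_half_plane \<alpha> \<inter> right_half_plane \<omega>"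
    by (auto simp: right_half_plane_def)
  with \<omega> have subset: "right_half_plane (max \<alpha> \<omega>) \<subseteq>
      hbcs_resolvent_set F a b P1 P0 H WB \<inter> right_half_plane \<alpha>"
    by blast
  show ?thesis
  proof (intro conjI ballI exI[of _ "max \<alpha> \<omega>"])
    fix s assume "s \<in> right_half_plane (max \<alpha> \<omega>)"
    then show "transfer_function a b P1 P0 H WB WC s = Z_fun F a b P1 P0 H WC s **
        matrix_inv (mat 1 - M ** U_fun F a b P1 P0 H s) ** matrix_inv K"
      using subset formula(3) resolvent by blast
  qed (use formula resolvent subset in auto)
qed

end
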